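(* Let $A$ be a local ring with maximal ideal $\mathfrak{m}$, $M$ a finitely generated $A$-module, $\mathfrak{a}$ an ideal of $A$ with $l(M/\mathfrak{a}M)<\infty$, and $a_1,\ldots,a_r$ ($r\ge 1$) a system of parameters of $M$ whose elements lie in $\mathfrak{a}$; put $\mathfrak{q}=(a_1,\ldots,a_r)$. Then for all $n\ge 0$, $$l(M/\mathfrak{a}^{n+1}M)\le\sum_{i=0}^{r}\binom{n+r-i-1}{r-i}e_i(\mathfrak{q};M)+\binom{n+r-1}{r-1}\,l\big(M/(\mathfrak{a}M+(O_M:\mathfrak{q}^n))\big).$$ Equality holds for an infinite sequence of integers $n\ge 0$ if and only if the following conditions are all satisfied: (i) $\mathfrak{q}^n\mathfrak{a}M=\mathfrak{a}^{n+1}M$ for some $n\ge 1$. (ii) $a_1,\ldots,a_r$ is an absolutely superficial $M$-sequence. (iii) For every permutation $\sigma$ of $\{1,\ldots,r\}$, $(a_{\sigma(1)},\ldots,a_{\sigma(r-1)})M:a_{\sigma(r)}\subseteq\mathfrak{a}M+\bigcup_{m=1}^{\infty}(O_M:\mathfrak{m}^m)$.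
   Context: Local rings are commutative and Noetherian; $l(\cdot)$ denotes length. For a submodule $N$ of a module $L$, $a\in A$ and an ideal $\mathfrak{b}$: $N:a=\{x\in L: ax\in N\}$, $N:\mathfrak{b}=\{x\in L:\mathfrak{b}x\subseteq N\}$; $O_M$ is the zero submodule of $M$. For $a_1,\ldots,a_r\in\mathfrak{m}$ put $\mathfrak{q}_i=(a_1,\ldots,a_i)$, $\mathfrak{q}_0=0$, $\mathfrak{q}=\mathfrak{q}_r$; $\mathfrak{q}^0=A$. Binomial coefficients: $\binom{k}{0}=1$ for every integer $k\geq -1$, and $\binom{k-1}{k}=0$ for $k\ge1$. The integers $e_i(\mathfrak{q};M)$ (which depend on the sequence $a_1,\ldots,a_r$) are defined by $$e_0(\mathfrak{q};M)=l(M/\mathfrak{q}M)-l\big((\mathfrak{q}_{r-1}M:a_r)/((\mathfrak{q}_{r-1}M:a_r)\cap\mathfrak{q}M)\big),$$ $$e_i(\mathfrak{q};M)=l\big((\mathfrak{q}_{r-i}M:a_{r-i+1})/((\mathfrak{q}_{r-i}M:a_{r-i+1})\cap\mathfrak{q}M)\big)-l\big((\mathfrak{q}_{r-i-1}M:a_{r-i})/((\mathfrak{q}_{r-i-1}M:a_{r-i})\cap\mathfrak{q}M)\big)\quad(0<i<r),$$ $$e_r(\mathfrak{q};M)=l\big((O_M:a_1)/((O_M:a_1)\cap\mathfrak{q}M)\big).$$ The sequence $a_1,\ldots,a_r$ is an absolutely superficial $M$-sequence if for each $i=1,\ldots,r$, with $M_{i-1}:=M/\mathfrak{q}_{i-1}M$,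 one has $(\mathfrak{q}^{n+1}M_{i-1}:a_i)\cap\mathfrak{q}M_{i-1}=\mathfrak{q}^nM_{i-1}$ for all sufficiently large $n$. *)

theory Defs
  imports
    "HOL-Algebra.Module"
    "HOL-Algebra.Ideal_Product"
    "HOL-Algebra.Ring_Divisibility"
    "HOL-Combinatorics.Permutations"
    "HOL-Library.Extended_Nat"
begin

locale noetherian_local_ring =
  cring R + noetherian_ring R + maximalideal \<mm> R for R (structure) and \<mm> +
  assumes unique_maximalideal: "maximalideal J R \<Longrightarrow> J = \<mm>"

abbreviation ideal_power :: "('a, 'c) ring_scheme \<Rightarrow> 'a set \<Rightarrow> nat \<Rightarrow> 'a set"
  where "ideal_power R I n \<equiv> I [^]\<^bsub>ideals_set R\<^esub> n"


subsection \<open>Submodules and quotient modules\<close>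

definition submodule_span ::
    "('a, 'c) ring_scheme \<Rightarrow> ('a, 'b, 'd) module_scheme \<Rightarrow> 'b set \<Rightarrow> 'b set"
  where "submodule_span R M S = \<Inter>{N. submodule N R M \<and> S \<subseteq> N}"

definition finitely_generated_module ::
    "('a, 'c) ring_scheme \<Rightarrow> ('a, 'b, 'd) module_scheme \<Rightarrow> bool"
  where "finitely_generated_module R M \<longleftrightarrow>
    Module.module R M \<and> (\<exists>S. finite S \<and> S \<subseteq> carrier M \<and> carrier M = submodule_span R M S)"

text \<open>The submodule \<open>I M\<close>.\<close>

definition ideal_smult ::
    "('a, 'c) ring_scheme \<Rightarrow> 'a set \<Rightarrow> ('a, 'b, 'd) module_scheme \<Rightarrow> 'b set"
  where "ideal_smult R I M = submodule_span R M {b \<odot>\<^bsub>M\<^esub> x | b x. b \<in> I \<and> x \<in> carrier M}"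

definition colon_elem :: "('a, 'b, 'd) module_scheme \<Rightarrow> 'b set \<Rightarrow> 'a \<Rightarrow> 'b set"
  where "colon_elem M N b = {x \<in> carrier M. b \<odot>\<^bsub>M\<^esub> x \<in> N}"

definition colon_ideal :: "('a, 'b, 'd) module_scheme \<Rightarrow> 'b set \<Rightarrow> 'a set \<Rightarrow> 'b set"
  where "colon_ideal M N I = {x \<in> carrier M. \<forall>b \<in> I. b \<odot>\<^bsub>M\<^esub> x \<in> N}"

text \<open>
  The record type of modules extends that of rings; the fields \<^const>\<open>monoid.mult\<close> and \<^const>\<open>one\<close>
  play no role for a module and are left unspecified. A quotient \<open>N / L\<close> of a submodule \<open>N\<close> of
  \<open>M\<close> is written \<^term>\<open>quot_module (M\<lparr>carrier := N\<rparr>) L\<close>.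
\<close>

definition quot_module :: "('a, 'b, 'd) module_scheme \<Rightarrow> 'b set \<Rightarrow> ('a, 'b set) module"
  where "quot_module M N =
    \<lparr>carrier = a_rcosets\<^bsub>M\<^esub> N, monoid.mult = undefined, one = undefined, zero = N, add = set_add M,
     smult = (\<lambda>b X. \<Union>x\<in>X. N +>\<^bsub>M\<^esub> (b \<odot>\<^bsub>M\<^esub> x))\<rparr>"

lemma quot_module_smult:
  assumes "Module.module R M" "submodule N R M" "b \<in> carrier R" "x \<in> carrier M"
  shows "b \<odot>\<^bsub>quot_module M N\<^esub> (N +>\<^bsub>M\<^esub> x) = N +>\<^bsub>M\<^esub> (b \<odot>\<^bsub>M\<^esub> x)"
proof -
  interpret Module.module R M by fact
  interpret N: submodule N R M by fact
  interpret abelian_subgroup N M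
    by (intro abelian_subgroupI3 additive_subgroup.intro N.subgroup_axioms M.abelian_group_axioms)
  have "N +>\<^bsub>M\<^esub> (b \<odot>\<^bsub>M\<^esub> y) = N +>\<^bsub>M\<^esub> (b \<odot>\<^bsub>M\<^esub> x)" if y: "y \<in> N +>\<^bsub>M\<^esub> x" for y
  proof -
    obtain h where h: "h \<in> N" "y = h \<oplus>\<^bsub>M\<^esub> x"
      using y by (auto simp: a_r_coset_def r_coset_def)
    then have "b \<odot>\<^bsub>M\<^esub> y = b \<odot>\<^bsub>M\<^esub> h \<oplus>\<^bsub>M\<^esub> b \<odot>\<^bsub>M\<^esub> x"
      using assms(3,4) a_Hcarr by (simp add: smult_r_distr)
    moreover have "b \<odot>\<^bsub>M\<^esub> h \<in> N"
      using assms(3) h(1) by (rule N.smult_closed)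
    ultimately have "b \<odot>\<^bsub>M\<^esub> y \<in> N +>\<^bsub>M\<^esub> (b \<odot>\<^bsub>M\<^esub> x)"
      unfolding a_r_coset_def r_coset_def by auto
    then show ?thesis
      by (rule a_repr_independence'[symmetric]) (rule smult_closed[OF assms(3,4)])
  qed
  moreover have "x \<in> N +>\<^bsub>M\<^esub> x"
    using assms(4) by (rule a_rcos_self)
  ultimately have "(\<Union>y\<in>N +>\<^bsub>M\<^esub> x. N +>\<^bsub>M\<^esub> (b \<odot>\<^bsub>M\<^esub> y)) = N +>\<^bsub>M\<^esub> (b \<odot>\<^bsub>M\<^esub> x)"
    by (intro UN_constant_eq ballI)
  then show ?thesis
    unfolding quot_module_def module.select_convs .
qed

lemma module_quot_module:
  assumes "Module.module R M" "submodule N R M"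
  shows "Module.module R (quot_module M N)"
proof -
  interpret Module.module R M by fact
  interpret N: submodule N R M by fact
  interpret abelian_subgroup N M
    by (intro abelian_subgroupI3 additive_subgroup.intro N.subgroup_axioms M.abelian_group_axioms)
  have rep: "\<exists>x\<in>carrier M. X = N +>\<^bsub>M\<^esub> x" if "X \<in> carrier (quot_module M N)" for X
    using that by (simp add: quot_module_def A_RCOSETS_def')
  have mem: "N +>\<^bsub>M\<^esub> x \<in> carrier (quot_module M N)" if "x \<in> carrier M" for x
    using that by (auto simp: quot_module_def A_RCOSETS_def')
  have add: "(N +>\<^bsub>M\<^esub> x) \<oplus>\<^bsub>quot_module M N\<^esub> (N +>\<^bsub>M\<^esub> y) = N +>\<^bsub>M\<^esub> (x \<oplus>\<^bsub>M\<^esub> y)"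
    if "x \<in> carrier M" "y \<in> carrier M" for x y
    using that by (simp add: quot_module_def a_rcos_sum)
  have zero: "\<zero>\<^bsub>quot_module M N\<^esub> = N +>\<^bsub>M\<^esub> \<zero>\<^bsub>M\<^esub>"
    using a_rcos_const[OF zero_closed] by (simp add: quot_module_def)
  note sm = quot_module_smult[OF assms]
  show ?thesis
  proof (rule moduleI)
    show "cring R" by (rule R.is_cring)
    show "abelian_group (quot_module M N)"
    proof (rule abelian_groupI)
      fix X assume X: "X \<in> carrier (quot_module M N)"
      then obtain x where x: "x \<in> carrier M" "X = N +>\<^bsub>M\<^esub> x"
        using rep by blast
      show "\<zero>\<^bsub>quot_module M N\<^esub> \<oplus>\<^bsub>quot_module M N\<^esub> X = X"
        using x by (simp add: zero add)
      have "(N +>\<^bsub>M\<^esub> (\<ominus>\<^bsub>M\<^esub> x)) \<oplus>\<^bsub>quot_module M N\<^esub> X = \<zero>\<^bsub>quot_module M N\<^esub>"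
        using x by (simp add: zero add M.l_neg)
      then show "\<exists>Y\<in>carrier (quot_module M N). Y \<oplus>\<^bsub>quot_module M N\<^esub> X = \<zero>\<^bsub>quot_module M N\<^esub>"
        using mem M.a_inv_closed x(1) by blast
    next
      fix X Y assume "X \<in> carrier (quot_module M N)" "Y \<in> carrier (quot_module M N)"
      then show "X \<oplus>\<^bsub>quot_module M N\<^esub> Y \<in> carrier (quot_module M N)"
        and "X \<oplus>\<^bsub>quot_module M N\<^esub> Y = Y \<oplus>\<^bsub>quot_module M N\<^esub> X"
        using rep[of X] rep[of Y] by (auto simp: add mem M.a_comm)
    next
      fix X Y Z
      assume "X \<in> carrier (quot_module M N)" "Y \<in> carrier (quot_module M N)"
        "Z \<in> carrier (quot_module M N)"
      then show "X \<oplus>\<^bsub>quot_module M N\<^esub> Y \<oplus>\<^bsub>quot_module M N\<^esub> Z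
          = X \<oplus>\<^bsub>quot_module M N\<^esub> (Y \<oplus>\<^bsub>quot_module M N\<^esub> Z)"
        using rep[of X] rep[of Y] rep[of Z] by (auto simp: add M.a_assoc)
    next
      show "\<zero>\<^bsub>quot_module M N\<^esub> \<in> carrier (quot_module M N)"
        by (simp add: zero mem)
    qed
  next
    fix b X assume "b \<in> carrier R" "X \<in> carrier (quot_module M N)"
    then show "b \<odot>\<^bsub>quot_module M N\<^esub> X \<in> carrier (quot_module M N)"
      using rep[of X] by (auto simp: sm mem)
  next
    fix b c X assume "b \<in> carrier R" "c \<in> carrier R" "X \<in> carrier (quot_module M N)"
    then show "(b \<oplus>\<^bsub>R\<^esub> c) \<odot>\<^bsub>quot_module M N\<^esub> X
        = b \<odot>\<^bsub>quot_module M N\<^esub> X \<oplus>\<^bsub>quot_module M N\<^esub> c \<odot>\<^bsub>quot_module M N\<^esub> X"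
      using rep[of X] by (auto simp: sm add smult_l_distr)
  next
    fix b X Y
    assume "b \<in> carrier R" "X \<in> carrier (quot_module M N)" "Y \<in> carrier (quot_module M N)"
    then show "b \<odot>\<^bsub>quot_module M N\<^esub> (X \<oplus>\<^bsub>quot_module M N\<^esub> Y)
        = b \<odot>\<^bsub>quot_module M N\<^esub> X \<oplus>\<^bsub>quot_module M N\<^esub> b \<odot>\<^bsub>quot_module M N\<^esub> Y"
      using rep[of X] rep[of Y] by (auto simp: sm add smult_r_distr)
  next
    fix b c X assume "b \<in> carrier R" "c \<in> carrier R" "X \<in> carrier (quot_module M N)"
    then show "(b \<otimes>\<^bsub>R\<^esub> c) \<odot>\<^bsub>quot_module M N\<^esub> X
        = b \<odot>\<^bsub>quot_module M N\<^esub> (c \<odot>\<^bsub>quot_module M N\<^esub> X)"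
      using rep[of X] by (auto simp: sm smult_assoc1)
  next
    fix X assume "X \<in> carrier (quot_module M N)"
    then show "\<one>\<^bsub>R\<^esub> \<odot>\<^bsub>quot_module M N\<^esub> X = X"
      using rep[of X] by (auto simp: sm)
  qed
qed


subsection \<open>Length and dimension\<close>

definition module_length ::
    "('a, 'c) ring_scheme \<Rightarrow> ('a, 'b, 'd) module_scheme \<Rightarrow> enat"
  where "module_length R M =
    (SUP k \<in> {k. \<exists>N. (\<forall>i\<le>k. submodule (N i) R M) \<and> (\<forall>i<k. N i \<subset> N (Suc i))}. enat k)"

text \<open>The length as an integer; meaningful only for modules of finite length.\<close>

abbreviation len :: "('a, 'c) ring_scheme \<Rightarrow> ('a, 'b, 'd) module_scheme \<Rightarrow> int"
  where "len R M \<equiv> int (the_enat (module_length R M))"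

definition annihilator ::
    "('a, 'c) ring_scheme \<Rightarrow> ('a, 'b, 'd) module_scheme \<Rightarrow> 'a set"
  where "annihilator R M = {b \<in> carrier R. \<forall>x \<in> carrier M. b \<odot>\<^bsub>M\<^esub> x = \<zero>\<^bsub>M\<^esub>}"

text \<open>
  The Krull dimension of \<open>R / Ann M\<close>, via chains of primes of \<open>R\<close> containing \<open>Ann M\<close>.
  The zero module gets dimension \<open>0\<close> here (supremum of the empty set).
\<close>

definition module_dim ::
    "('a, 'c) ring_scheme \<Rightarrow> ('a, 'b, 'd) module_scheme \<Rightarrow> enat"
  where "module_dim R M =
    (SUP k \<in> {k. \<exists>P. (\<forall>i\<le>k. primeideal (P i) R \<and> annihilator R M \<subseteq> P i) \<and>
                     (\<forall>i<k. P i \<subset> P (Suc i))}. enat k)"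


subsection \<open>Sequences of ring elements\<close>

text \<open>
  A sequence \<open>a\<^sub>1, \<dots>, a\<^sub>r\<close> is a function on \<^typ>\<open>nat\<close> of which only the values at
  \<open>1, \<dots>, r\<close> matter; \<open>seq_ideal R a i\<close> is \<open>(a\<^sub>1, \<dots>, a\<^sub>i)\<close>, the zero ideal for \<open>i = 0\<close>.
\<close>

definition seq_ideal :: "('a, 'c) ring_scheme \<Rightarrow> (nat \<Rightarrow> 'a) \<Rightarrow> nat \<Rightarrow> 'a set"
  where "seq_ideal R a i = Idl\<^bsub>R\<^esub> (a ` {1..i})"

lemma (in ring) seq_ideal_0: "seq_ideal R a 0 = {\<zero>}"
proof
  show "seq_ideal R a 0 \<subseteq> {\<zero>}"
    unfolding seq_ideal_def by (rule genideal_minimal[OF zeroideal]) simp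
  show "{\<zero>} \<subseteq> seq_ideal R a 0"
    unfolding seq_ideal_def genideal_def
    using additive_subgroup.zero_closed[OF ideal.axioms(1)] by blast
qed

definition system_of_parameters ::
    "('a, 'c) ring_scheme \<Rightarrow> 'a set \<Rightarrow> ('a, 'b, 'd) module_scheme \<Rightarrow> (nat \<Rightarrow> 'a) \<Rightarrow> nat \<Rightarrow> bool"
  where "system_of_parameters R \<mm> M a r \<longleftrightarrow>
    module_dim R M = enat r \<and> (\<forall>i\<in>{1..r}. a i \<in> \<mm>) \<and>
    module_length R (quot_module M (ideal_smult R (seq_ideal R a r) M)) < \<infinity>"

definition absolutely_superficial ::
    "('a, 'c) ring_scheme \<Rightarrow> ('a, 'b, 'd) module_scheme \<Rightarrow> (nat \<Rightarrow> 'a) \<Rightarrow> nat \<Rightarrow> bool"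
  where "absolutely_superficial R M a r \<longleftrightarrow>
    (\<forall>i\<in>{1..r}.
      let \<qq> = seq_ideal R a r;
          L = quot_module M (ideal_smult R (seq_ideal R a (i - 1)) M)
      in \<exists>n\<^sub>0. \<forall>n\<ge>n\<^sub>0.
           colon_elem L (ideal_smult R (ideal_power R \<qq> (n + 1)) L) (a i) \<inter> ideal_smult R \<qq> L
             = ideal_smult R (ideal_power R \<qq> n) L)"

text \<open>The length of \<open>N / (N \<inter> \<qq>M)\<close> for a submodule \<open>N\<close> of \<open>M\<close>.\<close>

definition len_mod ::
    "('a, 'c) ring_scheme \<Rightarrow> ('a, 'b, 'd) module_scheme \<Rightarrow> 'a set \<Rightarrow> 'b set \<Rightarrow> int"
  where "len_mod R M \<qq> N = len R (quot_module (M\<lparr>carrier := N\<rparr>) (N \<inter> ideal_smult R \<qq> M))"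

text \<open>The integers \<open>e\<^sub>i(\<qq>; M)\<close>, for \<open>0 \<le> i \<le> r\<close> and \<open>r \<ge> 1\<close>.\<close>

definition e_coeff ::
    "('a, 'c) ring_scheme \<Rightarrow> ('a, 'b, 'd) module_scheme \<Rightarrow> (nat \<Rightarrow> 'a) \<Rightarrow> nat \<Rightarrow> nat \<Rightarrow> int"
  where "e_coeff R M a r i =
    (let \<qq> = seq_ideal R a r; qM = (\<lambda>j. ideal_smult R (seq_ideal R a j) M)
     in if i = 0 then
          len R (quot_module M (qM r)) - len_mod R M \<qq> (colon_elem M (qM (r - 1)) (a r))
        else if i < r then
          len_mod R M \<qq> (colon_elem M (qM (r - i)) (a (r - i + 1)))
            - len_mod R M \<qq> (colon_elem M (qM (r - i - 1)) (a (r - i)))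
        else len_mod R M \<qq> (colon_elem M {\<zero>\<^bsub>M\<^esub>} (a 1)))"

text \<open>
  The right-hand side of the inequality. Subtraction on \<^typ>\<open>nat\<close> truncates in the upper binomial
  index only for \<open>n = 0\<close>, \<open>i = r\<close>, where \<open>0 choose 0 = 1\<close> is the conventional value of \<open>-1\<close>
  over \<open>0\<close>.
\<close>

definition length_bound ::
    "('a, 'c) ring_scheme \<Rightarrow> ('a, 'b, 'd) module_scheme \<Rightarrow> 'a set \<Rightarrow> (nat \<Rightarrow> 'a) \<Rightarrow> nat \<Rightarrow> nat \<Rightarrow> int"
  where "length_bound R M \<aa> a r n =
    (\<Sum>i=0..r. int ((n + r - i - 1) choose (r - i)) * e_coeff R M a r i)
    + int ((n + r - 1) choose (r - 1)) *
      len R (quot_module M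
        (ideal_smult R \<aa> M <+>\<^bsub>M\<^esub> colon_ideal M {\<zero>\<^bsub>M\<^esub>} (ideal_power R (seq_ideal R a r) n)))"

end

theory Submission
  imports Defs
begin

text \<open>
  Write \<open>q = (c 0, \<dots>, c (r - 1))\<close> with \<open>c i = a (i + 1)\<close>. Since \<open>q\<^sup>n \<aa> M \<subseteq> \<aa>\<^sup>n\<^sup>+\<^sup>1 M\<close>, it suffices to bound \<open>l(M/q\<^sup>n M)\<close> and
  \<open>l(q\<^sup>n M/q\<^sup>n \<aa> M)\<close>, and both bounds come from one argument. Adjoining the generators one at a time,
  multiplication by \<open>c i\<close> maps the degree \<open>k\<close> piece modulo \<open>c 0, \<dots>, c (i - 1)\<close> onto the \<open>i\<close>-th step of
  the degree \<open>k + 1\<close> piece; this gives a Pascal recursion for lengths, solved by binomial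
  coefficients. The bound is attained exactly when all these maps have the smallest possible kernels,
  and since the deficits of \<open>l(M/q\<^sup>n M)\<close> accumulate, equality for infinitely many \<open>n\<close> forces equality in
  every degree.

  For the first bound the kernel conditions are equivalent to
  \<open>((c 0, \<dots>, c (i - 1)) M : c i) \<inter> q M = (c 0, \<dots>, c (i - 1)) M\<close> for all \<open>i < r\<close>, which by Krull's
  intersection theorem is absolute superficiality. Given this, those for the second bound reduce to
  degree \<open>0\<close>, where they say that the coefficients of a linear relation among the generators lie in
  \<open>\<aa> M\<close> plus torsion; this is condition (iii).
\<close>

section \<open>The lattice of submodules\<close>

text \<open>For n >= 1 the bound loses length in three places: in the inclusion of q^n \<aa> M in
  \<aa>^(n+1) M, in the graded pieces that make up M/q^n M, and in q^n M/q^n \<aa> M. Equality for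
  one such n closes all three gaps; it yields (i) from the first and (iii) from the third, while
  (ii) needs the second gap closed in every degree, hence infinitely many n. The obstacle in (iii)
  is that the filtration depends on the order of the generators, and equality speaks most directly
  about the last one in degree 0. The lengths being compared, however, depend only on the ideal q,
  so the equality can be read again for each reordering: this is where the permutations come from.
  Conversely, the transposition that puts c i last controls the i-th coefficient of a linear
  relation. The torsion term is handled by a family made for one target n: degree k carries (0 :
  q^(n-k)), because a generator lowers the exponent by one, and so the torsion has disappeared in
  degree n.\<close>

abbreviation scale_set :: "('a, 'b, 'd) module_scheme \<Rightarrow> 'a \<Rightarrow> 'b set \<Rightarrow> 'b set"
  where "scale_set M b X \<equiv> (\<lambda>x. b \<odot>\<^bsub>M\<^esub> x) ` X"

text \<open>\<open>ideal_smult\<close> only multiplies the whole module. With a subset X in place of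
  the carrier, products such as q^k (\<aa> M) can be iterated inside one ambient module.\<close>

definition ideal_act ::
    "('a, 'c) ring_scheme \<Rightarrow> 'a set \<Rightarrow> ('a, 'b, 'd) module_scheme \<Rightarrow> 'b set \<Rightarrow> 'b set"
  where "ideal_act R I M X = submodule_span R M {b \<odot>\<^bsub>M\<^esub> x | b x. b \<in> I \<and> x \<in> X}"

lemma ideal_smult_eq_act: "ideal_smult R I M = ideal_act R I M (carrier M)"
  by (simp add: ideal_smult_def ideal_act_def)

context module
begin

lemma submodule_sub: "submodule X R M \<Longrightarrow> X \<subseteq> carrier M"
  and submodule_zero: "submodule X R M \<Longrightarrow> \<zero>\<^bsub>M\<^esub> \<in> X"
  and submodule_add: "submodule X R M \<Longrightarrow> x \<in> X \<Longrightarrow> y \<in> X \<Longrightarrow> x \<oplus>\<^bsub>M\<^esub> y \<in> X"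
  and submodule_smult: "submodule X R M \<Longrightarrow> b \<in> carrier R \<Longrightarrow> x \<in> X \<Longrightarrow> b \<odot>\<^bsub>M\<^esub> x \<in> X"
  and submodule_neg: "submodule X R M \<Longrightarrow> x \<in> X \<Longrightarrow> \<ominus>\<^bsub>M\<^esub> x \<in> X"
  using submoduleE[of X] subgroup.one_closed[OF submodule.axioms(1), of X R M] by auto

lemma submodule_minus:
  "submodule X R M \<Longrightarrow> x \<in> X \<Longrightarrow> y \<in> X \<Longrightarrow> x \<ominus>\<^bsub>M\<^esub> y \<in> X"
  by (simp add: a_minus_def submodule_add submodule_neg)

lemma submodule_carrierD: "submodule X R M \<Longrightarrow> x \<in> X \<Longrightarrow> x \<in> carrier M"
  using submodule_sub by blast

lemma add_minus_cancel:
  assumes "u \<in> carrier M" "v \<in> carrier M"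
  shows "(u \<oplus>\<^bsub>M\<^esub> v) \<ominus>\<^bsub>M\<^esub> u = v" and "u \<oplus>\<^bsub>M\<^esub> (v \<ominus>\<^bsub>M\<^esub> u) = v"
proof -
  have "(u \<oplus>\<^bsub>M\<^esub> v) \<ominus>\<^bsub>M\<^esub> u = (\<ominus>\<^bsub>M\<^esub> u \<oplus>\<^bsub>M\<^esub> u) \<oplus>\<^bsub>M\<^esub> v"
    using assms by (simp add: a_minus_def M.a_ac)
  then show "(u \<oplus>\<^bsub>M\<^esub> v) \<ominus>\<^bsub>M\<^esub> u = v"
    using assms by (simp add: M.l_neg)
  then show "u \<oplus>\<^bsub>M\<^esub> (v \<ominus>\<^bsub>M\<^esub> u) = v"
    using assms by (simp add: a_minus_def M.a_assoc)
qed

lemma join_mem: "x \<in> X <+>\<^bsub>M\<^esub> Y \<longleftrightarrow> (\<exists>u\<in>X. \<exists>v\<in>Y. x = u \<oplus>\<^bsub>M\<^esub> v)"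
  by (auto simp: set_add_def')

lemma joinI: "u \<in> X \<Longrightarrow> v \<in> Y \<Longrightarrow> u \<oplus>\<^bsub>M\<^esub> v \<in> X <+>\<^bsub>M\<^esub> Y"
  by (auto simp: set_add_def')

lemma join_mono: "X \<subseteq> X' \<Longrightarrow> Y \<subseteq> Y' \<Longrightarrow> X <+>\<^bsub>M\<^esub> Y \<subseteq> X' <+>\<^bsub>M\<^esub> Y'"
  by (auto simp: set_add_def')

lemma join_least: "submodule Z R M \<Longrightarrow> X \<subseteq> Z \<Longrightarrow> Y \<subseteq> Z \<Longrightarrow> X <+>\<^bsub>M\<^esub> Y \<subseteq> Z"
  by (auto simp: set_add_def' intro: submodule_add)

lemma join_upper1:
  assumes "submodule X R M" "submodule Y R M"
  shows "X \<subseteq> X <+>\<^bsub>M\<^esub> Y"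
proof
  fix x assume "x \<in> X"
  then show "x \<in> X <+>\<^bsub>M\<^esub> Y"
    unfolding join_mem using assms by (metis M.r_zero submodule_carrierD submodule_zero)
qed

lemma join_commute:
  assumes "submodule X R M" "submodule Y R M"
  shows "X <+>\<^bsub>M\<^esub> Y = Y <+>\<^bsub>M\<^esub> X"
  using assms by (auto simp: join_mem) (metis M.a_comm submodule_carrierD)+

lemma join_upper2:
  assumes "submodule X R M" "submodule Y R M"
  shows "Y \<subseteq> X <+>\<^bsub>M\<^esub> Y"
  using join_upper1[OF assms(2,1)] join_commute[OF assms] by simp

lemma submodule_join [intro, simp]:
  assumes X: "submodule X R M" and Y: "submodule Y R M"
  shows "submodule (X <+>\<^bsub>M\<^esub> Y) R M"
proof (rule submoduleI)
  note c = submodule_carrierD[OF X] submodule_carrierD[OF Y]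
  show "X <+>\<^bsub>M\<^esub> Y \<subseteq> carrier M"
    using c by (auto simp: join_mem)
  show "\<zero>\<^bsub>M\<^esub> \<in> X <+>\<^bsub>M\<^esub> Y"
    using join_upper1[OF X Y] submodule_zero[OF X] by blast
  fix z assume "z \<in> X <+>\<^bsub>M\<^esub> Y"
  then obtain u v where z: "u \<in> X" "v \<in> Y" "z = u \<oplus>\<^bsub>M\<^esub> v"
    by (auto simp: join_mem)
  have "\<ominus>\<^bsub>M\<^esub> z = \<ominus>\<^bsub>M\<^esub> u \<oplus>\<^bsub>M\<^esub> \<ominus>\<^bsub>M\<^esub> v"
    using z c by (simp add: M.minus_add)
  then show "\<ominus>\<^bsub>M\<^esub> z \<in> X <+>\<^bsub>M\<^esub> Y"
    unfolding join_mem using z submodule_neg[OF X] submodule_neg[OF Y] by blast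
  fix z' assume "z' \<in> X <+>\<^bsub>M\<^esub> Y"
  then obtain u' v' where z': "u' \<in> X" "v' \<in> Y" "z' = u' \<oplus>\<^bsub>M\<^esub> v'"
    by (auto simp: join_mem)
  have "z \<oplus>\<^bsub>M\<^esub> z' = (u \<oplus>\<^bsub>M\<^esub> u') \<oplus>\<^bsub>M\<^esub> (v \<oplus>\<^bsub>M\<^esub> v')"
    using z z' c by (simp add: M.add.m_ac)
  then show "z \<oplus>\<^bsub>M\<^esub> z' \<in> X <+>\<^bsub>M\<^esub> Y"
    unfolding join_mem using z z' submodule_add[OF X] submodule_add[OF Y] by blast
next
  fix b z assume b: "b \<in> carrier R" and "z \<in> X <+>\<^bsub>M\<^esub> Y"
  then obtain u v where z: "u \<in> X" "v \<in> Y" "z = u \<oplus>\<^bsub>M\<^esub> v"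
    by (auto simp: join_mem)
  then have "b \<odot>\<^bsub>M\<^esub> z = b \<odot>\<^bsub>M\<^esub> u \<oplus>\<^bsub>M\<^esub> b \<odot>\<^bsub>M\<^esub> v"
    using b submodule_carrierD[OF X] submodule_carrierD[OF Y] by (simp add: smult_r_distr)
  then show "b \<odot>\<^bsub>M\<^esub> z \<in> X <+>\<^bsub>M\<^esub> Y"
    unfolding join_mem using z b submodule_smult[OF X] submodule_smult[OF Y] by blast
qed

lemma join_assoc:
  assumes "submodule X R M" "submodule Y R M" "submodule Z R M"
  shows "(X <+>\<^bsub>M\<^esub> Y) <+>\<^bsub>M\<^esub> Z = X <+>\<^bsub>M\<^esub> (Y <+>\<^bsub>M\<^esub> Z)"
proof -
  note ss = submodule_carrierD[OF assms(1)] submodule_carrierD[OF assms(2)] submodule_carrierD[OF assms(3)]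
  show ?thesis
  proof (intro equalityI subsetI)
    fix t assume "t \<in> (X <+>\<^bsub>M\<^esub> Y) <+>\<^bsub>M\<^esub> Z"
    then obtain x y z where t: "x \<in> X" "y \<in> Y" "z \<in> Z" "t = (x \<oplus>\<^bsub>M\<^esub> y) \<oplus>\<^bsub>M\<^esub> z"
      by (auto simp: join_mem)
    then have "t = x \<oplus>\<^bsub>M\<^esub> (y \<oplus>\<^bsub>M\<^esub> z)"
      using ss by (simp add: M.a_assoc)
    then show "t \<in> X <+>\<^bsub>M\<^esub> (Y <+>\<^bsub>M\<^esub> Z)"
      using t by (simp only: joinI)
  next
    fix t assume "t \<in> X <+>\<^bsub>M\<^esub> (Y <+>\<^bsub>M\<^esub> Z)"
    then obtain x y z where t: "x \<in> X" "y \<in> Y" "z \<in> Z" "t = x \<oplus>\<^bsub>M\<^esub> (y \<oplus>\<^bsub>M\<^esub> z)"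
      by (auto simp: join_mem)
    then have "t = (x \<oplus>\<^bsub>M\<^esub> y) \<oplus>\<^bsub>M\<^esub> z"
      using ss by (simp add: M.a_assoc)
    then show "t \<in> (X <+>\<^bsub>M\<^esub> Y) <+>\<^bsub>M\<^esub> Z"
      using t by (simp only: joinI)
  qed
qed

lemma join_left_commute:
  assumes "submodule X R M" "submodule Y R M" "submodule Z R M"
  shows "X <+>\<^bsub>M\<^esub> (Y <+>\<^bsub>M\<^esub> Z) = Y <+>\<^bsub>M\<^esub> (X <+>\<^bsub>M\<^esub> Z)"
  using assms by (simp add: join_assoc[symmetric] join_commute[of X Y])

lemma join_absorb:
  assumes "submodule X R M" "submodule Y R M" "Y \<subseteq> X"
  shows "X <+>\<^bsub>M\<^esub> Y = X" and "Y <+>\<^bsub>M\<^esub> X = X"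
  using join_least[OF assms(1) order_refl assms(3)] join_upper1[OF assms(1,2)]
    join_commute[OF assms(1,2)] by auto

lemma submodule_Int [intro, simp]:
  assumes "submodule X R M" "submodule Y R M"
  shows "submodule (X \<inter> Y) R M"
  using assms submodule_sub
  by (intro submoduleI) (auto intro: submodule_zero submodule_add submodule_neg submodule_smult)

lemma submodule_carrier [intro, simp]: "submodule (carrier M) R M"
  by (rule carrier_is_submodule)

lemma submodule_zeroset [intro, simp]: "submodule {\<zero>\<^bsub>M\<^esub>} R M"
  by (rule submoduleI) auto

lemma modular_law:
  assumes X: "submodule X R M" and Y: "submodule Y R M" and Z: "submodule Z R M" and XZ: "X \<subseteq> Z"
  shows "(X <+>\<^bsub>M\<^esub> Y) \<inter> Z = X <+>\<^bsub>M\<^esub> (Y \<inter> Z)"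
proof
  show "X <+>\<^bsub>M\<^esub> (Y \<inter> Z) \<subseteq> (X <+>\<^bsub>M\<^esub> Y) \<inter> Z"
    using join_least[OF Z XZ, of "Y \<inter> Z"] join_mono[OF order_refl, of "Y \<inter> Z" Y X] by blast
  show "(X <+>\<^bsub>M\<^esub> Y) \<inter> Z \<subseteq> X <+>\<^bsub>M\<^esub> (Y \<inter> Z)"
  proof
    fix z assume z: "z \<in> (X <+>\<^bsub>M\<^esub> Y) \<inter> Z"
    then obtain u v where uv: "u \<in> X" "v \<in> Y" "z = u \<oplus>\<^bsub>M\<^esub> v"
      by (auto simp: join_mem)
    have c: "u \<in> carrier M" "v \<in> carrier M"
      using uv X Y submodule_carrierD by auto
    have "v = z \<ominus>\<^bsub>M\<^esub> u"
      using uv(3) c by (simp add: add_minus_cancel)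
    then have "v \<in> Z"
      using submodule_minus[OF Z] z uv(1) XZ by auto
    then show "z \<in> X <+>\<^bsub>M\<^esub> (Y \<inter> Z)"
      unfolding join_mem using uv by blast
  qed
qed

text \<open>If s + t = w with w in W, then s = w - t lies in T + W. Later this confines the multiple
  of one generator when a sum of multiples falls into a given submodule.\<close>

lemma join_Int_subset:
  assumes S: "submodule S R M" and T: "submodule T R M" and W: "submodule W R M"
  shows "(S <+>\<^bsub>M\<^esub> T) \<inter> W \<subseteq> (S \<inter> (T <+>\<^bsub>M\<^esub> W)) <+>\<^bsub>M\<^esub> T"
proof -
  have "(S <+>\<^bsub>M\<^esub> T) \<inter> W \<subseteq> (T <+>\<^bsub>M\<^esub> S) \<inter> (T <+>\<^bsub>M\<^esub> W)"
    using join_upper2[OF T W] join_commute[OF S T] by blast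
  also have "\<dots> = T <+>\<^bsub>M\<^esub> (S \<inter> (T <+>\<^bsub>M\<^esub> W))"
    using assms by (intro modular_law join_upper1) auto
  finally show ?thesis
    using assms join_commute by (metis submodule_Int submodule_join)
qed

lemma submodule_scale [intro, simp]:
  assumes b: "b \<in> carrier R" and X: "submodule X R M"
  shows "submodule (scale_set M b X) R M"
proof (rule submoduleI)
  note c = submodule_carrierD[OF X]
  show "scale_set M b X \<subseteq> carrier M"
    using b c by auto
  show "\<zero>\<^bsub>M\<^esub> \<in> scale_set M b X"
    using b submodule_zero[OF X] smult_r_null by (metis imageI)
  show "\<ominus>\<^bsub>M\<^esub> z \<in> scale_set M b X" if "z \<in> scale_set M b X" for z
    using that b c submodule_neg[OF X] by (auto simp: smult_r_minus[symmetric])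
  show "z \<oplus>\<^bsub>M\<^esub> z' \<in> scale_set M b X" if "z \<in> scale_set M b X" "z' \<in> scale_set M b X" for z z'
    using that b c submodule_add[OF X] by (auto simp: smult_r_distr[symmetric])
  show "d \<odot>\<^bsub>M\<^esub> z \<in> scale_set M b X" if d: "d \<in> carrier R" and z: "z \<in> scale_set M b X" for d z
  proof -
    obtain x where x: "x \<in> X" "z = b \<odot>\<^bsub>M\<^esub> x"
      using z by auto
    then have "d \<odot>\<^bsub>M\<^esub> z = b \<odot>\<^bsub>M\<^esub> (d \<odot>\<^bsub>M\<^esub> x)"
      using b d c by (simp add: smult_assoc1[symmetric] R.m_comm)
    then show ?thesis
      using submodule_smult[OF X d x(1)] by blast
  qed
qed

lemma submodule_colon [intro, simp]:
  assumes b: "b \<in> carrier R" and Z: "submodule Z R M"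
  shows "submodule (colon_elem M Z b) R M"
proof (rule submoduleI)
  show "d \<odot>\<^bsub>M\<^esub> x \<in> colon_elem M Z b" if "d \<in> carrier R" "x \<in> colon_elem M Z b" for d x
  proof -
    have "b \<odot>\<^bsub>M\<^esub> (d \<odot>\<^bsub>M\<^esub> x) = d \<odot>\<^bsub>M\<^esub> (b \<odot>\<^bsub>M\<^esub> x)"
      using that b by (simp add: colon_elem_def smult_assoc1[symmetric] R.m_comm)
    then show ?thesis
      using that submodule_smult[OF Z] by (simp add: colon_elem_def)
  qed
qed (use b Z in \<open>auto simp: colon_elem_def smult_r_minus smult_r_distr
      intro: submodule_zero submodule_add submodule_neg\<close>)

lemma scale_mono: "X \<subseteq> Y \<Longrightarrow> scale_set M b X \<subseteq> scale_set M b Y"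
  by (rule image_mono)

lemma colon_mono: "X \<subseteq> Y \<Longrightarrow> colon_elem M X b \<subseteq> colon_elem M Y b"
  by (auto simp: colon_elem_def)

lemma scale_subset:
  "b \<in> carrier R \<Longrightarrow> submodule X R M \<Longrightarrow> scale_set M b X \<subseteq> X"
  by (auto intro: submodule_smult)

lemma scale_subset_iff:
  "X \<subseteq> carrier M \<Longrightarrow> scale_set M b X \<subseteq> Y \<longleftrightarrow> X \<subseteq> colon_elem M Y b"
  unfolding colon_elem_def image_subset_iff by blast

lemma subset_colon: "b \<in> carrier R \<Longrightarrow> submodule X R M \<Longrightarrow> X \<subseteq> colon_elem M X b"
  by (simp add: scale_subset_iff[symmetric] scale_subset submodule_sub)

lemma scale_join:
  assumes b: "b \<in> carrier R" and X: "submodule X R M" and Y: "submodule Y R M"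
  shows "scale_set M b (X <+>\<^bsub>M\<^esub> Y) = scale_set M b X <+>\<^bsub>M\<^esub> scale_set M b Y"
proof -
  have *: "b \<odot>\<^bsub>M\<^esub> (u \<oplus>\<^bsub>M\<^esub> v) = b \<odot>\<^bsub>M\<^esub> u \<oplus>\<^bsub>M\<^esub> b \<odot>\<^bsub>M\<^esub> v" if "u \<in> X" "v \<in> Y" for u v
    using that b submodule_carrierD[OF X] submodule_carrierD[OF Y] by (simp add: smult_r_distr)
  show ?thesis
  proof (intro equalityI subsetI)
    fix z assume "z \<in> scale_set M b (X <+>\<^bsub>M\<^esub> Y)"
    then obtain u v where "u \<in> X" "v \<in> Y" "z = b \<odot>\<^bsub>M\<^esub> (u \<oplus>\<^bsub>M\<^esub> v)"
      by (auto simp: set_add_def')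
    then show "z \<in> scale_set M b X <+>\<^bsub>M\<^esub> scale_set M b Y"
      by (simp only: * joinI imageI)
  next
    fix z assume "z \<in> scale_set M b X <+>\<^bsub>M\<^esub> scale_set M b Y"
    then obtain u v where "u \<in> X" "v \<in> Y" "z = b \<odot>\<^bsub>M\<^esub> u \<oplus>\<^bsub>M\<^esub> b \<odot>\<^bsub>M\<^esub> v"
      by (auto simp: set_add_def')
    then show "z \<in> scale_set M b (X <+>\<^bsub>M\<^esub> Y)"
      by (simp only: *[symmetric] joinI imageI)
  qed
qed

lemma scale_commute:
  assumes "b \<in> carrier R" "c \<in> carrier R" "submodule X R M"
  shows "scale_set M b (scale_set M c X) = scale_set M c (scale_set M b X)"
  unfolding image_image using assms submodule_carrierD
  by (intro image_cong) (simp_all add: smult_assoc1[symmetric] R.m_comm)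

lemma scale_Int:
  assumes "submodule X R M"
  shows "scale_set M b X \<inter> Z = scale_set M b (X \<inter> colon_elem M Z b)"
  using assms submodule_carrierD by (auto simp: colon_elem_def)

text \<open>b y = b x + z means b (y - x) = z, so x may be subtracted. This is the cancellation used
  in the colon computations below.\<close>

lemma colon_scale_join:
  assumes b: "b \<in> carrier R" and X: "submodule X R M" and Z: "submodule Z R M"
  shows "colon_elem M (scale_set M b X <+>\<^bsub>M\<^esub> Z) b = X <+>\<^bsub>M\<^esub> colon_elem M Z b"
proof
  have "X \<subseteq> colon_elem M (scale_set M b X <+>\<^bsub>M\<^esub> Z) b"
    by (simp add: scale_subset_iff[symmetric] submodule_sub[OF X] join_upper1 b X Z)
  moreover have "colon_elem M Z b \<subseteq> colon_elem M (scale_set M b X <+>\<^bsub>M\<^esub> Z) b"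
    by (intro colon_mono join_upper2 submodule_scale b X Z)
  ultimately show "X <+>\<^bsub>M\<^esub> colon_elem M Z b \<subseteq> colon_elem M (scale_set M b X <+>\<^bsub>M\<^esub> Z) b"
    using b X Z by (intro join_least) auto
  show "colon_elem M (scale_set M b X <+>\<^bsub>M\<^esub> Z) b \<subseteq> X <+>\<^bsub>M\<^esub> colon_elem M Z b"
  proof
    fix y assume y: "y \<in> colon_elem M (scale_set M b X <+>\<^bsub>M\<^esub> Z) b"
    then obtain x z where xz: "x \<in> X" "z \<in> Z" "b \<odot>\<^bsub>M\<^esub> y = b \<odot>\<^bsub>M\<^esub> x \<oplus>\<^bsub>M\<^esub> z" "y \<in> carrier M"
      by (auto simp: colon_elem_def join_mem)
    have c: "x \<in> carrier M" "z \<in> carrier M"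
      using xz X Z submodule_carrierD by auto
    have "b \<odot>\<^bsub>M\<^esub> (y \<ominus>\<^bsub>M\<^esub> x) = b \<odot>\<^bsub>M\<^esub> y \<ominus>\<^bsub>M\<^esub> b \<odot>\<^bsub>M\<^esub> x"
      using xz(4) b c by (simp add: a_minus_def smult_r_distr smult_r_minus)
    then have "b \<odot>\<^bsub>M\<^esub> (y \<ominus>\<^bsub>M\<^esub> x) = z"
      using xz(3) b c by (simp add: add_minus_cancel)
    then have "y \<ominus>\<^bsub>M\<^esub> x \<in> colon_elem M Z b"
      using xz c by (simp add: colon_elem_def)
    moreover have "y = x \<oplus>\<^bsub>M\<^esub> (y \<ominus>\<^bsub>M\<^esub> x)"
      using xz(4) c by (simp add: add_minus_cancel)
    ultimately show "y \<in> X <+>\<^bsub>M\<^esub> colon_elem M Z b"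
      using joinI[OF xz(1)] by metis
  qed
qed

lemma submodule_Inter:
  assumes "\<And>N. N \<in> F \<Longrightarrow> submodule N R M" "F \<noteq> {}"
  shows "submodule (\<Inter>F) R M"
  using assms submodule_sub
  by (intro submoduleI) (fastforce intro: submodule_zero submodule_add submodule_neg submodule_smult)+

lemma submodule_span_least: "submodule N R M \<Longrightarrow> S \<subseteq> N \<Longrightarrow> submodule_span R M S \<subseteq> N"
  by (auto simp: submodule_span_def)

lemma submodule_span_superset: "S \<subseteq> submodule_span R M S"
  by (auto simp: submodule_span_def)

lemma submodule_submodule_span: "S \<subseteq> carrier M \<Longrightarrow> submodule (submodule_span R M S) R M"
  unfolding submodule_span_def by (rule submodule_Inter) auto

lemma submodule_act [intro, simp]:
  assumes "I \<subseteq> carrier R" "submodule X R M"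
  shows "submodule (ideal_act R I M X) R M"
  unfolding ideal_act_def using assms submodule_carrierD
  by (intro submodule_submodule_span) blast

lemma act_least:
  assumes "submodule N R M" "\<And>b x. b \<in> I \<Longrightarrow> x \<in> X \<Longrightarrow> b \<odot>\<^bsub>M\<^esub> x \<in> N"
  shows "ideal_act R I M X \<subseteq> N"
  unfolding ideal_act_def using assms by (intro submodule_span_least) auto

lemma act_mem: "b \<in> I \<Longrightarrow> x \<in> X \<Longrightarrow> b \<odot>\<^bsub>M\<^esub> x \<in> ideal_act R I M X"
  unfolding ideal_act_def by (rule subsetD[OF submodule_span_superset]) blast

lemma act_subset_iff:
  assumes "submodule N R M"
  shows "ideal_act R I M X \<subseteq> N \<longleftrightarrow> (\<forall>b\<in>I. \<forall>x\<in>X. b \<odot>\<^bsub>M\<^esub> x \<in> N)"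
proof
  show "\<forall>b\<in>I. \<forall>x\<in>X. b \<odot>\<^bsub>M\<^esub> x \<in> N" if "ideal_act R I M X \<subseteq> N"
    using act_mem subsetD[OF that] by meson
qed (simp add: act_least[OF assms])

lemma act_mono:
  assumes "I \<subseteq> J" "X \<subseteq> Y" "J \<subseteq> carrier R" "submodule Y R M"
  shows "ideal_act R I M X \<subseteq> ideal_act R J M Y"
  using assms by (intro act_least) (auto intro: act_mem)

lemma act_carrier:
  assumes "submodule X R M"
  shows "ideal_act R (carrier R) M X = X"
proof
  show "ideal_act R (carrier R) M X \<subseteq> X"
    using assms by (intro act_least) (auto intro: submodule_smult)
  show "X \<subseteq> ideal_act R (carrier R) M X"
  proof
    fix x assume "x \<in> X"
    then show "x \<in> ideal_act R (carrier R) M X"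
      using act_mem[of \<one> "carrier R" x X] submodule_carrierD[OF assms] by simp
  qed
qed

lemma ideal_residual:
  assumes "submodule N R M" "X \<subseteq> carrier M"
  shows "ideal {b \<in> carrier R. \<forall>x\<in>X. b \<odot>\<^bsub>M\<^esub> x \<in> N} R"
proof (rule idealI)
  note simps = smult_l_distr smult_l_minus smult_assoc1
  show "ring R" by (rule R.ring_axioms)
  show "subgroup {b \<in> carrier R. \<forall>x\<in>X. b \<odot>\<^bsub>M\<^esub> x \<in> N} (add_monoid R)"
    using assms
    by (intro R.add.subgroupI)
       (auto simp: simps a_inv_def[symmetric] subset_iff
         intro!: submodule_add submodule_neg submodule_zero exI[of _ \<zero>])
  fix b c assume b: "b \<in> {b \<in> carrier R. \<forall>x\<in>X. b \<odot>\<^bsub>M\<^esub> x \<in> N}" and c: "c \<in> carrier R"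
  then show cb: "c \<otimes> b \<in> {b \<in> carrier R. \<forall>x\<in>X. b \<odot>\<^bsub>M\<^esub> x \<in> N}"
    using assms(2) by (auto simp: simps subset_iff intro: submodule_smult[OF assms(1)])
  then show "b \<otimes> c \<in> {b \<in> carrier R. \<forall>x\<in>X. b \<odot>\<^bsub>M\<^esub> x \<in> N}"
    using b c R.m_comm[of b c] by simp
qed

text \<open>The scalars carrying X into N form an ideal (\<open>ideal_residual\<close>), so it is
  enough to test the generators S.\<close>

lemma act_genideal_subset_iff:
  assumes "submodule N R M" "X \<subseteq> carrier M" "S \<subseteq> carrier R"
  shows "ideal_act R (Idl S) M X \<subseteq> N \<longleftrightarrow> (\<forall>b\<in>S. \<forall>x\<in>X. b \<odot>\<^bsub>M\<^esub> x \<in> N)"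
proof -
  have "(\<forall>b\<in>S. \<forall>x\<in>X. b \<odot>\<^bsub>M\<^esub> x \<in> N) \<longleftrightarrow> S \<subseteq> {b \<in> carrier R. \<forall>x\<in>X. b \<odot>\<^bsub>M\<^esub> x \<in> N}"
    using assms(3) by (auto simp: subset_iff)
  also have "\<dots> \<longleftrightarrow> Idl S \<subseteq> {b \<in> carrier R. \<forall>x\<in>X. b \<odot>\<^bsub>M\<^esub> x \<in> N}"
    using R.genideal_minimal[OF ideal_residual[OF assms(1,2)]] R.genideal_self[OF assms(3)]
    by (meson order_trans)
  also have "\<dots> \<longleftrightarrow> (\<forall>b\<in>Idl S. \<forall>x\<in>X. b \<odot>\<^bsub>M\<^esub> x \<in> N)"
    using ideal.Icarr[OF R.genideal_ideal[OF assms(3)]] by (auto simp: subset_iff)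
  finally show ?thesis
    by (simp add: act_subset_iff[OF assms(1)])
qed

lemma submodule_residual:
  assumes "submodule N R M" "I \<subseteq> carrier R"
  shows "submodule {x \<in> carrier M. \<forall>b\<in>I. b \<odot>\<^bsub>M\<^esub> x \<in> N} R M"
proof (cases "I = {}")
  case False
  then have "{x \<in> carrier M. \<forall>b\<in>I. b \<odot>\<^bsub>M\<^esub> x \<in> N} = \<Inter>(colon_elem M N ` I)"
    by (auto simp: colon_elem_def)
  then show ?thesis
    using False assms by (auto intro!: submodule_Inter)
qed simp

lemma submodule_colon_ideal [intro, simp]:
  assumes "submodule N R M" "I \<subseteq> carrier R"
  shows "submodule (colon_ideal M N I) R M"
  using submodule_residual[OF assms] by (simp add: colon_ideal_def)

lemma act_prod:
  assumes I: "ideal I R" and J: "ideal J R" and X: "submodule X R M"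
  shows "ideal_act R (I \<cdot> J) M X = ideal_act R I M (ideal_act R J M X)"
proof
  have c: "I \<subseteq> carrier R" "J \<subseteq> carrier R"
    using I J by (auto dest: ideal.Icarr)
  have sJ: "submodule (ideal_act R J M X) R M"
    using c X by simp
  have sIJ: "submodule (ideal_act R I M (ideal_act R J M X)) R M"
    using c sJ by simp
  show "ideal_act R (I \<cdot> J) M X \<subseteq> ideal_act R I M (ideal_act R J M X)"
  proof (rule act_least[OF sIJ])
    fix b x assume b: "b \<in> I \<cdot> J" and x: "x \<in> X"
    then show "b \<odot>\<^bsub>M\<^esub> x \<in> ideal_act R I M (ideal_act R J M X)"
    proof (induction b rule: ideal_prod.induct)
      case (prod i j)
      then have "(i \<otimes> j) \<odot>\<^bsub>M\<^esub> x = i \<odot>\<^bsub>M\<^esub> (j \<odot>\<^bsub>M\<^esub> x)"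
        using c submodule_carrierD[OF X x] by (intro smult_assoc1) auto
      then show ?case
        using prod x by (simp add: act_mem)
    next
      case (sum s1 s2)
      then have "s1 \<in> carrier R" "s2 \<in> carrier R"
        using R.ideal_prod_in_carrier[OF I J] by auto
      then have "(s1 \<oplus> s2) \<odot>\<^bsub>M\<^esub> x = s1 \<odot>\<^bsub>M\<^esub> x \<oplus>\<^bsub>M\<^esub> s2 \<odot>\<^bsub>M\<^esub> x"
        using submodule_carrierD[OF X x] by (intro smult_l_distr) auto
      then show ?case
        using sum x submodule_add[OF sIJ] by simp
    qed
  qed
  have cIJ: "I \<cdot> J \<subseteq> carrier R"
    using R.ideal_prod_in_carrier[OF I J] .
  have sP: "submodule (ideal_act R (I \<cdot> J) M X) R M"
    using cIJ X by simp
  \<comment> \<open>The elements that I carries into (I J) X form a submodule, so it is enough to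
    test the products j x that generate J X.\<close>
  have "ideal_act R J M X \<subseteq> {x \<in> carrier M. \<forall>b\<in>I. b \<odot>\<^bsub>M\<^esub> x \<in> ideal_act R (I \<cdot> J) M X}"
  proof (rule act_least[OF submodule_residual[OF sP c(1)]])
    fix j x assume j: "j \<in> J" and x: "x \<in> X"
    have "i \<odot>\<^bsub>M\<^esub> (j \<odot>\<^bsub>M\<^esub> x) \<in> ideal_act R (I \<cdot> J) M X" if i: "i \<in> I" for i
    proof -
      have "i \<odot>\<^bsub>M\<^esub> (j \<odot>\<^bsub>M\<^esub> x) = (i \<otimes> j) \<odot>\<^bsub>M\<^esub> x"
        using i j c submodule_carrierD[OF X x] by (intro smult_assoc1[symmetric]) auto
      then show ?thesis
        using act_mem[OF ideal_prod.prod[OF i j] x] by simp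
    qed
    then show "j \<odot>\<^bsub>M\<^esub> x \<in> {x \<in> carrier M. \<forall>b\<in>I. b \<odot>\<^bsub>M\<^esub> x \<in> ideal_act R (I \<cdot> J) M X}"
      using j c submodule_carrierD[OF X x] by auto
  qed
  then show "ideal_act R I M (ideal_act R J M X) \<subseteq> ideal_act R (I \<cdot> J) M X"
    by (intro act_least[OF sP]) (simp add: subset_iff)
qed

end

lemma (in cring) ideal_ideal_power [intro, simp]:
  assumes "ideal I R"
  shows "ideal (ideal_power R I n) R"
proof (induction n)
  case 0
  then show ?case
    using oneideal by (simp add: nat_pow_def ideals_set_def)
next
  case (Suc n)
  then show ?case
    using ideal_prod_is_ideal[OF _ assms] by (simp add: nat_pow_def ideals_set_def)
qed

lemma ideal_power_0: "ideal_power R I 0 = carrier R"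
  and ideal_power_Suc: "ideal_power R I (Suc n) = ideal_prod R (ideal_power R I n) I"
  by (simp_all add: nat_pow_def ideals_set_def)

lemma (in module) act_power_Suc:
  assumes "ideal I R" "submodule X R M"
  shows "ideal_act R (ideal_power R I (Suc n)) M X
    = ideal_act R (ideal_power R I n) M (ideal_act R I M X)"
  using assms by (simp only: ideal_power_Suc act_prod R.ideal_ideal_power)

lemma (in module) act_power:
  assumes I: "ideal I R" and X: "submodule X R M"
  shows "ideal_act R (ideal_power R I n) M X = (ideal_act R I M ^^ n) X"
  using X
proof (induction n arbitrary: X)
  case 0
  then show ?case
    by (simp only: ideal_power_0 act_carrier funpow_0)
next
  case (Suc n)
  have "submodule (ideal_act R I M X) R M"
    using Suc.prems I by (auto dest: ideal.Icarr)
  then show ?case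
    by (simp only: act_power_Suc[OF I Suc.prems] Suc.IH funpow_Suc_right o_apply)
qed

section \<open>Length\<close>

text \<open>The family of sets is arbitrary, so lengths of modules, submodules and quotients are all
  instances and can be compared by strictly monotone maps between families.\<close>

definition chains_between :: "'b set set \<Rightarrow> 'b set \<Rightarrow> 'b set \<Rightarrow> nat set"
  where "chains_between \<S> A B =
    {k. \<exists>N. (\<forall>i\<le>k. N i \<in> \<S> \<and> A \<subseteq> N i \<and> N i \<subseteq> B) \<and> (\<forall>i<k. N i \<subset> N (Suc i))}"

definition chain_length :: "'b set set \<Rightarrow> 'b set \<Rightarrow> 'b set \<Rightarrow> enat"
  where "chain_length \<S> A B = (SUP k \<in> chains_between \<S> A B. enat k)"

lemma chains_betweenE:
  assumes "k \<in> chains_between \<S> A B"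
  obtains N where "\<And>i. i \<le> k \<Longrightarrow> N i \<in> \<S>" "\<And>i. i \<le> k \<Longrightarrow> A \<subseteq> N i"
    "\<And>i. i \<le> k \<Longrightarrow> N i \<subseteq> B" "\<And>i. i < k \<Longrightarrow> N i \<subset> N (Suc i)"
  using assms unfolding chains_between_def by blast

lemma chains_betweenI:
  assumes "\<And>i. i \<le> k \<Longrightarrow> N i \<in> \<S>" "\<And>i. i \<le> k \<Longrightarrow> A \<subseteq> N i"
    "\<And>i. i \<le> k \<Longrightarrow> N i \<subseteq> B" "\<And>i. i < k \<Longrightarrow> N i \<subset> N (Suc i)"
  shows "k \<in> chains_between \<S> A B"
  using assms unfolding chains_between_def by blast

lemma chain_length_le_iff:
  "chain_length \<S> A B \<le> m \<longleftrightarrow> (\<forall>k\<in>chains_between \<S> A B. enat k \<le> m)"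
  by (simp add: chain_length_def SUP_le_iff)

lemma chains_between_le: "k \<in> chains_between \<S> A B \<Longrightarrow> enat k \<le> chain_length \<S> A B"
  using chain_length_le_iff by blast

lemma chain_length_mono_map:
  assumes "\<And>X. X \<in> \<S> \<Longrightarrow> A \<subseteq> X \<Longrightarrow> X \<subseteq> B \<Longrightarrow> \<phi> X \<in> \<S>' \<and> A' \<subseteq> \<phi> X \<and> \<phi> X \<subseteq> B'"
    and "\<And>X Y. X \<in> \<S> \<Longrightarrow> Y \<in> \<S> \<Longrightarrow> A \<subseteq> X \<Longrightarrow> Y \<subseteq> B \<Longrightarrow> X \<subset> Y \<Longrightarrow> \<phi> X \<subset> \<phi> Y"
  shows "chain_length \<S> A B \<le> chain_length \<S>' A' B'"
  unfolding chain_length_le_iff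
proof
  fix k assume "k \<in> chains_between \<S> A B"
  then obtain N where N: "\<And>i. i \<le> k \<Longrightarrow> N i \<in> \<S>" "\<And>i. i \<le> k \<Longrightarrow> A \<subseteq> N i"
    "\<And>i. i \<le> k \<Longrightarrow> N i \<subseteq> B" "\<And>i. i < k \<Longrightarrow> N i \<subset> N (Suc i)"
    by (rule chains_betweenE) blast
  have "k \<in> chains_between \<S>' A' B'"
    using N assms by (intro chains_betweenI[of _ "\<lambda>i. \<phi> (N i)"]) auto
  then show "enat k \<le> chain_length \<S>' A' B'"
    by (rule chains_between_le)
qed

lemma chain_length_mono:
  "A' \<subseteq> A \<Longrightarrow> B \<subseteq> B' \<Longrightarrow> chain_length \<S> A B \<le> chain_length \<S> A' B'"
  by (rule chain_length_mono_map[where \<phi> = "\<lambda>X. X"]) auto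

text \<open>Y extends every chain between A and X by one step. If the length up to Y is infinite
  there is nothing to show.\<close>

lemma chain_length_strict:
  assumes "X \<in> \<S>" "Y \<in> \<S>" "A \<subseteq> X" "X \<subset> Y"
  shows "chain_length \<S> A X + 1 \<le> chain_length \<S> A Y"
proof -
  have *: "Suc k \<in> chains_between \<S> A Y" if k: "k \<in> chains_between \<S> A X" for k
  proof -
    obtain N where N: "\<And>i. i \<le> k \<Longrightarrow> N i \<in> \<S>" "\<And>i. i \<le> k \<Longrightarrow> A \<subseteq> N i"
      "\<And>i. i \<le> k \<Longrightarrow> N i \<subseteq> X" "\<And>i. i < k \<Longrightarrow> N i \<subset> N (Suc i)"
      using k by (rule chains_betweenE) blast
    have "N k \<subset> Y"
      using N(3)[of k] assms(4) by auto
    then have *: "i \<le> k \<Longrightarrow> N i \<subset> (if i < k then N (Suc i) else Y)" for i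
      using N(4)[of i] by (cases "i = k") auto
    show ?thesis
    proof (rule chains_betweenI[of _ "\<lambda>i. if i \<le> k then N i else Y"])
      fix i
      show "(if i \<le> k then N i else Y) \<in> \<S>" "A \<subseteq> (if i \<le> k then N i else Y)"
        "(if i \<le> k then N i else Y) \<subseteq> Y"
        using N(1-3)[of i] assms by auto
      show "(if i \<le> k then N i else Y) \<subset> (if Suc i \<le> k then N (Suc i) else Y)" if "i < Suc k"
        using *[of i] that by (simp add: Suc_le_eq less_Suc_eq_le split: if_splits)
    qed
  qed
  show ?thesis
  proof (cases "chain_length \<S> A Y")
    case (enat m)
    have le: "k < m" if "k \<in> chains_between \<S> A X" for k
      using chains_between_le[OF *[OF that]] enat by simp
    have "0 \<in> chains_between \<S> A X"
      using assms by (intro chains_betweenI[of _ "\<lambda>_. X"]) auto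
    from le[OF this] obtain m' where Suc: "m = Suc m'"
      by (cases m) auto
    have "chain_length \<S> A X \<le> enat m'"
      using le by (force simp: chain_length_le_iff Suc)
    then have "chain_length \<S> A X + 1 \<le> enat m' + 1"
      by (rule add_right_mono)
    then show ?thesis
      by (simp add: enat Suc one_enat_def)
  qed simp
qed

section \<open>Length of intervals in the lattice of submodules\<close>

context module
begin

abbreviation submodules :: "'c set set"
  where "submodules \<equiv> {X. submodule X R M}"

abbreviation interval_length :: "'c set \<Rightarrow> 'c set \<Rightarrow> enat"
  where "interval_length \<equiv> chain_length submodules"

text \<open>Additivity without composition series: a chain from A to B projects to its meets and
  joins with P, and by the modular law a strict step stays strict in at least one of the two
  projections. Conversely, chains above P are stacked on the interval below P. Infinite lengths are
  included.\<close>

lemma interval_length_add: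
  assumes A: "submodule A R M" and P: "submodule P R M" and B: "submodule B R M"
    and AP: "A \<subseteq> P" and PB: "P \<subseteq> B"
  shows "interval_length A B = interval_length A P + interval_length P B"
proof (rule antisym)
  show "interval_length A B \<le> interval_length A P + interval_length P B"
    unfolding chain_length_le_iff
  proof
    fix k assume "k \<in> chains_between submodules A B"
    then obtain N where N: "\<And>i. i \<le> k \<Longrightarrow> submodule (N i) R M \<and> A \<subseteq> N i \<and> N i \<subseteq> B"
      "\<And>i. i < k \<Longrightarrow> N i \<subset> N (Suc i)"
      by (rule chains_betweenE) (simp, metis)
    have "enat i \<le> interval_length A (N i \<inter> P) + interval_length P (P <+>\<^bsub>M\<^esub> N i)" if "i \<le> k" for i
      using that
    proof (induction i)
      case 0
      then show ?case
        by (simp add: zero_enat_def[symmetric])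
    next
      case (Suc i)
      let ?m = "\<lambda>i. N i \<inter> P" and ?j = "\<lambda>i. P <+>\<^bsub>M\<^esub> N i"
      have s: "submodule (N i) R M" "submodule (N (Suc i)) R M" "N i \<subset> N (Suc i)" "A \<subseteq> N i"
        using N Suc.prems by auto
      have IH: "enat i \<le> interval_length A (?m i) + interval_length P (?j i)"
        using Suc by simp
      have m_le: "?m i \<subseteq> ?m (Suc i)"
        using s(3) by auto
      have j_le: "?j i \<subseteq> ?j (Suc i)"
        using s(3) by (intro join_mono) auto
      have mono: "interval_length A (?m i) \<le> interval_length A (?m (Suc i))"
        "interval_length P (?j i) \<le> interval_length P (?j (Suc i))"
        using m_le j_le by (auto intro: chain_length_mono)
      have "?m i \<noteq> ?m (Suc i) \<or> ?j i \<noteq> ?j (Suc i)"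
      proof (rule ccontr)
        assume "\<not> ?thesis"
        then have eq: "?m i = ?m (Suc i)" "?j i = ?j (Suc i)"
          by auto
        have "N (Suc i) = (N i <+>\<^bsub>M\<^esub> P) \<inter> N (Suc i)"
          using eq(2) join_upper2[OF P s(2)] join_commute[OF P s(1)] by auto
        also have "\<dots> = N i <+>\<^bsub>M\<^esub> (P \<inter> N (Suc i))"
          using s by (intro modular_law P) auto
        also have "\<dots> = N i"
          using eq(1) by (intro join_absorb s submodule_Int P) auto
        finally show False
          using s(3) by simp
      qed
      then consider "?m i \<subset> ?m (Suc i)" | "?j i \<subset> ?j (Suc i)"
        using m_le j_le by auto
      then show ?case
      proof cases
        case 1
        then have "interval_length A (?m i) + 1 \<le> interval_length A (?m (Suc i))"
          using s P AP by (intro chain_length_strict) auto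
        then have "(interval_length A (?m i) + 1) + interval_length P (?j i)
            \<le> interval_length A (?m (Suc i)) + interval_length P (?j (Suc i))"
          using mono by (intro add_mono)
        moreover have "enat (Suc i) \<le> (interval_length A (?m i) + 1) + interval_length P (?j i)"
          using add_right_mono[OF IH, of 1] by (simp add: one_enat_def ac_simps)
        ultimately show ?thesis
          by (rule order_trans[rotated])
      next
        case 2
        then have "interval_length P (?j i) + 1 \<le> interval_length P (?j (Suc i))"
          using s P join_upper1[OF P s(1)] by (intro chain_length_strict) auto
        then have "interval_length A (?m i) + (interval_length P (?j i) + 1)
            \<le> interval_length A (?m (Suc i)) + interval_length P (?j (Suc i))"
          using mono by (intro add_mono)
        moreover have "enat (Suc i) \<le> interval_length A (?m i) + (interval_length P (?j i) + 1)"
          using add_right_mono[OF IH, of 1] by (simp add: one_enat_def ac_simps)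
        ultimately show ?thesis
          by (rule order_trans[rotated])
      qed
    qed
    from this[of k] have "enat k \<le> interval_length A (N k \<inter> P) + interval_length P (P <+>\<^bsub>M\<^esub> N k)"
      by simp
    also have "\<dots> \<le> interval_length A P + interval_length P B"
      using N(1)[of k] PB B by (intro add_mono chain_length_mono join_least) auto
    finally show "enat k \<le> interval_length A P + interval_length P B" .
  qed
  \<comment> \<open>The chain above P is climbed step by step starting from the full length of
    [A, P], so that finiteness of that length is a consequence and not a premise.\<close>
  have *: "interval_length A P + enat k \<le> interval_length A B" if k: "k \<in> chains_between submodules P B" for k
  proof -
    obtain N where N: "\<And>i. i \<le> k \<Longrightarrow> submodule (N i) R M \<and> P \<subseteq> N i \<and> N i \<subseteq> B"
      "\<And>i. i < k \<Longrightarrow> N i \<subset> N (Suc i)"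
      using k by (rule chains_betweenE) (simp, metis)
    have "interval_length A P + enat i \<le> interval_length A (N i)" if "i \<le> k" for i
      using that
    proof (induction i)
      case 0
      then show ?case
        using N(1)[of 0] by (auto simp: zero_enat_def[symmetric] intro: chain_length_mono)
    next
      case (Suc i)
      have "interval_length A (N i) + 1 \<le> interval_length A (N (Suc i))"
        using N(1)[of i] N(1)[of "Suc i"] N(2)[of i] Suc.prems AP by (intro chain_length_strict) auto
      moreover have "interval_length A P + enat i + 1 \<le> interval_length A (N i) + 1"
        using Suc by (intro add_right_mono) simp
      ultimately show ?case
        by (simp add: one_enat_def add.assoc)
    qed
    from this[of k] have "interval_length A P + enat k \<le> interval_length A (N k)"
      by simp
    also have "\<dots> \<le> interval_length A B"
      using N(1)[of k] by (intro chain_length_mono) auto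
    finally show ?thesis .
  qed
  show "interval_length A P + interval_length P B \<le> interval_length A B"
  proof (cases "interval_length A B")
    case (enat n)
    have "0 \<in> chains_between submodules P B"
      using P PB by (intro chains_betweenI[of _ "\<lambda>_. P"]) auto
    then obtain p where p: "interval_length A P = enat p"
      using *[of 0] enat by (cases "interval_length A P") auto
    have "interval_length P B \<le> enat (n - p)"
      using * enat p by (force simp: chain_length_le_iff)
    moreover have "p \<le> n"
      using *[OF \<open>0 \<in> _\<close>] enat p by simp
    ultimately show ?thesis
      using add_left_mono[of "interval_length P B" "enat (n - p)" "enat p"] by (simp add: enat p)
  qed simp
qed

lemma interval_length_self: "interval_length A A = 0"
proof -
  have "k = 0" if "k \<in> chains_between submodules A A" for k
    using that by (rule chains_betweenE) (metis gr0I psubsetE subset_antisym le0 Suc_leI less_imp_le)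
  then have "interval_length A A \<le> 0"
    unfolding chain_length_le_iff by (simp add: zero_enat_def)
  then show ?thesis
    by simp
qed

text \<open>Multiplication by b induces an isomorphism from P/(P \<inter> (Y : b)) to (b P + Y)/Y.
  Here it appears as a pair of inverse order maps \<open>?\<phi>\<close> and \<open>?\<psi>\<close>
  between intervals. The counting of graded pieces rests on it.\<close>

lemma interval_length_scale:
  assumes b: "b \<in> carrier R" and P: "submodule P R M" and Y: "submodule Y R M"
  shows "interval_length Y (scale_set M b P <+>\<^bsub>M\<^esub> Y)
    = interval_length (P \<inter> colon_elem M Y b) P"
proof (rule antisym)
  let ?\<phi> = "\<lambda>X. scale_set M b X <+>\<^bsub>M\<^esub> Y" and ?\<psi> = "\<lambda>W. P \<inter> colon_elem M W b"
  have \<psi>\<phi>: "?\<psi> (?\<phi> X) = X" if X: "submodule X R M" "P \<inter> colon_elem M Y b \<subseteq> X" "X \<subseteq> P" for X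
  proof -
    have "?\<psi> (?\<phi> X) = (X <+>\<^bsub>M\<^esub> colon_elem M Y b) \<inter> P"
      using b X Y by (simp add: colon_scale_join Int_commute)
    also have "\<dots> = X <+>\<^bsub>M\<^esub> (colon_elem M Y b \<inter> P)"
      using b P X Y by (intro modular_law) auto
    also have "\<dots> = X"
      using b P X Y by (intro join_absorb) auto
    finally show ?thesis .
  qed
  have \<phi>\<psi>: "?\<phi> (?\<psi> W) = W" if W: "submodule W R M" "Y \<subseteq> W" "W \<subseteq> scale_set M b P <+>\<^bsub>M\<^esub> Y" for W
  proof -
    have "?\<phi> (?\<psi> W) = Y <+>\<^bsub>M\<^esub> (scale_set M b P \<inter> W)"
      using b P W Y by (subst join_commute) (auto simp: scale_Int[OF P])
    also have "\<dots> = (Y <+>\<^bsub>M\<^esub> scale_set M b P) \<inter> W"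
      using b P W Y by (intro modular_law[symmetric]) auto
    also have "\<dots> = W"
      using W b P Y join_commute[of Y "scale_set M b P"] by auto
    finally show ?thesis .
  qed
  show "interval_length (P \<inter> colon_elem M Y b) P \<le> interval_length Y (scale_set M b P <+>\<^bsub>M\<^esub> Y)"
  proof (rule chain_length_mono_map[where \<phi> = ?\<phi>])
    fix X assume "X \<in> submodules" "P \<inter> colon_elem M Y b \<subseteq> X" "X \<subseteq> P"
    then show "?\<phi> X \<in> submodules \<and> Y \<subseteq> ?\<phi> X \<and> ?\<phi> X \<subseteq> ?\<phi> P"
      using b Y by (simp add: join_upper2 join_mono scale_mono)
  next
    fix X X' assume X: "X \<in> submodules" "X' \<in> submodules" "P \<inter> colon_elem M Y b \<subseteq> X" "X' \<subseteq> P" "X \<subset> X'"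
    have "?\<phi> X \<subseteq> ?\<phi> X'"
      using X(5) by (intro join_mono scale_mono) auto
    moreover have "?\<psi> (?\<phi> X) = X" "?\<psi> (?\<phi> X') = X'"
      using X by (intro \<psi>\<phi>; auto)+
    ultimately show "?\<phi> X \<subset> ?\<phi> X'"
      using X(5) by (metis psubsetI psubset_eq)
  qed
  show "interval_length Y (scale_set M b P <+>\<^bsub>M\<^esub> Y) \<le> interval_length (P \<inter> colon_elem M Y b) P"
  proof (rule chain_length_mono_map[where \<phi> = ?\<psi>])
    fix W assume "W \<in> submodules" "Y \<subseteq> W" "W \<subseteq> ?\<phi> P"
    then show "?\<psi> W \<in> submodules \<and> ?\<psi> Y \<subseteq> ?\<psi> W \<and> ?\<psi> W \<subseteq> P"
      using b P colon_mono[of Y W b] by auto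
  next
    fix W W' assume W: "W \<in> submodules" "W' \<in> submodules" "Y \<subseteq> W" "W' \<subseteq> ?\<phi> P" "W \<subset> W'"
    have "?\<psi> W \<subseteq> ?\<psi> W'"
      using W(5) by (auto simp: colon_elem_def)
    moreover have "?\<phi> (?\<psi> W) = W" "?\<phi> (?\<psi> W') = W'"
      using W by (intro \<phi>\<psi>; auto)+
    ultimately show "?\<psi> W \<subset> ?\<psi> W'"
      using W(5) by (metis psubsetI psubset_eq)
  qed
qed

text \<open>The case b = 1 of \<open>interval_length_scale\<close>.\<close>

lemma interval_length_diamond:
  assumes X: "submodule X R M" and Y: "submodule Y R M"
  shows "interval_length (X \<inter> Y) X = interval_length Y (X <+>\<^bsub>M\<^esub> Y)"
proof -
  have "scale_set M \<one> X = X"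
    using submodule_carrierD[OF X] by (auto simp: image_iff)
  moreover have "colon_elem M Y \<one> = Y"
    using submodule_carrierD[OF Y] by (auto simp: colon_elem_def)
  ultimately show ?thesis
    using interval_length_scale[OF R.one_closed X Y] by simp
qed

definition finite_colength :: "'c set \<Rightarrow> bool"
  where "finite_colength X \<longleftrightarrow> submodule X R M \<and> interval_length X (carrier M) < \<infinity>"

text \<open>An integer, so that lengths of subquotients become differences; the value is meaningful
  only under \<open>finite_colength\<close>.\<close>

definition colength :: "'c set \<Rightarrow> int"
  where "colength X = int (the_enat (interval_length X (carrier M)))"

lemma finite_colengthD [dest]: "finite_colength X \<Longrightarrow> submodule X R M"
  by (simp add: finite_colength_def)

lemma finite_colength_mono:
  assumes "finite_colength X" "submodule Y R M" "X \<subseteq> Y"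
  shows "finite_colength Y"
  using assms chain_length_mono[OF assms(3) order_refl, of submodules "carrier M"]
  unfolding finite_colength_def by (meson order.strict_trans1)

lemma finite_colength_iff_interval:
  assumes X: "finite_colength X" and Y: "submodule Y R M" "Y \<subseteq> X"
  shows "finite_colength Y \<longleftrightarrow> interval_length Y X < \<infinity>"
  using interval_length_add[OF Y(1) finite_colengthD[OF X] submodule_carrier Y(2)] X Y submodule_sub
  by (cases "interval_length Y X") (auto simp: finite_colength_def)

lemma interval_length_colength:
  assumes Y: "finite_colength Y" and X: "submodule X R M" "Y \<subseteq> X"
  shows "int (the_enat (interval_length Y X)) = colength Y - colength X"
    and "interval_length Y X < \<infinity>"
proof -
  have X': "finite_colength X"
    using finite_colength_mono[OF Y X] .
  have "interval_length Y (carrier M) = interval_length Y X + interval_length X (carrier M)"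
    using Y X submodule_sub by (intro interval_length_add) auto
  then show "int (the_enat (interval_length Y X)) = colength Y - colength X"
    and "interval_length Y X < \<infinity>"
    using X' Y unfolding finite_colength_def colength_def
    by (cases "interval_length Y X"; cases "interval_length X (carrier M)"; auto)+
qed

lemma colength_carrier [simp]: "colength (carrier M) = 0"
  by (simp add: colength_def interval_length_self zero_enat_def)

lemma finite_colength_carrier [simp]: "finite_colength (carrier M)"
  by (simp add: finite_colength_def interval_length_self)

lemma colength_mono:
  assumes "finite_colength Y" "submodule X R M" "Y \<subseteq> X"
  shows "colength X \<le> colength Y"
  using interval_length_colength(1)[OF assms] by linarith

lemma colength_eq_imp:
  assumes Y: "finite_colength Y" and X: "submodule X R M" "Y \<subseteq> X" and eq: "colength X = colength Y"
  shows "X = Y"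
proof (rule ccontr)
  assume "X \<noteq> Y"
  then have "Y \<subset> X"
    using X by auto
  then have "interval_length Y Y + 1 \<le> interval_length Y X"
    using X Y by (intro chain_length_strict) (auto dest: finite_colengthD)
  then show False
    using interval_length_colength[OF Y X] eq
    by (cases "interval_length Y X") (auto simp: interval_length_self one_enat_def)
qed

text \<open>The interval from Y to b P + Y has the length of P/(P \<inter> (Y : b)), which is finite
  by the last hypothesis.\<close>

lemma finite_colength_scale:
  assumes "b \<in> carrier R" "submodule P R M" "submodule Y R M"
    and "finite_colength (scale_set M b P <+>\<^bsub>M\<^esub> Y)" and "finite_colength (P \<inter> colon_elem M Y b)"
  shows "finite_colength Y"
  using assms interval_length_colength(2)[OF assms(5,2)]
  by (subst finite_colength_iff_interval[OF assms(4)])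
     (auto simp: interval_length_scale join_upper2)

lemma colength_scale:
  assumes b: "b \<in> carrier R" and P: "submodule P R M" and Y: "finite_colength Y"
    and PY: "finite_colength (P \<inter> colon_elem M Y b)"
  shows "colength Y - colength (scale_set M b P <+>\<^bsub>M\<^esub> Y)
    = colength (P \<inter> colon_elem M Y b) - colength P"
  using interval_length_colength(1)[OF PY P]
    interval_length_colength(1)[OF Y, of "scale_set M b P <+>\<^bsub>M\<^esub> Y"]
    interval_length_scale[OF b P finite_colengthD[OF Y]] b P finite_colengthD[OF Y]
  by (simp add: join_upper2)

end

section \<open>Powers of a finitely generated ideal acting on submodules\<close>

locale module_seq = module R M for R (structure) and M (structure) +
  fixes c :: "nat \<Rightarrow> 'a" and r :: nat
  assumes c_closed [simp, intro]: "c i \<in> carrier R"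
begin

abbreviation scale :: "nat \<Rightarrow> 'c set \<Rightarrow> 'c set"
  where "scale i \<equiv> scale_set M (c i)"

abbreviation colon :: "nat \<Rightarrow> 'c set \<Rightarrow> 'c set"
  where "colon i Z \<equiv> colon_elem M Z (c i)"

text \<open>The product of the ideal (c 0, ..., c (i - 1)) with X. The recursion adjoins one
  generator at a time, and \<open>pw\<close> iterates the case of all r generators, so the
  filtration arguments run without powers of ideals; \<open>act_power_eq_pw\<close>
  translates.\<close>

primrec Q :: "nat \<Rightarrow> 'c set \<Rightarrow> 'c set" where
  "Q 0 X = {\<zero>\<^bsub>M\<^esub>}"
| "Q (Suc i) X = scale i X <+>\<^bsub>M\<^esub> Q i X"

abbreviation pw :: "nat \<Rightarrow> 'c set \<Rightarrow> 'c set"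
  where "pw k X \<equiv> (Q r ^^ k) X"

abbreviation T :: "'c set"
  where "T \<equiv> carrier M"

lemma submodule_Q [intro, simp]: "submodule X R M \<Longrightarrow> submodule (Q i X) R M"
  by (induction i) auto

lemma Q_mono: "X \<subseteq> Y \<Longrightarrow> Q i X \<subseteq> Q i Y"
  by (induction i) (simp_all add: join_mono image_mono)

lemma Q_least:
  assumes "submodule Z R M" "\<And>j. j < i \<Longrightarrow> scale j X \<subseteq> Z"
  shows "Q i X \<subseteq> Z"
  using assms(2)
proof (induction i)
  case 0
  then show ?case
    by (simp add: submodule_zero[OF assms(1)])
next
  case (Suc i)
  then show ?case
    by (simp only: Q.simps) (intro join_least[OF assms(1)], auto)
qed

lemma Q_subset: "submodule X R M \<Longrightarrow> Q i X \<subseteq> X"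
  by (intro Q_least scale_subset) auto

lemma Q_subset_Suc: "submodule X R M \<Longrightarrow> Q i X \<subseteq> Q (Suc i) X"
  by (simp add: join_upper2)

lemma Q_index_mono: "submodule X R M \<Longrightarrow> i \<le> j \<Longrightarrow> Q i X \<subseteq> Q j X"
  by (rule lift_Suc_mono_le[of "\<lambda>i. Q i X"]) (rule Q_subset_Suc)

lemma scale_subset_Q:
  assumes "submodule X R M" "j < i"
  shows "scale j X \<subseteq> Q i X"
proof -
  have "scale j X \<subseteq> Q (Suc j) X"
    using assms by (simp add: join_upper1)
  also have "\<dots> \<subseteq> Q i X"
    using assms by (intro Q_index_mono) auto
  finally show ?thesis .
qed

lemma scale_Q:
  assumes "b \<in> carrier R" "submodule X R M"
  shows "scale_set M b (Q i X) = Q i (scale_set M b X)"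
  using assms by (induction i) (simp_all add: scale_join scale_commute del: image_image)

lemma Q_join:
  assumes "submodule X R M" "submodule Y R M"
  shows "Q i (X <+>\<^bsub>M\<^esub> Y) = Q i X <+>\<^bsub>M\<^esub> Q i Y"
proof (rule antisym)
  have "scale j (X <+>\<^bsub>M\<^esub> Y) \<subseteq> Q i X <+>\<^bsub>M\<^esub> Q i Y" if "j < i" for j
    using that assms by (simp add: scale_join join_mono scale_subset_Q)
  then show "Q i (X <+>\<^bsub>M\<^esub> Y) \<subseteq> Q i X <+>\<^bsub>M\<^esub> Q i Y"
    using assms by (intro Q_least) auto
  show "Q i X <+>\<^bsub>M\<^esub> Q i Y \<subseteq> Q i (X <+>\<^bsub>M\<^esub> Y)"
    using assms by (intro join_least Q_mono join_upper1 join_upper2) auto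
qed

lemma submodule_pw [intro, simp]: "submodule X R M \<Longrightarrow> submodule (pw k X) R M"
  by (induction k) auto

lemma pw_mono: "X \<subseteq> Y \<Longrightarrow> pw k X \<subseteq> pw k Y"
  by (induction k) (simp_all add: Q_mono)

lemma pw_antimono: "submodule X R M \<Longrightarrow> k \<le> l \<Longrightarrow> pw l X \<subseteq> pw k X"
  by (rule lift_Suc_antimono_le[of "\<lambda>k. pw k X"]) (simp_all add: Q_subset)

lemma scale_pw_subset: "submodule X R M \<Longrightarrow> i < r \<Longrightarrow> scale i (pw k X) \<subseteq> pw (Suc k) X"
  using scale_subset_Q[OF submodule_pw] by simp

lemma pw_subset_Q: "submodule X R M \<Longrightarrow> pw (Suc k) X \<subseteq> Q r X"
  using pw_antimono[of X 1 "Suc k"] by simp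

lemma scale_Q_pw_subset:
  assumes "submodule X R M" "i < r"
  shows "scale i (Q j (pw k X)) \<subseteq> Q j (pw (Suc k) X)"
  using scale_pw_subset[OF assms] assms by (simp only: scale_Q c_closed submodule_pw Q_mono)

lemma pw_commute: "pw k (Q r X) = pw (Suc k) X"
  by (simp only: funpow_Suc_right o_apply)


subsection \<open>Relative regularity\<close>

text \<open>
  Equivalent to absolute superficiality by Krull's intersection theorem; unlike the latter it
  involves no powers of the ideal.
\<close>

definition relatively_regular :: bool
  where "relatively_regular \<longleftrightarrow> (\<forall>i<r. colon i (Q i T) \<inter> Q r T \<subseteq> Q i T)"

lemma relatively_regular_Int:
  assumes "relatively_regular" "i < r" "Z \<subseteq> Q r T"
  shows "Z \<inter> colon i (Q i T) \<subseteq> Z \<inter> Q i T"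
  using assms by (auto simp: relatively_regular_def)

text \<open>Let c i x be the last term of an element of Q (i + 1) (q^(k+1) X) that lies in Q i T.
  Then x lies in (Q i T : c i) and in qM, hence in Q i T by relative regularity, and the statement
  for one power less puts x into Q i (q^k X). The hypothesis \<open>base\<close> is the case k = 0:
  trivial for X = T, and the place where (iii) enters for X = \<aa> M.\<close>

lemma Q_Int_pw:
  assumes D: "relatively_regular" and X: "submodule X R M"
    and base: "\<And>i. i \<le> r \<Longrightarrow> Q i T \<inter> Q r X \<subseteq> Q i X"
    and "i \<le> r"
  shows "Q i T \<inter> pw (Suc k) X \<subseteq> Q i (pw k X)"
  using \<open>i \<le> r\<close>
proof (induction k arbitrary: i)
  case 0
  then show ?case
    using base by simp
next
  case (Suc k)
  show ?case
    using Suc.prems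
  \<comment> \<open>Descending induction: for i = r the right-hand side is the whole power, and the
    statement for i + 1 supplies the expansion whose last term is treated for i.\<close>
  proof (induction i rule: inc_induct)
    case base
    then show ?case
      by auto
  next
    case (step i)
    let ?Z = "pw (Suc k) X"
    have Z: "submodule ?Z R M" "?Z \<subseteq> Q r T"
      using X pw_subset_Q[OF X] Q_mono[OF submodule_sub[OF X]] by (blast intro: submodule_pw)+
    have sub: "Q i ?Z \<subseteq> Q i T"
      using Q_mono[OF submodule_sub[OF Z(1)]] .
    have "Q i T \<inter> pw (Suc (Suc k)) X \<subseteq> (Q (Suc i) T \<inter> pw (Suc (Suc k)) X) \<inter> Q i T"
      using Q_subset_Suc[of T i] by auto
    also have "\<dots> \<subseteq> (Q i ?Z <+>\<^bsub>M\<^esub> scale i ?Z) \<inter> Q i T"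
      using step.IH Z join_commute[of "scale i ?Z" "Q i ?Z"] by auto
    also have "\<dots> = Q i ?Z <+>\<^bsub>M\<^esub> (scale i ?Z \<inter> Q i T)"
      using Z sub by (intro modular_law) auto
    also have "\<dots> \<subseteq> Q i ?Z"
    proof (intro join_least order_refl)
      have "scale i ?Z \<inter> Q i T \<subseteq> scale i (Q i (pw k X))"
        unfolding scale_Int[OF Z(1)]
      proof (rule scale_mono)
        show "?Z \<inter> colon i (Q i T) \<subseteq> Q i (pw k X)"
          using relatively_regular_Int[OF D _ Z(2), of i] Suc.IH[of i] step.hyps by auto
      qed
      also have "\<dots> \<subseteq> Q i ?Z"
        using step.hyps X by (intro scale_Q_pw_subset) auto
      finally show "scale i ?Z \<inter> Q i T \<subseteq> Q i ?Z" .
    qed (use Z in auto)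
    finally show ?case .
  qed
qed

text \<open>If c i y = z + t with z in q^(k+1) X and t in Q i T, then z lies in Q (i + 1) T. By
  \<open>sub\<close> it is c i x plus an element of Q i T, with x in q^k X, and c i cancels.\<close>

lemma colon_pw_join:
  assumes X: "submodule X R M" and sub: "Q (Suc i) T \<inter> pw (Suc k) X \<subseteq> Q (Suc i) (pw k X)"
  shows "colon i (pw (Suc k) X <+>\<^bsub>M\<^esub> Q i T) \<subseteq> pw k X <+>\<^bsub>M\<^esub> colon i (Q i T)"
proof -
  let ?G = "colon i (pw (Suc k) X <+>\<^bsub>M\<^esub> Q i T)"
  have G: "submodule ?G R M"
    using X by (intro submodule_colon submodule_join submodule_pw submodule_Q) auto
  have "scale i ?G \<subseteq> pw (Suc k) X <+>\<^bsub>M\<^esub> Q i T"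
    using scale_subset_iff[OF submodule_sub[OF G]] by blast
  moreover have "scale i ?G \<subseteq> Q (Suc i) T"
    using scale_mono[OF submodule_sub[OF G]] scale_subset_Q[of T i "Suc i"]
    by (meson lessI order_trans submodule_carrier)
  ultimately have "scale i ?G \<subseteq> (Q i T <+>\<^bsub>M\<^esub> pw (Suc k) X) \<inter> Q (Suc i) T"
    using X join_commute[of "pw (Suc k) X" "Q i T"] by (simp del: funpow.simps)
  also have "\<dots> = Q i T <+>\<^bsub>M\<^esub> (pw (Suc k) X \<inter> Q (Suc i) T)"
    using X by (intro modular_law Q_subset_Suc) (simp_all del: funpow.simps Q.simps)
  also have "\<dots> \<subseteq> scale i (pw k X) <+>\<^bsub>M\<^esub> Q i T"
  proof (rule join_least)
    have "pw (Suc k) X \<inter> Q (Suc i) T \<subseteq> scale i (pw k X) <+>\<^bsub>M\<^esub> Q i (pw k X)"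
      using sub by (simp add: Int_commute)
    also have "\<dots> \<subseteq> scale i (pw k X) <+>\<^bsub>M\<^esub> Q i T"
      using X by (intro join_mono Q_mono submodule_sub) auto
    finally show "pw (Suc k) X \<inter> Q (Suc i) T \<subseteq> scale i (pw k X) <+>\<^bsub>M\<^esub> Q i T" .
  qed (use X in \<open>simp_all add: join_upper2\<close>)
  finally have "?G \<subseteq> colon i (scale i (pw k X) <+>\<^bsub>M\<^esub> Q i T)"
    using scale_subset_iff[OF submodule_sub[OF G]] by blast
  then show ?thesis
    using X by (simp add: colon_scale_join)
qed

text \<open>
  The next predicate says that \<open>c i\<close> acts injectively on the graded pieces of
  \<open>gr M / (c 0, \<dots>, c (i - 1)) gr M\<close> of degree \<open>0 < k \<le> n\<close>, and with the smallest possible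
  kernel in degree \<open>0\<close>.
\<close>

definition graded_regular_upto :: "nat \<Rightarrow> bool"
  where "graded_regular_upto n \<longleftrightarrow> (\<forall>i<r.
    colon i (pw 2 T <+>\<^bsub>M\<^esub> Q i T) \<subseteq> Q r T <+>\<^bsub>M\<^esub> colon i (Q i T) \<and>
    (\<forall>k<n. pw (Suc k) T \<inter> colon i (pw (k + 3) T <+>\<^bsub>M\<^esub> Q i (pw (Suc k) T))
      \<subseteq> pw (k + 2) T <+>\<^bsub>M\<^esub> Q i (pw k T)))"

text \<open>Both kernel conditions come from \<open>colon_pw_join\<close>, which leaves the summand
  (Q i T : c i). In degree 0 this is permitted; in positive degree its part inside q^(k+1) M lies in
  Q i T by relative regularity, and then in Q i (q^k M) by \<open>Q_Int_pw\<close>.\<close>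

lemma relatively_regular_imp_graded:
  assumes D: "relatively_regular"
  shows "graded_regular_upto n"
  unfolding graded_regular_upto_def
proof (intro allI impI conjI)
  fix i assume i: "i < r"
  have I: "Q j T \<inter> pw (Suc k) T \<subseteq> Q j (pw k T)" if "j \<le> r" for j k
    using D _ _ that by (rule Q_Int_pw) auto
  show "colon i (pw 2 T <+>\<^bsub>M\<^esub> Q i T) \<subseteq> Q r T <+>\<^bsub>M\<^esub> colon i (Q i T)"
    using colon_pw_join[OF submodule_carrier, of i 1] I[of "Suc i" 1] i
    by (simp add: numeral_2_eq_2)
  fix k assume "k < n"
  have "pw (Suc k) T \<inter> colon i (pw (k + 3) T <+>\<^bsub>M\<^esub> Q i (pw (Suc k) T))
      \<subseteq> (pw (k + 2) T <+>\<^bsub>M\<^esub> colon i (Q i T)) \<inter> pw (Suc k) T"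
  proof -
    have "colon i (pw (k + 3) T <+>\<^bsub>M\<^esub> Q i (pw (Suc k) T)) \<subseteq> colon i (pw (Suc (k + 2)) T <+>\<^bsub>M\<^esub> Q i T)"
      by (intro colon_mono join_mono Q_mono submodule_sub submodule_pw)
         (simp_all add: eval_nat_numeral)
    also have "\<dots> \<subseteq> pw (k + 2) T <+>\<^bsub>M\<^esub> colon i (Q i T)"
      using colon_pw_join[OF submodule_carrier I[of "Suc i" "k + 2"]] i by (simp only: Suc_le_eq)
    finally show ?thesis
      by auto
  qed
  also have "\<dots> = pw (k + 2) T <+>\<^bsub>M\<^esub> (colon i (Q i T) \<inter> pw (Suc k) T)"
    by (intro modular_law pw_antimono) auto
  also have "\<dots> \<subseteq> pw (k + 2) T <+>\<^bsub>M\<^esub> Q i (pw k T)"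
    using relatively_regular_Int[OF D i pw_subset_Q[of T k]] I[of i k] i
    by (intro join_mono order_refl) auto
  finally show "pw (Suc k) T \<inter> colon i (pw (k + 3) T <+>\<^bsub>M\<^esub> Q i (pw (Suc k) T))
      \<subseteq> pw (k + 2) T <+>\<^bsub>M\<^esub> Q i (pw k T)" .
qed

text \<open>The intersection property is recovered from the graded conditions alone. The local fact
  \<open>step\<close> gains one power, by induction over the generators: if c i x lies two powers
  deep modulo the earlier generators, the kernel condition makes x one power deeper up to the
  trivial part of the kernel. Induction on k then chains these gains.\<close>

lemma graded_Q_Int_pw:
  assumes E: "\<And>n. graded_regular_upto n" and "i \<le> r"
  shows "Q i T \<inter> pw (Suc k) T \<subseteq> Q i (pw k T)"
proof -
  have step: "Q i (pw k T) \<inter> pw (k + 2) T \<subseteq> Q i (pw (Suc k) T)" if "i \<le> r" for i k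
    using that
  proof (induction i)
    case 0
    then show ?case by simp
  next
    case (Suc i)
    let ?S = "scale i (pw k T)" and ?T' = "Q i (pw k T)" and ?W = "pw (k + 2) T"
    let ?V = "Q (Suc i) (pw (Suc k) T)"
    have i: "i < r" using Suc.prems by simp
    have V: "submodule ?V R M" "?V \<subseteq> ?W"
      using Suc.prems Q_index_mono[of "pw (Suc k) T" "Suc i" r] by simp_all
    have "?S \<inter> (?T' <+>\<^bsub>M\<^esub> ?W) = scale i (pw k T \<inter> colon i (?W <+>\<^bsub>M\<^esub> ?T'))"
      using scale_Int[of "pw k T"] join_commute[of ?T' ?W] by simp
    also have "\<dots> \<subseteq> ?V <+>\<^bsub>M\<^esub> ?T'"
    \<comment> \<open>In degree 0 the trivial part of the kernel is (Q i T : c i), which c i carries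
      into Q i T; in higher degree it is Q i (q^(k-1) M).\<close>
    proof (cases k)
      case 0
      have "pw k T \<inter> colon i (?W <+>\<^bsub>M\<^esub> ?T') \<subseteq> Q r T <+>\<^bsub>M\<^esub> colon i (Q i T)"
        using E[of 0] i 0 by (simp add: graded_regular_upto_def numeral_2_eq_2 le_infI2)
      then have "scale i (pw k T \<inter> colon i (?W <+>\<^bsub>M\<^esub> ?T')) \<subseteq> scale i (Q r T <+>\<^bsub>M\<^esub> colon i (Q i T))"
        by (rule scale_mono)
      also have "\<dots> = scale i (Q r T) <+>\<^bsub>M\<^esub> scale i (colon i (Q i T))"
        by (intro scale_join) auto
      also have "\<dots> \<subseteq> ?V <+>\<^bsub>M\<^esub> ?T'"
      proof (rule join_mono)
        show "scale i (Q r T) \<subseteq> ?V"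
          using scale_subset_Q[of "Q r T" i "Suc i"] 0 by simp
        show "scale i (colon i (Q i T)) \<subseteq> ?T'"
          using 0 by (auto simp: colon_elem_def)
      qed
      finally show ?thesis .
    next
      case (Suc k')
      have "pw k T \<inter> colon i (?W <+>\<^bsub>M\<^esub> ?T') \<subseteq> pw (Suc k) T <+>\<^bsub>M\<^esub> Q i (pw k' T)"
        using E[of k] i Suc by (auto simp: graded_regular_upto_def eval_nat_numeral)
      then have "scale i (pw k T \<inter> colon i (?W <+>\<^bsub>M\<^esub> ?T'))
          \<subseteq> scale i (pw (Suc k) T <+>\<^bsub>M\<^esub> Q i (pw k' T))"
        by (rule scale_mono)
      also have "\<dots> = scale i (pw (Suc k) T) <+>\<^bsub>M\<^esub> scale i (Q i (pw k' T))"
        by (intro scale_join submodule_Q submodule_pw) auto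
      also have "\<dots> \<subseteq> ?V <+>\<^bsub>M\<^esub> ?T'"
      proof (rule join_mono)
        show "scale i (pw (Suc k) T) \<subseteq> ?V"
          by (intro scale_subset_Q submodule_pw) auto
        show "scale i (Q i (pw k' T)) \<subseteq> ?T'"
          unfolding Suc by (intro scale_Q_pw_subset i) auto
      qed
      finally show ?thesis .
    qed
    finally have S: "?S \<inter> (?T' <+>\<^bsub>M\<^esub> ?W) \<subseteq> ?V <+>\<^bsub>M\<^esub> ?T'" .
    have "Q (Suc i) (pw k T) \<inter> ?W \<subseteq> (?S \<inter> (?T' <+>\<^bsub>M\<^esub> ?W)) <+>\<^bsub>M\<^esub> ?T'"
      using join_Int_subset[of ?S ?T' ?W] by simp
    also have "\<dots> \<subseteq> ?V <+>\<^bsub>M\<^esub> ?T'"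
      using S V by (intro join_least join_upper2) (auto simp del: Q.simps)
    finally have "Q (Suc i) (pw k T) \<inter> ?W \<subseteq> (?V <+>\<^bsub>M\<^esub> ?T') \<inter> ?W"
      by auto
    also have "\<dots> = ?V <+>\<^bsub>M\<^esub> (?T' \<inter> ?W)"
      using V by (intro modular_law) auto
    also have "\<dots> \<subseteq> ?V"
    proof (intro join_least V order_refl)
      show "?T' \<inter> ?W \<subseteq> ?V"
        using Suc.IH i Q_subset_Suc[of "pw (Suc k) T" i] by (auto simp del: Q.simps)
    qed
    finally show ?case .
  qed
  show ?thesis
    using \<open>i \<le> r\<close>
  proof (induction k)
    case 0
    then show ?case by auto
  next
    case (Suc k)
    have "Q i T \<inter> pw (Suc (Suc k)) T \<subseteq> Q i (pw k T) \<inter> pw (k + 2) T"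
      using Suc Q_subset[of "pw (Suc k) T" r] by auto
    then show ?case
      using step[OF Suc.prems, of k] by (rule order_trans)
  qed
qed

text \<open>An element is pushed from q^(k+1) M to q^(k+2) M modulo Q i T, for k = 0, ..., n - 1, by
  the kernel condition in degree k + 1. To apply that condition, the error term in Q i T is first
  moved into Q i (q^(k+1) M) by \<open>graded_Q_Int_pw\<close>.\<close>

lemma graded_regular_imp_superficial:
  assumes E: "\<And>n. graded_regular_upto n" and i: "i < r"
  shows "colon i (pw (Suc (Suc n)) T <+>\<^bsub>M\<^esub> Q i T) \<inter> Q r T \<subseteq> pw (Suc n) T <+>\<^bsub>M\<^esub> Q i T"
proof -
  let ?G = "colon i (pw (Suc (Suc n)) T <+>\<^bsub>M\<^esub> Q i T) \<inter> Q r T"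
  have "?G \<subseteq> pw (Suc k) T <+>\<^bsub>M\<^esub> Q i T" if "k \<le> n" for k
    using that
  proof (induction k)
    case 0
    then show ?case
      using join_upper1[of "Q r T" "Q i T"] by auto
  next
    case (Suc k)
    let ?C = "colon i (pw (k + 3) T <+>\<^bsub>M\<^esub> Q i T)"
    have C: "submodule ?C R M"
      by (intro submodule_colon submodule_join submodule_pw submodule_Q) auto
    have "pw (Suc (Suc n)) T \<subseteq> pw (k + 3) T"
      using Suc.prems by (intro pw_antimono) auto
    then have "?G \<subseteq> ?C"
      using colon_mono[OF join_mono[OF _ order_refl]] by (meson Int_lower1 order_trans)
    then have "?G \<subseteq> (Q i T <+>\<^bsub>M\<^esub> pw (Suc k) T) \<inter> ?C"
      using Suc join_commute[of "Q i T" "pw (Suc k) T"] by auto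
    also have "\<dots> = Q i T <+>\<^bsub>M\<^esub> (pw (Suc k) T \<inter> ?C)"
    proof (intro modular_law C submodule_Q submodule_pw submodule_carrier)
      have "Q i T \<subseteq> colon i (Q i T)"
        by (intro subset_colon) auto
      also have "\<dots> \<subseteq> ?C"
        by (intro colon_mono join_upper2 submodule_pw submodule_Q submodule_carrier)
      finally show "Q i T \<subseteq> ?C" .
    qed
    also have "\<dots> \<subseteq> Q i T <+>\<^bsub>M\<^esub> (pw (k + 2) T <+>\<^bsub>M\<^esub> Q i T)"
    proof (intro join_mono order_refl)
      let ?P = "pw (Suc k) T \<inter> ?C"
      have P: "submodule ?P R M"
        using C by (intro submodule_Int submodule_pw) auto
      have "scale i ?P \<subseteq> pw (k + 3) T <+>\<^bsub>M\<^esub> Q i T"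
        by (auto simp: colon_elem_def)
      moreover have "scale i ?P \<subseteq> pw (k + 2) T"
        using scale_mono[of ?P "pw (Suc k) T" "c i"] scale_pw_subset[of T i "Suc k"] i by auto
      ultimately have "scale i ?P \<subseteq> (pw (k + 3) T <+>\<^bsub>M\<^esub> Q i T) \<inter> pw (k + 2) T"
        by simp
      also have "\<dots> = pw (k + 3) T <+>\<^bsub>M\<^esub> (Q i T \<inter> pw (k + 2) T)"
        by (intro modular_law pw_antimono) auto
      also have "\<dots> \<subseteq> pw (k + 3) T <+>\<^bsub>M\<^esub> Q i (pw (Suc k) T)"
        using graded_Q_Int_pw[OF E, of i "Suc k"] i by (intro join_mono) auto
      finally have "?P \<subseteq> pw (Suc k) T \<inter> colon i (pw (k + 3) T <+>\<^bsub>M\<^esub> Q i (pw (Suc k) T))"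
        using scale_subset_iff[OF submodule_sub[OF P]] by auto
      also have "\<dots> \<subseteq> pw (k + 2) T <+>\<^bsub>M\<^esub> Q i (pw k T)"
        using E[of "Suc k"] i by (auto simp: graded_regular_upto_def)
      also have "\<dots> \<subseteq> pw (k + 2) T <+>\<^bsub>M\<^esub> Q i T"
        by (intro join_mono Q_mono submodule_sub submodule_pw) auto
      finally show "?P \<subseteq> pw (k + 2) T <+>\<^bsub>M\<^esub> Q i T" .
    qed
    also have "\<dots> \<subseteq> pw (Suc (Suc k)) T <+>\<^bsub>M\<^esub> Q i T"
      by (intro join_least join_upper2) (simp_all add: join_upper1)
    finally show ?case .
  qed
  then show ?thesis
    by simp
qed

text \<open>If x in U (m + 1) lies in qM, then c 0 x = 0 by induction, and relative regularity for i
  = 0 says that (0 : c 0) meets qM only in 0. It is applied to U m = (0 : q^m).\<close>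

lemma submodules_disjoint:
  assumes D: "relatively_regular" and r: "0 < r"
    and U: "\<And>m. submodule (U m) R M" "U 0 = {\<zero>\<^bsub>M\<^esub>}" "\<And>m. scale 0 (U (Suc m)) \<subseteq> U m"
  shows "U m \<inter> Q r T \<subseteq> {\<zero>\<^bsub>M\<^esub>}"
proof (induction m)
  case (Suc m)
  have "scale 0 (U (Suc m) \<inter> Q r T) \<subseteq> U m \<inter> Q r T"
    using U(3)[of m] scale_subset[of "c 0" "Q r T"] by auto
  then have "scale 0 (U (Suc m) \<inter> Q r T) \<subseteq> Q 0 T"
    using Suc by (simp only: Q.simps)
  then have "U (Suc m) \<inter> Q r T \<subseteq> colon 0 (Q 0 T)"
    using submodule_sub[OF U(1)] by (subst (asm) scale_subset_iff) auto
  moreover have "colon 0 (Q 0 T) \<inter> Q r T \<subseteq> Q 0 T"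
    using D r unfolding relatively_regular_def by blast
  ultimately show ?case
    by (auto simp only: Q.simps)
qed (simp add: U)

end

section \<open>Two combinatorial lemmas\<close>

text \<open>Unrolled, \<Delta> i k is a combination of the \<delta> j l with i <= j < r and l <= k
  whose coefficients count lattice paths. They are positive, so \<Delta> i k vanishes only if all
  these \<delta> j l do.\<close>

lemma nonneg_deficit_recursion:
  fixes \<Delta> \<delta> :: "nat \<Rightarrow> nat \<Rightarrow> int"
  assumes top: "\<And>k. \<Delta> r k = 0"
    and zero: "\<And>i. i < r \<Longrightarrow> \<Delta> i 0 = \<Delta> (Suc i) 0 + \<delta> i 0"
    and suc: "\<And>i k. i < r \<Longrightarrow> \<Delta> i (Suc k) = \<Delta> (Suc i) (Suc k) + \<Delta> i k + \<delta> i (Suc k)"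
    and nonneg: "\<And>i k. i < r \<Longrightarrow> 0 \<le> \<delta> i k"
    and "i \<le> r"
  shows "0 \<le> \<Delta> i k \<and> (\<Delta> i k = 0 \<longleftrightarrow> (\<forall>j\<in>{i..<r}. \<forall>l\<le>k. \<delta> j l = 0))"
  using \<open>i \<le> r\<close>
proof (induction k arbitrary: i)
  case 0
  then show ?case
  proof (induction i rule: inc_induct)
    case base
    then show ?case by (simp add: top)
  next
    case (step i)
    have "{i..<r} = insert i {Suc i..<r}"
      using step.hyps by auto
    then show ?case
      using step zero[of i] nonneg[of i 0] by auto
  qed
next
  case (Suc k)
  show ?case
    using Suc.prems
  proof (induction i rule: inc_induct)
    case base
    then show ?case by (simp add: top)
  next
    case (step i)
    have i: "{i..<r} = insert i {Suc i..<r}"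
      using step.hyps by auto
    have IH: "0 \<le> \<Delta> i k" "\<Delta> i k = 0 \<longleftrightarrow> (\<forall>j\<in>{i..<r}. \<forall>l\<le>k. \<delta> j l = 0)"
      using Suc.IH[of i] step.hyps by auto
    have "\<Delta> i (Suc k) = 0 \<longleftrightarrow> \<Delta> (Suc i) (Suc k) = 0 \<and> \<Delta> i k = 0 \<and> \<delta> i (Suc k) = 0"
      using step IH(1) suc[of i k] nonneg[of i "Suc k"] by auto
    then show ?case
      using step IH suc[of i k] nonneg[of i "Suc k"] by (auto simp: i le_Suc_eq)
  qed
qed

text \<open>Without deficits the recursion is Pascal's rule with sources b i in degree 0; the
  difference between its solution and w obeys \<open>nonneg_deficit_recursion\<close>.\<close>

lemma length_recursion_bound:
  fixes w \<delta> :: "nat \<Rightarrow> nat \<Rightarrow> int" and b :: "nat \<Rightarrow> int"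
  assumes top: "\<And>k. w r k = 0"
    and zero: "\<And>i. i < r \<Longrightarrow> w i 0 + \<delta> i 0 = w (Suc i) 0 + b i"
    and suc: "\<And>i k. i < r \<Longrightarrow> w i (Suc k) + \<delta> i (Suc k) = w (Suc i) (Suc k) + w i k"
    and nonneg: "\<And>i k. i < r \<Longrightarrow> 0 \<le> \<delta> i k"
  shows "w 0 k \<le> (\<Sum>j<r. int ((k + j) choose j) * b j)"
    and "w 0 k = (\<Sum>j<r. int ((k + j) choose j) * b j) \<longleftrightarrow> (\<forall>i<r. \<forall>l\<le>k. \<delta> i l = 0)"
proof -
  \<comment> \<open>The coefficient of b j counts the monomials of degree k in c i, ..., c
    j.\<close>
  define W where "W i k = (\<Sum>j\<in>{i..<r}. int ((k + (j - i)) choose (j - i)) * b j)" for i k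
  have split: "{i..<r} = insert i {Suc i..<r}" if "i < r" for i
    using that by auto
  have W0: "W i 0 = W (Suc i) 0 + b i" if "i < r" for i
    by (simp add: W_def split[OF that])
  have WSuc: "W i (Suc k) = W (Suc i) (Suc k) + W i k" if "i < r" for i k
  proof -
    have "(\<Sum>j\<in>{Suc i..<r}. int ((Suc k + (j - i)) choose (j - i)) * b j)
        = (\<Sum>j\<in>{Suc i..<r}. int ((Suc k + (j - Suc i)) choose (j - Suc i)) * b j
            + int ((k + (j - i)) choose (j - i)) * b j)"
    proof (rule sum.cong)
      fix j assume j: "j \<in> {Suc i..<r}"
      then obtain m where m: "j - i = Suc m" "j - Suc i = m"
        by (cases "j - i") auto
      show "int ((Suc k + (j - i)) choose (j - i)) * b j
          = int ((Suc k + (j - Suc i)) choose (j - Suc i)) * b j + int ((k + (j - i)) choose (j - i)) * b j"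
        by (simp add: m algebra_simps)
    qed simp
    then show ?thesis
      by (simp add: W_def split[OF that] sum.distrib)
  qed
  have main: "0 \<le> W 0 k - w 0 k \<and> (W 0 k - w 0 k = 0 \<longleftrightarrow> (\<forall>j\<in>{0..<r}. \<forall>l\<le>k. \<delta> j l = 0))"
  proof (rule nonneg_deficit_recursion[where \<Delta> = "\<lambda>i k. W i k - w i k"])
    show "W r k - w r k = 0" for k
      by (simp add: W_def top)
    show "W i 0 - w i 0 = W (Suc i) 0 - w (Suc i) 0 + \<delta> i 0" if "i < r" for i
      using W0[OF that] zero[OF that] by simp
    show "W i (Suc k) - w i (Suc k) = W (Suc i) (Suc k) - w (Suc i) (Suc k) + (W i k - w i k) + \<delta> i (Suc k)"
      if "i < r" for i k
      using WSuc[OF that, of k] suc[OF that, of k] by simp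
  qed (use nonneg in auto)
  have W: "W 0 k = (\<Sum>j<r. int ((k + j) choose j) * b j)"
    by (simp add: W_def lessThan_atLeast0)
  show "w 0 k \<le> (\<Sum>j<r. int ((k + j) choose j) * b j)"
    using main W by simp
  show "w 0 k = (\<Sum>j<r. int ((k + j) choose j) * b j) \<longleftrightarrow> (\<forall>i<r. \<forall>l\<le>k. \<delta> i l = 0)"
  proof -
    have "w 0 k = W 0 k \<longleftrightarrow> (\<forall>j\<in>{0..<r}. \<forall>l\<le>k. \<delta> j l = 0)"
      using main[THEN conjunct2] by (subst eq_commute) (simp only: right_minus_eq)
    then show ?thesis
      by (simp only: W Ball_def atLeastLessThan_iff le0 simp_thms)
  qed
qed

text \<open>Summation by parts: in the induction on r the new difference c (r + 1) - c r collects
  the binomials with index 0 to r, whose sum is a single binomial by the hockey-stick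
  identity.\<close>

lemma sum_choose_differences:
  fixes c :: "nat \<Rightarrow> int"
  shows "(\<Sum>j<r. int ((n + 1 + j) choose j) * (c (Suc j) - c j))
    = (\<Sum>j<r. int ((n + j) choose j) * (c r - c j))"
proof (induction r)
  case (Suc r)
  have "(\<Sum>j<Suc r. int ((n + j) choose j) * (c (Suc r) - c j))
      = (\<Sum>j<Suc r. int ((n + j) choose j) * (c (Suc r) - c r))
        + (\<Sum>j<Suc r. int ((n + j) choose j) * (c r - c j))"
    by (simp add: sum.distrib[symmetric] algebra_simps)
  also have "(\<Sum>j<Suc r. int ((n + j) choose j) * (c (Suc r) - c r))
      = int (\<Sum>j\<le>r. (n + j) choose j) * (c (Suc r) - c r)"
    by (simp add: sum_distrib_right lessThan_Suc_atMost)
  also have "(\<Sum>j\<le>r. (n + j) choose j) = (n + 1 + r) choose r"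
    by (simp add: sum_choose_lower)
  finally show ?case
    using Suc by simp
qed simp

text \<open>Brings the binomial sum over the e_i into cumulative form: by Pascal's rule, passing
  from n to n + 1 adds exactly the maximal length of the next graded piece. The c j will be the
  lengths whose consecutive differences are the e_i.\<close>

lemma hilbert_sum_eq:
  fixes c :: "nat \<Rightarrow> int"
  assumes "c 0 = 0"
  shows "(\<Sum>j\<le>r. int ((n + j) choose j) * (c (Suc j) - c j))
    = c (Suc r) + (\<Sum>k<n. \<Sum>j<r. int ((k + j) choose j) * (c (Suc r) - c (Suc j)))"
proof (induction n)
  case 0
  have "(\<Sum>j\<le>r. c (Suc j) - c j) = c (Suc r) - c 0"
    by (induction r) auto
  then show ?case
    using assms by simp
next
  case (Suc n)
  have "(\<Sum>j\<le>r. int ((Suc n + j) choose j) * (c (Suc j) - c j))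
      = (c 1 - c 0) + (\<Sum>j<r. int ((Suc n + Suc j) choose Suc j) * (c (Suc (Suc j)) - c (Suc j)))"
    by (simp add: sum.atMost_shift)
  also have "\<dots> = (c 1 - c 0) + (\<Sum>j<r. int ((n + Suc j) choose Suc j) * (c (Suc (Suc j)) - c (Suc j)))
      + (\<Sum>j<r. int ((n + 1 + j) choose j) * (c (Suc (Suc j)) - c (Suc j)))"
    by (simp add: sum.distrib[symmetric] algebra_simps)
  also have "(c 1 - c 0) + (\<Sum>j<r. int ((n + Suc j) choose Suc j) * (c (Suc (Suc j)) - c (Suc j)))
      = (\<Sum>j\<le>r. int ((n + j) choose j) * (c (Suc j) - c j))"
    by (simp add: sum.atMost_shift)
  also have "(\<Sum>j<r. int ((n + 1 + j) choose j) * (c (Suc (Suc j)) - c (Suc j)))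
      = (\<Sum>j<r. int ((n + j) choose j) * (c (Suc r) - c (Suc j)))"
    by (rule sum_choose_differences[where c = "\<lambda>j. c (Suc j)"])
  finally show ?case
    using Suc by simp
qed

section \<open>Bounds for the length of graded pieces\<close>

context module_seq
begin

text \<open>One descends from q^(k+1) M to q^(k+2) M through q^(k+2) M + Q i (q^k M), from i = r to
  i = 0. Dropping c i costs at most l(q^k M/q^(k+1) M), since c i q^(k+1) M lies in q^(k+2)
  M.\<close>

lemma finite_colength_pw:
  assumes fin: "finite_colength (Q r T)"
  shows "finite_colength (pw k T)"
proof -
  have "finite_colength (pw (Suc k) T)" for k
  proof (induction k)
    case 0
    then show ?case using fin by simp
  next
    case (Suc k)
    let ?Y = "\<lambda>i. pw (k + 2) T <+>\<^bsub>M\<^esub> Q i (pw k T)"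
    have Y: "submodule (?Y i) R M" for i
      by (intro submodule_join submodule_pw submodule_Q) auto
    have "finite_colength (?Y i)" if "i \<le> r" for i
      using that
    proof (induction i rule: inc_induct)
      case base
      have "pw (k + 2) T \<subseteq> pw (Suc k) T"
        by (intro pw_antimono) auto
      then have "?Y r = pw (Suc k) T"
        using join_absorb(2)[of "pw (Suc k) T" "pw (k + 2) T"] by simp
      then show ?case
        using Suc by (simp only:)
    next
      case (step i)
      have "?Y (Suc i) = scale i (pw k T) <+>\<^bsub>M\<^esub> ?Y i"
        by (simp del: funpow.simps add: join_left_commute)
      moreover have "finite_colength (pw k T \<inter> colon i (?Y i))"
      proof (rule finite_colength_mono[OF Suc])
        have "scale i (pw (Suc k) T) \<subseteq> pw (k + 2) T"
          using scale_pw_subset[of T i "Suc k"] step.hyps by simp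
        also have "\<dots> \<subseteq> ?Y i"
          by (intro join_upper1 submodule_pw submodule_Q) auto
        finally have "pw (Suc k) T \<subseteq> colon i (?Y i)"
          using scale_subset_iff[OF submodule_sub[OF submodule_pw[OF submodule_carrier]]] by blast
        then show "pw (Suc k) T \<subseteq> pw k T \<inter> colon i (?Y i)"
          using pw_antimono[of T k "Suc k"] by simp
      qed (intro submodule_Int submodule_pw submodule_colon Y; simp)
      ultimately show ?case
        using finite_colength_scale[OF c_closed submodule_pw[OF submodule_carrier] Y] step.IH
        by (simp only:)
  qed
    from this[of 0] have "finite_colength (?Y 0)"
      by simp
    moreover have "?Y 0 = pw (Suc (Suc k)) T"
      by (simp add: join_absorb submodule_zero)
    ultimately show ?case
      by (simp only:)
  qed
  then show ?thesis
    by (cases k) auto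
qed

text \<open>
  The pieces \<open>(Z k + Q i (q^(k-1) M)) / Z k\<close> are built up one generator at a time; multiplication by
  \<open>c i\<close> maps degree \<open>k\<close> onto the \<open>i\<close>-th step of degree \<open>k + 1\<close>, and \<open>graded_kernel\<close> is the part of
  the kernel present for trivial reasons.
\<close>

definition graded_step :: "(nat \<Rightarrow> 'c set) \<Rightarrow> nat \<Rightarrow> nat \<Rightarrow> 'c set"
  where "graded_step Z i k = Z (Suc k) <+>\<^bsub>M\<^esub> Q i (pw k T)"

definition graded_kernel :: "(nat \<Rightarrow> 'c set) \<Rightarrow> (nat \<Rightarrow> 'c set) \<Rightarrow> nat \<Rightarrow> nat \<Rightarrow> 'c set"
  where "graded_kernel Z B i k =
    (case k of 0 \<Rightarrow> Z 0 <+>\<^bsub>M\<^esub> B i | Suc l \<Rightarrow> graded_step Z i l)"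

text \<open>With w i k = l(q^(k+1) M / \<open>graded_step Z i k\<close>), multiplication by c i
  shows that w i k - w (i + 1) k is the length of q^k M modulo its kernel. Replacing the kernel by
  its trivial part gives Pascal's recursion, because in degree k + 1 that part is
  \<open>graded_step Z i k\<close> and contributes w i k. Z and B are left free so that one count
  serves both q^k M/q^(k+1) M and q^k M/q^k \<aa> M.\<close>

lemma graded_length_bound:
  assumes fin: "finite_colength (Q r T)"
    and Z: "\<And>k. submodule (Z k) R M" "\<And>k. Z k \<subseteq> pw k T" "\<And>k. pw (Suc k) T \<subseteq> Z k"
    and ZSuc: "\<And>i k. i < r \<Longrightarrow> scale i (Z k) \<subseteq> Z (Suc k)"
    and B: "\<And>i. submodule (B i) R M" "\<And>i. i < r \<Longrightarrow> scale i (B i) \<subseteq> graded_step Z i 0"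
  shows "colength (Z (Suc k)) - colength (pw (Suc k) T)
      \<le> (\<Sum>i<r. int ((k + i) choose i) * colength (Z 0 <+>\<^bsub>M\<^esub> B i))" (is ?le)
    and "colength (Z (Suc k)) - colength (pw (Suc k) T)
        = (\<Sum>i<r. int ((k + i) choose i) * colength (Z 0 <+>\<^bsub>M\<^esub> B i))
      \<longleftrightarrow> (\<forall>i<r. \<forall>l\<le>k. pw l T \<inter> colon i (graded_step Z i l) \<subseteq> graded_kernel Z B i l)" (is ?eq)
proof -
  let ?Y = "graded_step Z" and ?K = "graded_kernel Z B"
  let ?C = "\<lambda>i k. pw k T \<inter> colon i (?Y i k)"
  have Y: "submodule (?Y i k) R M" for i k
    unfolding graded_step_def using Z by auto
  have K: "submodule (?K i k) R M" for i k
    unfolding graded_kernel_def using Z B Y by (cases k) auto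
  have C: "submodule (?C i k) R M" for i k
    using Y by auto
  have finZ: "finite_colength (Z k)" for k
    using finite_colength_mono[OF finite_colength_pw[OF fin] Z(1,3)] .
  have finY: "finite_colength (?Y i k)" for i k
    by (rule finite_colength_mono[OF finZ[of "Suc k"] Y]) (use Z in \<open>simp add: graded_step_def join_upper1\<close>)
  have finK: "finite_colength (?K i k)" for i k
    using finite_colength_mono[OF finZ[of 0], of "Z 0 <+>\<^bsub>M\<^esub> B i"] Z B finY
    by (cases k) (auto simp: graded_kernel_def join_upper1)
  have KC: "?K i k \<subseteq> ?C i k" if i: "i < r" for i k
  proof (cases k)
    case 0
    have "scale i (Z 0) \<subseteq> ?Y i 0"
      using ZSuc[OF i, of 0] Z join_upper1[OF Z(1)[of 1], of "Q i (pw 0 T)"]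
      by (simp add: graded_step_def)
    then have "Z 0 \<subseteq> colon i (?Y i 0)" "B i \<subseteq> colon i (?Y i 0)"
      using B[of i] i Z(1)[of 0] scale_subset_iff[OF submodule_sub] by blast+
    then have "Z 0 <+>\<^bsub>M\<^esub> B i \<subseteq> colon i (?Y i 0)"
      using Y by (intro join_least) auto
    moreover have "Z 0 <+>\<^bsub>M\<^esub> B i \<subseteq> T"
      using Z B by (intro submodule_sub) auto
    ultimately show ?thesis
      using 0 by (simp add: graded_kernel_def)
  next
    case (Suc l)
    have "Z (Suc l) <+>\<^bsub>M\<^esub> Q i (pw l T) \<subseteq> pw (Suc l) T"
      using Z(2)[of "Suc l"] Q_index_mono[of "pw l T" i r] i by (intro join_least) auto
    moreover have "Z (Suc l) <+>\<^bsub>M\<^esub> Q i (pw l T) \<subseteq> colon i (?Y i (Suc l))"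
    proof (rule join_least)
      have "scale i (Z (Suc l)) \<subseteq> ?Y i (Suc l)"
        unfolding graded_step_def using i Z
        by (intro order_trans[OF ZSuc join_upper1]) auto
      then show "Z (Suc l) \<subseteq> colon i (?Y i (Suc l))"
        using scale_subset_iff[OF submodule_sub[OF Z(1)]] by blast
      have "scale i (Q i (pw l T)) \<subseteq> ?Y i (Suc l)"
        unfolding graded_step_def using i Z
        by (intro order_trans[OF scale_Q_pw_subset join_upper2]) auto
      then show "Q i (pw l T) \<subseteq> colon i (?Y i (Suc l))"
        using scale_subset_iff[OF submodule_sub[OF submodule_Q[OF submodule_pw[OF submodule_carrier]]]]
        by blast
    qed (use Y in auto)
    ultimately show ?thesis
      by (simp add: Suc graded_kernel_def graded_step_def)
  qed
  have finC: "finite_colength (?C i k)" if "i < r" for i k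
    using finite_colength_mono[OF finK C KC[OF that]] .
  have step: "colength (?Y i k) - colength (?Y (Suc i) k) = colength (?C i k) - colength (pw k T)"
    if "i < r" for i k
  proof -
    have "?Y (Suc i) k = scale i (pw k T) <+>\<^bsub>M\<^esub> ?Y i k"
      using Z by (simp add: graded_step_def join_left_commute)
    then show ?thesis
      using colength_scale[OF c_closed submodule_pw[OF submodule_carrier] finY finC[OF that]] by simp
  qed
  define w where "w i k = colength (?Y i k) - colength (pw (Suc k) T)" for i k
  \<comment> \<open>The deficit: the length of the kernel modulo its trivial part.\<close>
  define \<delta> where "\<delta> i k = colength (?K i k) - colength (?C i k)" for i k
  have \<delta>0: "\<delta> i k = 0 \<longleftrightarrow> ?C i k \<subseteq> ?K i k" if "i < r" for i k
    using colength_eq_imp[OF finK C KC[OF that]] KC[OF that]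
    unfolding \<delta>_def by (metis antisym diff_eq_eq add_0 diff_self order_refl)
  have "Z (Suc k) <+>\<^bsub>M\<^esub> pw (Suc k) T = pw (Suc k) T" for k
    using Z(1) Z(2)[of "Suc k"] by (intro join_absorb) auto
  then have top: "w r k = 0" for k
    by (simp add: w_def graded_step_def)
  have zero: "w i 0 + \<delta> i 0 = w (Suc i) 0 + colength (Z 0 <+>\<^bsub>M\<^esub> B i)" if "i < r" for i
    using step[OF that, of 0] by (simp add: w_def \<delta>_def graded_kernel_def)
  have suc: "w i (Suc k) + \<delta> i (Suc k) = w (Suc i) (Suc k) + w i k" if "i < r" for i k
    using step[OF that, of "Suc k"] by (simp add: w_def \<delta>_def graded_kernel_def)
  have nonneg: "0 \<le> \<delta> i k" if "i < r" for i k
    using colength_mono[OF finK C KC[OF that]] by (simp add: \<delta>_def)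
  have "?Y 0 k = Z (Suc k)"
    using Z submodule_zero by (simp add: graded_step_def join_absorb)
  then have w0: "w 0 k = colength (Z (Suc k)) - colength (pw (Suc k) T)"
    by (simp add: w_def)
  note bound = length_recursion_bound[OF top zero suc nonneg, of k]
  show ?le
    using bound(1) w0 by simp
  show ?eq
    using bound(2) w0 \<delta>0 by simp
qed

end

context module_seq
begin

text \<open>The count for Z k = q^(k+1) M. In degree 0 the kernel of c i modulo the earlier
  generators contains (Q i T : c i) besides qM, which dictates B.\<close>

lemma pw_step_bound:
  assumes fin: "finite_colength (Q r T)"
  shows "colength (pw (Suc (Suc k)) T) - colength (pw (Suc k) T)
      \<le> (\<Sum>i<r. int ((k + i) choose i) * colength (Q r T <+>\<^bsub>M\<^esub> colon i (Q i T)))" (is ?le)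
    and "colength (pw (Suc (Suc k)) T) - colength (pw (Suc k) T)
        = (\<Sum>i<r. int ((k + i) choose i) * colength (Q r T <+>\<^bsub>M\<^esub> colon i (Q i T)))
      \<longleftrightarrow> graded_regular_upto k" (is "?eq \<longleftrightarrow> _")
proof -
  let ?Z = "\<lambda>k. pw (Suc k) T" and ?B = "\<lambda>i. colon i (Q i T)"
  have Z: "submodule (?Z k) R M" "?Z k \<subseteq> pw k T" "pw (Suc k) T \<subseteq> ?Z k" for k
    by (auto intro: subsetD[OF Q_subset])
  have ZSuc: "scale i (?Z k) \<subseteq> ?Z (Suc k)" if "i < r" for i k
    using that by (intro scale_pw_subset) auto
  have B: "submodule (?B i) R M" "scale i (?B i) \<subseteq> graded_step ?Z i 0" for i
  proof -
    show "submodule (?B i) R M" by simp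
    have "scale i (?B i) \<subseteq> Q i T"
      by (auto simp: colon_elem_def)
    also have "\<dots> \<subseteq> graded_step ?Z i 0"
      by (simp add: graded_step_def join_upper2)
    finally show "scale i (?B i) \<subseteq> graded_step ?Z i 0" .
  qed
  note bound = graded_length_bound[of ?Z ?B k, OF fin Z ZSuc B]
  show ?le
    using bound(1) by simp
  \<comment> \<open>Degree 0 is split off; degree l + 1 gives the second clause of
    \<open>graded_regular_upto\<close>, which explains the shifted exponents there.\<close>
  have "(\<forall>l\<le>k. pw l T \<inter> colon i (graded_step ?Z i l) \<subseteq> graded_kernel ?Z ?B i l)
    \<longleftrightarrow> colon i (pw 2 T <+>\<^bsub>M\<^esub> Q i T) \<subseteq> Q r T <+>\<^bsub>M\<^esub> colon i (Q i T) \<and>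
      (\<forall>l<k. pw (Suc l) T \<inter> colon i (pw (l + 3) T <+>\<^bsub>M\<^esub> Q i (pw (Suc l) T))
        \<subseteq> pw (l + 2) T <+>\<^bsub>M\<^esub> Q i (pw l T))" (is "?L \<longleftrightarrow> ?R") for i
  proof -
    have "?L \<longleftrightarrow> pw 0 T \<inter> colon i (graded_step ?Z i 0) \<subseteq> graded_kernel ?Z ?B i 0
        \<and> (\<forall>l<k. pw (Suc l) T \<inter> colon i (graded_step ?Z i (Suc l)) \<subseteq> graded_kernel ?Z ?B i (Suc l))"
      by (metis (no_types, lifting) Suc_le_eq le0 not0_implies_Suc)
    moreover have "pw 0 T \<inter> colon i (graded_step ?Z i 0) = colon i (pw 2 T <+>\<^bsub>M\<^esub> Q i T)"
      by (auto simp: graded_step_def numeral_2_eq_2 colon_elem_def)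
    ultimately show ?thesis
      by (simp add: graded_step_def graded_kernel_def numeral_3_eq_3)
  qed
  then show "?eq \<longleftrightarrow> graded_regular_upto k"
    using bound(2) by (simp add: graded_regular_upto_def)
qed

text \<open>l(M/qM) plus the maximal lengths of the graded pieces of degree 1, ..., n.
  \<open>length_bound_eq\<close> identifies it with the binomial sum over the e_i.\<close>

definition hilbert_bound :: "nat \<Rightarrow> int"
  where "hilbert_bound n = colength (Q r T)
    + (\<Sum>k<n. \<Sum>i<r. int ((k + i) choose i) * colength (Q r T <+>\<^bsub>M\<^esub> colon i (Q i T)))"

text \<open>Each graded piece obeys its own bound, so the sum is extremal only if every piece
  is.\<close>

lemma colength_pw_bound:
  assumes fin: "finite_colength (Q r T)"
  shows "colength (pw (Suc n) T) \<le> hilbert_bound n \<and>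
    (colength (pw (Suc n) T) = hilbert_bound n \<longleftrightarrow> (\<forall>k<n. graded_regular_upto k))"
proof (induction n)
  case 0
  then show ?case
    by (simp add: hilbert_bound_def)
next
  case (Suc n)
  have "hilbert_bound (Suc n) = hilbert_bound n
      + (\<Sum>i<r. int ((n + i) choose i) * colength (Q r T <+>\<^bsub>M\<^esub> colon i (Q i T)))"
    by (simp add: hilbert_bound_def)
  then show ?case
    using Suc pw_step_bound[OF fin, of n] by (auto simp: less_Suc_eq simp del: funpow.simps)
qed

lemma sum_choose_lessThan:
  assumes "0 < r"
  shows "(\<Sum>i<r. (m + i) choose i) = (m + r) choose (r - 1)"
proof -
  obtain s where r: "r = Suc s"
    using assms by (cases r) auto
  show ?thesis
    using sum_choose_lower[of m s] by (simp add: r lessThan_Suc_atMost)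
qed

section \<open>Length of q^n M/q^n X for a submodule X containing qM\<close>

context
  fixes X :: "'c set" and U :: "nat \<Rightarrow> 'c set" and m :: nat
  assumes fin: "finite_colength (Q r T)" and r: "0 < r"
    and X: "submodule X R M" "Q r T \<subseteq> X"
    and U: "\<And>m. submodule (U m) R M" "U 0 = {\<zero>\<^bsub>M\<^esub>}"
      "\<And>i m. i < r \<Longrightarrow> scale i (U (Suc m)) \<subseteq> U m"
begin

text \<open>For the fixed target n = Suc m, degree k carries the torsion U (n - k), since a
  generator lowers the index of U by one. The family starts at X + U n, which gives the factor in
  the bound, and reaches q^n X in degree n because U 0 = 0. Beyond n, truncated subtraction keeps
  the torsion part zero.\<close>

private abbreviation (input) Z :: "nat \<Rightarrow> 'c set"
  where "Z \<equiv> \<lambda>k. pw k X <+>\<^bsub>M\<^esub> (U (Suc m - k) \<inter> pw k T)"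

text \<open>The torsion already sits in Z 0, so no further kernel is set aside in degree 0, and
  every generator contributes the same number l(M/(X + U (Suc m))).\<close>

private abbreviation (input) B :: "nat \<Rightarrow> 'c set"
  where "B \<equiv> \<lambda>_. {\<zero>\<^bsub>M\<^esub>}"

private lemma Z_facts:
  shows "submodule (Z k) R M" "Z k \<subseteq> pw k T" "pw (Suc k) T \<subseteq> Z k"
    and "i < r \<Longrightarrow> scale i (Z k) \<subseteq> Z (Suc k)"
    and "submodule (B i) R M" "i < r \<Longrightarrow> scale i (B i) \<subseteq> graded_step Z i 0"
proof -
  show Z: "submodule (Z k) R M" for k
    using X U by auto
  show "Z k \<subseteq> pw k T"
    using pw_mono[OF submodule_sub[OF X(1)]] by (intro join_least) auto
  have "pw (Suc k) T \<subseteq> pw k X"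
    using pw_mono[OF X(2), of k] by (simp only: pw_commute)
  also have "\<dots> \<subseteq> Z k"
    using X U by (intro join_upper1) auto
  finally show "pw (Suc k) T \<subseteq> Z k" .
  show "scale i (Z k) \<subseteq> Z (Suc k)" if i: "i < r"
  proof -
    have "scale i (U (Suc m - k) \<inter> pw k T) \<subseteq> U (Suc m - Suc k) \<inter> pw (Suc k) T"
    proof (rule Int_greatest)
      show "scale i (U (Suc m - k) \<inter> pw k T) \<subseteq> pw (Suc k) T"
        using scale_pw_subset[of T i k] i by auto
      show "scale i (U (Suc m - k) \<inter> pw k T) \<subseteq> U (Suc m - Suc k)"
      proof (cases "k \<le> m")
        case True
        then have "scale i (U (Suc m - k)) \<subseteq> U (Suc m - Suc k)"
          using U(3)[OF i, of "m - k"] by (simp add: Suc_diff_le)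
        then show ?thesis by auto
      next
        case False
        then have "U (Suc m - k) = {\<zero>\<^bsub>M\<^esub>}" "U (Suc m - Suc k) = {\<zero>\<^bsub>M\<^esub>}"
          using U(2) by simp_all
        then show ?thesis
          by auto
      qed
    qed
    moreover have "scale i (Z k) = scale i (pw k X) <+>\<^bsub>M\<^esub> scale i (U (Suc m - k) \<inter> pw k T)"
      using X U by (intro scale_join) auto
    ultimately show ?thesis
      using scale_pw_subset[OF X(1) i, of k] by (simp only: join_mono)
  qed
  show "submodule (B i) R M"
    by simp
  show "scale i (B i) \<subseteq> graded_step Z i 0"
    using Z[of 1] submodule_zero unfolding graded_step_def by (simp add: submodule_zero)
qed

private lemma Z_ends:
  "Z 0 <+>\<^bsub>M\<^esub> B i = X <+>\<^bsub>M\<^esub> U (Suc m)" "Z (Suc m) = pw (Suc m) X"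
proof -
  show "Z 0 <+>\<^bsub>M\<^esub> B i = X <+>\<^bsub>M\<^esub> U (Suc m)"
    using X U submodule_sub[OF U(1)]
    by (simp add: join_absorb submodule_zero Int_absorb2)
  show "Z (Suc m) = pw (Suc m) X"
    using X U by (simp add: join_absorb submodule_zero)
qed

private lemma Z_bound:
  "colength (pw (Suc m) X) - colength (pw (Suc m) T)
    \<le> int ((m + r) choose (r - 1)) * colength (X <+>\<^bsub>M\<^esub> U (Suc m))"
  "colength (pw (Suc m) X) - colength (pw (Suc m) T)
    = int ((m + r) choose (r - 1)) * colength (X <+>\<^bsub>M\<^esub> U (Suc m))
   \<longleftrightarrow> (\<forall>i<r. \<forall>l\<le>m. pw l T \<inter> colon i (graded_step Z i l) \<subseteq> graded_kernel Z B i l)"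
proof -
  have "(\<Sum>i<r. int ((m + i) choose i) * colength (Z 0 <+>\<^bsub>M\<^esub> B i))
      = int (\<Sum>i<r. (m + i) choose i) * colength (X <+>\<^bsub>M\<^esub> U (Suc m))"
    unfolding Z_ends by (simp add: sum_distrib_right)
  also have "(\<Sum>i<r. (m + i) choose i) = (m + r) choose (r - 1)"
    using r by (rule sum_choose_lessThan)
  finally have sum: "(\<Sum>i<r. int ((m + i) choose i) * colength (Z 0 <+>\<^bsub>M\<^esub> B i))
      = int ((m + r) choose (r - 1)) * colength (X <+>\<^bsub>M\<^esub> U (Suc m))" .
  note bound = graded_length_bound[of Z B m, OF fin Z_facts, unfolded sum Z_ends(2)]
  show "colength (pw (Suc m) X) - colength (pw (Suc m) T)
    \<le> int ((m + r) choose (r - 1)) * colength (X <+>\<^bsub>M\<^esub> U (Suc m))"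
    by (rule bound(1))
  show "colength (pw (Suc m) X) - colength (pw (Suc m) T)
    = int ((m + r) choose (r - 1)) * colength (X <+>\<^bsub>M\<^esub> U (Suc m))
   \<longleftrightarrow> (\<forall>i<r. \<forall>l\<le>m. pw l T \<inter> colon i (graded_step Z i l) \<subseteq> graded_kernel Z B i l)"
    by (rule bound(2))
qed

lemmas fiber_bound = Z_bound(1)

text \<open>Equality makes all kernels trivial. In degree 0 the kernel of the last generator
  contains (Q (r - 1) T : c (r - 1)), and its trivial part is X + U (Suc m). The other generators
  are reached by reordering the sequence.\<close>

lemma fiber_bound_eq_imp_colon:
  assumes "colength (pw (Suc m) X) - colength (pw (Suc m) T)
    = int ((m + r) choose (r - 1)) * colength (X <+>\<^bsub>M\<^esub> U (Suc m))"
  shows "colon (r - 1) (Q (r - 1) T) \<subseteq> X <+>\<^bsub>M\<^esub> U (Suc m)"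
proof -
  have "pw 0 T \<inter> colon (r - 1) (graded_step Z (r - 1) 0) \<subseteq> graded_kernel Z B (r - 1) 0"
  proof -
    have "\<forall>l\<le>m. pw l T \<inter> colon (r - 1) (graded_step Z (r - 1) l) \<subseteq> graded_kernel Z B (r - 1) l"
      using Z_bound(2)[THEN iffD1, OF assms] r by (meson diff_less zero_less_one)
    then show ?thesis
      by (meson le0)
  qed
  moreover have "graded_kernel Z B (r - 1) 0 = X <+>\<^bsub>M\<^esub> U (Suc m)"
    using Z_ends(1) by (simp add: graded_kernel_def)
  moreover have "colon (r - 1) (Q (r - 1) T) \<subseteq> pw 0 T \<inter> colon (r - 1) (graded_step Z (r - 1) 0)"
  proof (rule Int_greatest)
    show "colon (r - 1) (Q (r - 1) T) \<subseteq> pw 0 T"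
      by (auto simp: colon_elem_def)
    have "Q (r - 1) T \<subseteq> graded_step Z (r - 1) 0"
      using Z_facts(1)[of 1] by (simp add: graded_step_def join_upper2)
    then show "colon (r - 1) (Q (r - 1) T) \<subseteq> colon (r - 1) (graded_step Z (r - 1) 0)"
      by (rule colon_mono)
  qed
  ultimately show ?thesis
    by auto
qed

text \<open>S i contains c j M for every j other than i, and V is torsion killed by q. The colon
  conditions force the coefficients of a linear relation with value in qX into X + V. This gives the
  hypothesis \<open>base\<close> of \<open>Q_Int_pw\<close>, after which
  \<open>colon_pw_join\<close> computes all kernels.\<close>

lemma fiber_bound_eqI:
  assumes D: "relatively_regular"
    and S: "\<And>i. i < r \<Longrightarrow> submodule (S i) R M"
      "\<And>i j. i < r \<Longrightarrow> j < r \<Longrightarrow> i \<noteq> j \<Longrightarrow> scale j T \<subseteq> S i"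
    and V: "submodule V R M" "\<And>i. i < r \<Longrightarrow> scale i V \<subseteq> {\<zero>\<^bsub>M\<^esub>}" "V \<subseteq> U (Suc m)"
    and SV: "\<And>i. i < r \<Longrightarrow> colon i (S i) \<subseteq> X <+>\<^bsub>M\<^esub> V"
  shows "colength (pw (Suc m) X) - colength (pw (Suc m) T)
    = int ((m + r) choose (r - 1)) * colength (X <+>\<^bsub>M\<^esub> U (Suc m))"
proof -
  have QS: "Q i T \<subseteq> S i" if "i < r" for i
    using that S by (intro Q_least) auto
  \<comment> \<open>Terms of an element of Q i T \<inter> qX are removed from the last one
    downwards, at the price of elements of Q i X. The coefficient x of c j satisfies c j x \<in> c j
    X + S j, hence x \<in> X + V, and c j V = 0 leaves c j x \<in> c j X.\<close>
  have base: "Q i T \<inter> Q r X \<subseteq> Q i X" if i: "i \<le> r" for i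
  proof -
    have "Q i T \<inter> Q r X \<subseteq> Q j T <+>\<^bsub>M\<^esub> Q i X" if "j \<le> i" for j
      using that
    proof (induction j rule: inc_induct)
      case base
      show ?case
        using join_upper1[of "Q i T" "Q i X"] X by auto
    next
      case (step j)
      let ?S = "Q j T <+>\<^bsub>M\<^esub> Q i X"
      have j: "j < r" "j < i" using step.hyps i by auto
      have sub: "submodule ?S R M" "submodule (scale j X <+>\<^bsub>M\<^esub> S j) R M" "submodule (S j) R M"
        using X S j by auto
      have "?S <+>\<^bsub>M\<^esub> Q r X \<subseteq> scale j X <+>\<^bsub>M\<^esub> S j"
      proof -
        have *: "Q k X \<subseteq> scale j X <+>\<^bsub>M\<^esub> S j" if "k \<le> r" for k
        proof (rule Q_least[OF sub(2)])
          fix l assume "l < k"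
          show "scale l X \<subseteq> scale j X <+>\<^bsub>M\<^esub> S j"
          proof (cases "l = j")
            case True
            then show ?thesis
              using X sub by (simp add: join_upper1)
          next
            case False
            have "scale l X \<subseteq> S j"
              using S(2)[of j l] False j \<open>l < k\<close> \<open>k \<le> r\<close> scale_mono[OF submodule_sub[OF X(1)], of "c l"]
              by auto
            also have "\<dots> \<subseteq> scale j X <+>\<^bsub>M\<^esub> S j"
              using X sub by (intro join_upper2) auto
            finally show ?thesis .
          qed
        qed
        have "Q j T \<subseteq> scale j X <+>\<^bsub>M\<^esub> S j"
          using QS[OF j(1)] join_upper2[of "scale j X" "S j"] X sub by auto
        then show ?thesis
          using *[of i] *[of r] i by (intro join_least sub) auto
      qed
      then have "scale j T \<inter> (?S <+>\<^bsub>M\<^esub> Q r X) \<subseteq> scale j (T \<inter> colon j (scale j X <+>\<^bsub>M\<^esub> S j))"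
        unfolding scale_Int[OF submodule_carrier, of "c j"]
        by (intro scale_mono Int_mono colon_mono) auto
      also have "\<dots> \<subseteq> scale j (X <+>\<^bsub>M\<^esub> V)"
      proof (rule scale_mono)
        have "colon j (scale j X <+>\<^bsub>M\<^esub> S j) = X <+>\<^bsub>M\<^esub> colon j (S j)"
          using X sub by (simp add: colon_scale_join)
        also have "\<dots> \<subseteq> X <+>\<^bsub>M\<^esub> V"
          using SV[OF j(1)] X V join_upper1[of X V] by (intro join_least) auto
        finally show "T \<inter> colon j (scale j X <+>\<^bsub>M\<^esub> S j) \<subseteq> X <+>\<^bsub>M\<^esub> V"
          by auto
      qed
      also have "\<dots> = scale j X <+>\<^bsub>M\<^esub> scale j V"
        using X V by (intro scale_join) auto
      also have "\<dots> \<subseteq> Q i X"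
        using X V(2)[OF j(1)] scale_subset_Q[OF X(1) j(2)] submodule_zero[of "Q i X"]
        by (intro join_least) auto
      also have "\<dots> \<subseteq> ?S"
        using X by (intro join_upper2) auto
      finally have *: "scale j T \<inter> (?S <+>\<^bsub>M\<^esub> Q r X) \<subseteq> ?S" .
      have "Q i T \<inter> Q r X \<subseteq> (scale j T <+>\<^bsub>M\<^esub> ?S) \<inter> Q r X"
        using step.IH X by (simp add: join_assoc)
      also have "\<dots> \<subseteq> (scale j T \<inter> (?S <+>\<^bsub>M\<^esub> Q r X)) <+>\<^bsub>M\<^esub> ?S"
        using X by (intro join_Int_subset) auto
      also have "\<dots> \<subseteq> ?S"
        by (rule join_least[OF sub(1) * order_refl])
      finally show ?case .
    qed
    from this[of 0] show ?thesis
      using X by (simp add: join_absorb submodule_zero)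
  qed
  have I: "Q i T \<inter> pw (Suc k) X \<subseteq> Q i (pw k X)" if "i \<le> r" for i k
    using D X(1) base that by (rule Q_Int_pw)
  have IT: "Q i T \<inter> pw (Suc k) T \<subseteq> Q i (pw k T)" if "i \<le> r" for i k
    using D _ _ that by (rule Q_Int_pw) auto
  \<comment> \<open>The torsion meets qM only in 0, so it survives in degree 0 alone.\<close>
  have ZSuc: "Z (Suc k) = pw (Suc k) X" for k
  proof -
    have "U (Suc m - Suc k) \<inter> Q r T \<subseteq> {\<zero>\<^bsub>M\<^esub>}"
      by (rule submodules_disjoint[of U, OF D r U(1,2) U(3)[OF r]])
    then have "U (Suc m - Suc k) \<inter> pw (Suc k) T \<subseteq> {\<zero>\<^bsub>M\<^esub>}"
      using pw_subset_Q[OF submodule_carrier, of k] by blast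
    then have "U (Suc m - Suc k) \<inter> pw (Suc k) T \<subseteq> pw (Suc k) X"
      using submodule_zero[OF submodule_pw[OF X(1)]] by blast
    then show ?thesis
      using X U(1) by (intro join_absorb) auto
  qed
  have "pw l T \<inter> colon i (graded_step Z i l) \<subseteq> graded_kernel Z B i l" if i: "i < r" for i l
  proof (cases l)
    case 0
    have "colon i (graded_step Z i 0) = colon i (pw (Suc 0) X <+>\<^bsub>M\<^esub> Q i T)"
      unfolding graded_step_def ZSuc by simp
    also have "\<dots> \<subseteq> pw 0 X <+>\<^bsub>M\<^esub> colon i (Q i T)"
      using I[of "Suc i" 0] i by (intro colon_pw_join X) simp
    also have "\<dots> \<subseteq> X <+>\<^bsub>M\<^esub> U (Suc m)"
    proof -
      have "colon i (Q i T) \<subseteq> X <+>\<^bsub>M\<^esub> V"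
        using colon_mono[OF QS[OF i]] SV[OF i] by (rule order_trans)
      also have "\<dots> \<subseteq> X <+>\<^bsub>M\<^esub> U (Suc m)"
        using V by (intro join_mono) auto
      finally show ?thesis
        using X U join_upper1 by (intro join_least) auto
    qed
    finally show ?thesis
      using 0 Z_ends(1) by (auto simp: graded_kernel_def)
  next
    case (Suc k)
    have "colon i (graded_step Z i (Suc k)) = colon i (pw (Suc (Suc k)) X <+>\<^bsub>M\<^esub> Q i (pw (Suc k) T))"
      unfolding graded_step_def ZSuc by (rule refl)
    also have "\<dots> \<subseteq> colon i (pw (Suc (Suc k)) X <+>\<^bsub>M\<^esub> Q i T)"
      by (intro colon_mono join_mono Q_mono submodule_sub submodule_pw) auto
    also have "\<dots> \<subseteq> pw (Suc k) X <+>\<^bsub>M\<^esub> colon i (Q i T)"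
      using I[of "Suc i" "Suc k"] i by (intro colon_pw_join X) simp
    finally have "pw l T \<inter> colon i (graded_step Z i l)
        \<subseteq> (pw (Suc k) X <+>\<^bsub>M\<^esub> colon i (Q i T)) \<inter> pw (Suc k) T"
      unfolding Suc by blast
    also have "\<dots> = pw (Suc k) X <+>\<^bsub>M\<^esub> (colon i (Q i T) \<inter> pw (Suc k) T)"
      using X by (intro modular_law pw_mono submodule_sub) auto
    also have "\<dots> \<subseteq> pw (Suc k) X <+>\<^bsub>M\<^esub> Q i (pw k T)"
      using relatively_regular_Int[OF D i pw_subset_Q[of T k]] IT[of i k] i
      by (intro join_mono) auto
    also have "\<dots> = graded_kernel Z B i l"
      unfolding Suc graded_kernel_def graded_step_def ZSuc by simp
    finally show ?thesis .
  qed
  then show ?thesis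
    using Z_bound(2) by blast
qed

end

end

section \<open>Noetherian modules over local rings\<close>

lemma maximal_element_if_stationary:
  fixes F :: "'x set set"
  assumes "F \<noteq> {}"
    and stat: "\<And>N. (\<And>n. N n \<in> F) \<Longrightarrow> (\<And>n. N n \<subseteq> N (Suc n)) \<Longrightarrow> \<exists>n. \<forall>m\<ge>n. N m = N (n :: nat)"
  shows "\<exists>L\<in>F. \<forall>X\<in>F. L \<subseteq> X \<longrightarrow> X = L"
proof (rule ccontr)
  assume "\<not> ?thesis"
  then have "\<forall>L\<in>F. \<exists>X\<in>F. L \<subset> X"
    by blast
  then obtain f where f: "\<And>L. L \<in> F \<Longrightarrow> f L \<in> F" "\<And>L. L \<in> F \<Longrightarrow> L \<subset> f L"
    by metis
  obtain X where "X \<in> F"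
    using \<open>F \<noteq> {}\<close> by blast
  define N where "N n = (f ^^ n) X" for n
  have N: "N n \<in> F" for n
    by (induction n) (simp_all add: N_def \<open>X \<in> F\<close> f)
  have "N n \<subset> N (Suc n)" for n
    using f(2)[OF N[of n]] by (simp add: N_def)
  then show False
    using stat[of N] N by (metis le_SucI order_refl psubset_eq)
qed

lemma (in noetherian_ring) ascending_ideals_stationary:
  assumes "\<And>n. ideal (I n) R" "\<And>n. I n \<subseteq> I (Suc n)"
  shows "\<exists>n. \<forall>m\<ge>n. I m = I n"
proof -
  have mono: "I m \<subseteq> I n" if "m \<le> n" for m n
    using lift_Suc_mono_le[of I, OF assms(2) that] .
  have "subset.chain {J. ideal J R} (range I)"
    unfolding subset_chain_def
  proof (intro conjI ballI)
    show "range I \<subseteq> {J. ideal J R}"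
      using assms(1) by blast
    fix J K assume "J \<in> range I" "K \<in> range I"
    then obtain m n where "J = I m" "K = I n"
      by blast
    then show "J \<subseteq> K \<or> K \<subseteq> J"
      using mono nat_le_linear by metis
  qed
  then obtain n where "\<Union>(range I) = I n"
    using ideal_chain_is_trivial[of "range I"] by auto
  then have "\<forall>m\<ge>n. I m = I n"
    using mono by blast
  then show ?thesis
    by blast
qed

context module
begin

text \<open>Relative to P, so that the condition can be passed from P to R s + P and thus to the
  span of finitely many generators.\<close>

definition ascending_stationary :: "'c set \<Rightarrow> bool"
  where "ascending_stationary P \<longleftrightarrow>
    (\<forall>N. (\<forall>n. submodule (N n) R M \<and> N n \<subseteq> P \<and> N n \<subseteq> N (Suc n)) \<longrightarrow> (\<exists>n. \<forall>m\<ge>n. N m = N n))"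

text \<open>A member N n of the chain is controlled by its meet with P and by the ideal of all b
  with b s in N n + P. Both become stationary, and the modular law then identifies the
  members.\<close>

lemma ascending_stationary_cyclic_join:
  assumes R: "noetherian_ring R" and P: "submodule P R M" "ascending_stationary P"
    and s: "s \<in> carrier M"
  shows "ascending_stationary ((\<lambda>b. b \<odot>\<^bsub>M\<^esub> s) ` carrier R <+>\<^bsub>M\<^esub> P)"
  unfolding ascending_stationary_def
proof (intro allI impI)
  fix N assume N: "\<forall>n. submodule (N n) R M \<and> N n \<subseteq> (\<lambda>b. b \<odot>\<^bsub>M\<^esub> s) ` carrier R <+>\<^bsub>M\<^esub> P \<and> N n \<subseteq> N (Suc n)"
  have sub: "submodule (N n) R M" for n
    using N by auto
  have mono: "N m \<subseteq> N n" if "m \<le> n" for m n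
    using lift_Suc_mono_le[of N] N that by blast
  define I where "I n = {b \<in> carrier R. \<forall>x\<in>{s}. b \<odot>\<^bsub>M\<^esub> x \<in> N n <+>\<^bsub>M\<^esub> P}" for n
  have "ideal (I n) R" for n
    unfolding I_def using sub P s by (intro ideal_residual) auto
  moreover have "I n \<subseteq> I (Suc n)" for n
    unfolding I_def using join_mono[OF mono order_refl, of n "Suc n" P] by auto
  ultimately obtain n1 where n1: "\<And>m. n1 \<le> m \<Longrightarrow> I m = I n1"
    using noetherian_ring.ascending_ideals_stationary[OF R, of I] by blast
  have "\<forall>n. submodule (N n \<inter> P) R M \<and> N n \<inter> P \<subseteq> P \<and> N n \<inter> P \<subseteq> N (Suc n) \<inter> P"
    using sub P N by auto
  then obtain n2 where n2: "\<And>m. n2 \<le> m \<Longrightarrow> N m \<inter> P = N n2 \<inter> P"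
    using P(2) unfolding ascending_stationary_def by meson
  define n where "n = max n1 n2"
  have "N m = N n" if m: "n \<le> m" for m
  proof
    show "N n \<subseteq> N m"
      using mono m .
    have IP: "I m = I n" "P \<inter> N m = P \<inter> N n"
      using n1[of m] n1[of n] n2[of m] n2[of n] m by (auto simp: n_def)
    have "N m \<subseteq> N n <+>\<^bsub>M\<^esub> P"
    proof
      fix x assume x: "x \<in> N m"
      then have "x \<in> (\<lambda>b. b \<odot>\<^bsub>M\<^esub> s) ` carrier R <+>\<^bsub>M\<^esub> P"
        using N by (meson subsetD)
      then obtain b p where b: "b \<in> carrier R" and p: "p \<in> P" and xbp: "x = b \<odot>\<^bsub>M\<^esub> s \<oplus>\<^bsub>M\<^esub> p"
        by (auto simp: join_mem)
      have "b \<odot>\<^bsub>M\<^esub> s = x \<oplus>\<^bsub>M\<^esub> \<ominus>\<^bsub>M\<^esub> p"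
        using xbp b s submodule_carrierD[OF P(1) p] by (simp add: M.a_assoc M.r_neg)
      then have "b \<odot>\<^bsub>M\<^esub> s \<in> N m <+>\<^bsub>M\<^esub> P"
        using joinI[OF x submodule_neg[OF P(1) p]] by simp
      then have "b \<in> I m"
        using b by (simp add: I_def)
      then have "b \<odot>\<^bsub>M\<^esub> s \<in> N n <+>\<^bsub>M\<^esub> P"
        unfolding IP by (simp add: I_def)
      moreover have "p \<in> N n <+>\<^bsub>M\<^esub> P"
        using join_upper2[OF sub P(1)] p by blast
      ultimately show "x \<in> N n <+>\<^bsub>M\<^esub> P"
        unfolding xbp by (intro submodule_add submodule_join sub P)
    qed
    then have "N m \<subseteq> (N n <+>\<^bsub>M\<^esub> P) \<inter> N m"
      by auto
    also have "\<dots> = N n <+>\<^bsub>M\<^esub> (P \<inter> N m)"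
      by (intro modular_law sub P mono m)
    also have "\<dots> \<subseteq> N n"
      using IP by (intro join_least sub) auto
    finally show "N m \<subseteq> N n" .
  qed
  then show "\<exists>n. \<forall>m\<ge>n. N m = N n"
    by blast
qed

lemma submodule_cyclic: "s \<in> carrier M \<Longrightarrow> submodule ((\<lambda>b. b \<odot>\<^bsub>M\<^esub> s) ` carrier R) R M"
proof (rule submoduleI)
  assume s: "s \<in> carrier M"
  show "\<zero>\<^bsub>M\<^esub> \<in> (\<lambda>b. b \<odot>\<^bsub>M\<^esub> s) ` carrier R"
    using s smult_l_null by (metis R.zero_closed imageI)
qed (auto simp: smult_l_minus[symmetric] smult_l_distr[symmetric] smult_assoc1[symmetric])

lemma finitely_generated_stationary:
  assumes R: "noetherian_ring R" and fg: "finitely_generated_module R M"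
  shows "ascending_stationary (carrier M)"
proof -
  obtain S where S: "finite S" "S \<subseteq> carrier M" "carrier M = submodule_span R M S"
    using fg by (auto simp: finitely_generated_module_def)
  have "\<exists>P. submodule P R M \<and> S \<subseteq> P \<and> ascending_stationary P"
    using S(1,2)
  proof (induction S)
    case empty
    have "ascending_stationary {\<zero>\<^bsub>M\<^esub>}"
      unfolding ascending_stationary_def
    proof (intro allI impI)
      fix N :: "nat \<Rightarrow> 'c set"
      assume N: "\<forall>n. submodule (N n) R M \<and> N n \<subseteq> {\<zero>\<^bsub>M\<^esub>} \<and> N n \<subseteq> N (Suc n)"
      have "N n = {\<zero>\<^bsub>M\<^esub>}" for n
        using N submodule_zero[of "N n"] by auto
      then show "\<exists>n. \<forall>m\<ge>n. N m = N n"
        by simp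
    qed
    then show ?case
      by (intro exI[of _ "{\<zero>\<^bsub>M\<^esub>}"]) auto
  next
    case (insert s S)
    then obtain P where P: "submodule P R M" "S \<subseteq> P" "ascending_stationary P"
      by auto
    let ?P = "(\<lambda>b. b \<odot>\<^bsub>M\<^esub> s) ` carrier R <+>\<^bsub>M\<^esub> P"
    have s: "s \<in> carrier M"
      using insert by simp
    have "s \<in> (\<lambda>b. b \<odot>\<^bsub>M\<^esub> s) ` carrier R"
      using s by (auto simp: image_iff intro!: bexI[of _ \<one>])
    then have "insert s S \<subseteq> ?P"
      using P join_upper1[OF submodule_cyclic[OF s] P(1)] join_upper2[OF submodule_cyclic[OF s] P(1)]
      by blast
    then show ?case
      using ascending_stationary_cyclic_join[OF R P(1,3) s] submodule_cyclic[OF s] P(1) by blast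
  qed
  then obtain P where "submodule P R M" "S \<subseteq> P" "ascending_stationary P"
    by blast
  moreover from this have "P = carrier M"
    using S(3) submodule_span_least[of P S] submodule_sub[of P] by simp
  ultimately show ?thesis
    by simp
qed

lemma maximal_submodule_exists:
  assumes acc: "ascending_stationary (carrier M)"
    and F: "\<And>X. X \<in> F \<Longrightarrow> submodule X R M" "F \<noteq> {}"
  shows "\<exists>L\<in>F. \<forall>X\<in>F. L \<subseteq> X \<longrightarrow> X = L"
proof (rule maximal_element_if_stationary[OF F(2)])
  fix N :: "nat \<Rightarrow> 'c set"
  assume N: "\<And>n. N n \<in> F" "\<And>n. N n \<subseteq> N (Suc n)"
  show "\<exists>n. \<forall>m\<ge>n. N m = N n"
    using acc F(1)[OF N(1)] submodule_sub[OF F(1)[OF N(1)]] N(2)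
    unfolding ascending_stationary_def by simp
qed

end

text \<open>Locality is given as uniqueness of the maximal ideal. If u generated a proper ideal, the
  ascending chain condition would enlarge it to a maximal ideal, which must be \<mm> and contains
  u.\<close>

lemma (in noetherian_local_ring) unit_if_not_maximal:
  assumes u: "u \<in> carrier R" "u \<notin> \<mm>"
  obtains v where "v \<in> carrier R" "v \<otimes> u = \<one>"
proof -
  let ?F = "{I. ideal I R \<and> PIdl u \<subseteq> I \<and> \<one> \<notin> I}"
  have "\<one> \<in> PIdl u"
  proof (rule ccontr)
    assume "\<one> \<notin> PIdl u"
    then have ne: "PIdl u \<in> ?F"
      using cgenideal_ideal[OF u(1)] by auto
    have "\<exists>J\<in>?F. \<forall>X\<in>?F. J \<subseteq> X \<longrightarrow> X = J"
      using ne by (intro maximal_element_if_stationary ascending_ideals_stationary) auto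
    then obtain J where J: "J \<in> ?F" "\<And>X. X \<in> ?F \<Longrightarrow> J \<subseteq> X \<Longrightarrow> X = J"
      by (metis (no_types, lifting))
    have "maximalideal J R"
    proof (rule maximalidealI)
      show "ideal J R"
        using J(1) by simp
      show "carrier R \<noteq> J"
        using J(1) by auto
      show "K = J \<or> K = carrier R" if K: "ideal K R" "J \<subseteq> K" "K \<subseteq> carrier R" for K
      proof (cases "\<one> \<in> K")
        case True
        then show ?thesis
          using ideal.one_imp_carrier[OF K(1)] by simp
      next
        case False
        then have "K \<in> ?F"
          using K J(1) by auto
        then show ?thesis
          using J K(2) by auto
      qed
    qed
    then have "J = \<mm>"
      by (rule unique_maximalideal)
    then show False
      using J(1) cgenideal_self[OF u(1)] u(2) by auto
  qed
  then show ?thesis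
    using that by (auto simp: cgenideal_def)
qed

locale noetherian_local_module =
  A: noetherian_local_ring R \<mm> + module R M for R (structure) and M (structure) and \<mm> +
  assumes fg: "finitely_generated_module R M"
begin

lemma acc: "ascending_stationary (carrier M)"
  using finitely_generated_stationary[OF A.noetherian_ring_axioms fg] .

text \<open>If K differs from N, the chain condition yields P maximal among the proper submodules of
  K above N, so K/P is simple. Each b in I kills K/P: otherwise b K + P = K, and any y in K outside
  P satisfies y = b d y + p with p in P, so (1 - b d) y lies in P although 1 - b d is a
  unit.\<close>

lemma nakayama:
  assumes K: "submodule K R M" and N: "submodule N R M" "N \<subseteq> K"
    and I: "I \<subseteq> \<mm>" and eq: "K \<subseteq> ideal_act R I M K <+>\<^bsub>M\<^esub> N"
  shows "K = N"
proof (rule ccontr)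
  assume "K \<noteq> N"
  let ?F = "{X. submodule X R M \<and> N \<subseteq> X \<and> X \<subset> K}"
  have F: "?F \<noteq> {}" "X \<in> ?F \<Longrightarrow> submodule X R M" for X
    using N \<open>K \<noteq> N\<close> by auto
  obtain P where P: "P \<in> ?F" "\<And>X. X \<in> ?F \<Longrightarrow> P \<subseteq> X \<Longrightarrow> X = P"
    using maximal_submodule_exists[OF acc F(2,1)] by (metis (no_types, lifting))
  have Psub: "submodule P R M" "N \<subseteq> P" "P \<subset> K"
    using P(1) by auto
  have Pmax: "X = P \<or> X = K" if "submodule X R M" "P \<subseteq> X" "X \<subseteq> K" for X
    using P(2)[of X] that Psub by auto
  have IR: "I \<subseteq> carrier R"
    using I A.a_subset by auto
  have mem: "b \<odot>\<^bsub>M\<^esub> x \<in> P" if b: "b \<in> I" and x: "x \<in> K" for b x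
  proof -
    have bR: "b \<in> carrier R"
      using b IR by auto
    have sb: "submodule (scale_set M b K <+>\<^bsub>M\<^esub> P) R M"
      using bR K Psub by auto
    have "scale_set M b K <+>\<^bsub>M\<^esub> P \<noteq> K"
    proof
      assume bK: "scale_set M b K <+>\<^bsub>M\<^esub> P = K"
      obtain y where y: "y \<in> K" "y \<notin> P"
        using Psub by auto
      have yM: "y \<in> carrier M"
        using submodule_carrierD[OF K y(1)] .
      let ?C = "(\<lambda>d. d \<odot>\<^bsub>M\<^esub> y) ` carrier R"
      have C: "submodule ?C R M" "?C \<subseteq> K"
        using submodule_cyclic[OF yM] submodule_smult[OF K] y by auto
      have "y \<in> ?C"
        using yM by (auto simp: image_iff intro!: bexI[of _ \<one>])
      then have "?C <+>\<^bsub>M\<^esub> P \<noteq> P"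
        using y join_upper1[OF C(1) Psub(1)] by blast
      then have CP: "?C <+>\<^bsub>M\<^esub> P = K"
        using Pmax[of "?C <+>\<^bsub>M\<^esub> P"] C Psub join_upper2[OF C(1) Psub(1)]
        by (metis K join_least psubset_imp_subset submodule_join)
      have "K = scale_set M b (?C <+>\<^bsub>M\<^esub> P) <+>\<^bsub>M\<^esub> P"
        using bK CP by simp
      also have "\<dots> = scale_set M b ?C <+>\<^bsub>M\<^esub> (scale_set M b P <+>\<^bsub>M\<^esub> P)"
        using scale_join[OF bR C(1) Psub(1)] bR C Psub by (simp add: join_assoc del: image_image)
      also have "\<dots> = scale_set M b ?C <+>\<^bsub>M\<^esub> P"
        using scale_subset[OF bR Psub(1)] bR Psub by (simp add: join_absorb)
      finally obtain d p where d: "d \<in> carrier R" and p: "p \<in> P"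
        and ydp: "y = b \<odot>\<^bsub>M\<^esub> (d \<odot>\<^bsub>M\<^esub> y) \<oplus>\<^bsub>M\<^esub> p"
        using y(1) by (auto simp: join_mem)
      have bd: "b \<otimes> d \<in> \<mm>"
        using b I d A.I_r_closed by auto
      have bdR: "b \<otimes> d \<in> carrier R"
        using bR d by simp
      have "(\<one> \<ominus> b \<otimes> d) \<notin> \<mm>"
      proof
        assume "\<one> \<ominus> b \<otimes> d \<in> \<mm>"
        then have "(\<one> \<ominus> b \<otimes> d) \<oplus> b \<otimes> d \<in> \<mm>"
          using bd by (rule A.a_closed)
        moreover have "(\<one> \<ominus> b \<otimes> d) \<oplus> b \<otimes> d = \<one>"
          using bdR by (simp add: a_minus_def A.a_assoc A.l_neg)
        ultimately show False
          using A.one_imp_carrier A.I_notcarr by simp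
      qed
      then obtain v where v: "v \<in> carrier R" "v \<otimes> (\<one> \<ominus> b \<otimes> d) = \<one>"
        using A.unit_if_not_maximal bdR by (metis A.minus_closed A.one_closed)
      have "(\<one> \<ominus> b \<otimes> d) \<odot>\<^bsub>M\<^esub> y = y \<ominus>\<^bsub>M\<^esub> (b \<otimes> d) \<odot>\<^bsub>M\<^esub> y"
        using bdR yM by (simp add: a_minus_def a_minus_def smult_l_distr smult_l_minus)
      also have "\<dots> = (b \<odot>\<^bsub>M\<^esub> (d \<odot>\<^bsub>M\<^esub> y) \<oplus>\<^bsub>M\<^esub> p) \<ominus>\<^bsub>M\<^esub> b \<odot>\<^bsub>M\<^esub> (d \<odot>\<^bsub>M\<^esub> y)"
        using ydp bR d yM by (simp add: smult_assoc1)
      also have "\<dots> = p"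
        using bR d yM submodule_carrierD[OF Psub(1) p] by (simp add: add_minus_cancel)
      finally have "(\<one> \<ominus> b \<otimes> d) \<odot>\<^bsub>M\<^esub> y \<in> P"
        using p by simp
      then have "v \<odot>\<^bsub>M\<^esub> ((\<one> \<ominus> b \<otimes> d) \<odot>\<^bsub>M\<^esub> y) \<in> P"
        using submodule_smult[OF Psub(1) v(1)] by simp
      then have "y \<in> P"
        using v yM bdR by (simp add: smult_assoc1[symmetric])
      then show False
        using y by simp
    qed
    then have "scale_set M b K <+>\<^bsub>M\<^esub> P = P"
      using Pmax[OF sb join_upper2] bR K Psub join_least[OF K scale_subset[OF bR K], of P]
      by (metis psubset_imp_subset submodule_scale)
    then show ?thesis
      using join_upper1[of "scale_set M b K" P] bR K Psub x by auto
  qed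
  have "ideal_act R I M K <+>\<^bsub>M\<^esub> N \<subseteq> P"
    using mem Psub by (intro join_least act_least) auto
  then show False
    using eq Psub by auto
qed

end

section \<open>A weak Artin-Rees lemma\<close>

context module_seq
begin

text \<open>Pigeonhole on monomials: in degree s + t either c i occurs at least s times or the
  earlier generators occur at least t times.\<close>

lemma Q_power_le:
  assumes X: "submodule X R M"
  shows "(Q (Suc i) ^^ (s + t)) X \<subseteq> (scale i ^^ s) X <+>\<^bsub>M\<^esub> (Q i ^^ t) X"
proof -
  have subS: "submodule ((scale i ^^ s) X) R M" "submodule ((Q i ^^ t) X) R M" for s t
  proof -
    show "submodule ((scale i ^^ s) X) R M"
      by (induction s) (simp_all add: X)
    show "submodule ((Q i ^^ t) X) R M"
      by (induction t) (simp_all add: X)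
  qed
  have subQ: "submodule ((Q (Suc i) ^^ n) X) R M" "(Q (Suc i) ^^ n) X \<subseteq> X" for n
  proof -
    show *: "submodule ((Q (Suc i) ^^ n) X) R M" for n
      by (induction n) (simp_all add: X)
    show "(Q (Suc i) ^^ n) X \<subseteq> X"
    proof (induction n)
      case (Suc n)
      then show ?case
        using Q_subset[OF *[of n], of "Suc i"] by (simp del: Q.simps)
    qed simp
  qed
  show ?thesis
  proof (induction "s + t" arbitrary: s t rule: less_induct)
    case less
    consider "s = 0" | "t = 0" | s' t' where "s = Suc s'" "t = Suc t'"
      by (cases s; cases t) auto
    then show ?case
    proof cases
      case 1
      then show ?thesis
        using subQ(2)[of t] join_upper1[OF X subS(2), of t] by auto
    next
      case 2
      then show ?thesis
        using subQ(2)[of s] join_upper2[OF subS(1) X, of s] by auto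
    next
      case 3
      let ?n = "s' + Suc t'"
      let ?L = "(scale i ^^ s) X <+>\<^bsub>M\<^esub> (Q i ^^ t) X"
      have L: "submodule ?L R M"
        using subS by simp
      have IH1: "(Q (Suc i) ^^ ?n) X \<subseteq> (scale i ^^ s') X <+>\<^bsub>M\<^esub> (Q i ^^ t) X"
        and IH2: "(Q (Suc i) ^^ ?n) X \<subseteq> (scale i ^^ s) X <+>\<^bsub>M\<^esub> (Q i ^^ t') X"
        using less[of s' t] less[of s t'] 3 by (simp_all del: funpow.simps)
      have "(Q (Suc i) ^^ (s + t)) X = scale i ((Q (Suc i) ^^ ?n) X) <+>\<^bsub>M\<^esub> Q i ((Q (Suc i) ^^ ?n) X)"
        using 3 by simp
      also have "\<dots> \<subseteq> ?L"
      proof (rule join_least[OF L])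
        have "scale i ((Q (Suc i) ^^ ?n) X) \<subseteq> scale i ((scale i ^^ s') X <+>\<^bsub>M\<^esub> (Q i ^^ t) X)"
          by (rule scale_mono[OF IH1])
        also have "\<dots> = scale i ((scale i ^^ s') X) <+>\<^bsub>M\<^esub> scale i ((Q i ^^ t) X)"
          using subS by (intro scale_join) auto
        also have "\<dots> \<subseteq> ?L"
          using scale_subset[OF c_closed[of i] subS(2)[of t]] 3 by (intro join_mono) auto
        finally show "scale i ((Q (Suc i) ^^ ?n) X) \<subseteq> ?L" .
        have "Q i ((Q (Suc i) ^^ ?n) X) \<subseteq> Q i ((scale i ^^ s) X <+>\<^bsub>M\<^esub> (Q i ^^ t') X)"
          by (rule Q_mono[OF IH2])
        also have "\<dots> = Q i ((scale i ^^ s) X) <+>\<^bsub>M\<^esub> Q i ((Q i ^^ t') X)"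
          using subS by (intro Q_join) auto
        also have "\<dots> \<subseteq> ?L"
          using Q_subset[OF subS(1)[of s]] 3 by (intro join_mono) auto
        finally show "Q i ((Q (Suc i) ^^ ?n) X) \<subseteq> ?L" .
      qed
      finally show ?thesis .
    qed
  qed
qed

lemma scale_funpow_Int:
  assumes "submodule X R M"
  shows "(scale i ^^ t) X \<inter> Z = (scale i ^^ t) (X \<inter> (colon i ^^ t) Z)"
proof (induction t arbitrary: Z)
  case (Suc t)
  have s: "submodule ((scale i ^^ t) X) R M"
    by (induction t) (simp_all add: assms)
  have "(scale i ^^ Suc t) X \<inter> Z = scale i ((scale i ^^ t) X \<inter> colon i Z)"
    using scale_Int[OF s, of "c i" Z] by simp
  also have "\<dots> = scale i ((scale i ^^ t) (X \<inter> (colon i ^^ t) (colon i Z)))"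
    by (simp only: Suc)
  also have "\<dots> = (scale i ^^ Suc t) (X \<inter> (colon i ^^ t) (colon i Z))"
    by simp
  also have "(colon i ^^ t) (colon i Z) = (colon i ^^ Suc t) Z"
    by (simp only: funpow_Suc_right o_apply)
  finally show ?case .
qed simp

text \<open>
  A weak form of the Artin-Rees lemma: for \<open>L\<close> maximal with \<open>L \<inter> K = J\<close>, each generator of the
  ideal is nilpotent on \<open>M / L\<close>.
\<close>

lemma weak_artin_rees:
  assumes acc: "ascending_stationary T"
    and J: "submodule J R M" and K: "submodule K R M" and JK: "J \<subseteq> K"
    and KJ: "\<And>i. i < r \<Longrightarrow> scale i K \<subseteq> J"
  obtains L n where "submodule L R M" "J \<subseteq> L" "L \<inter> K = J" "pw n T \<subseteq> L"
proof -
  let ?F = "{X. submodule X R M \<and> X \<inter> K = J}"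
  have F: "?F \<noteq> {}" "X \<in> ?F \<Longrightarrow> submodule X R M" for X
    using J JK by auto
  obtain L where L: "L \<in> ?F" "\<And>X. X \<in> ?F \<Longrightarrow> L \<subseteq> X \<Longrightarrow> X = L"
    using maximal_submodule_exists[OF acc F(2,1)] by (metis (no_types, lifting))
  have Ls: "submodule L R M" "L \<inter> K = J" "J \<subseteq> L"
    using L(1) by auto
  have nil: "\<exists>t. (scale i ^^ t) T \<subseteq> L" if i: "i < r" for i
  proof -
    have col: "submodule ((colon i ^^ t) L) R M" for t
      by (induction t) (simp_all add: Ls)
    have inc: "(colon i ^^ t) L \<subseteq> (colon i ^^ Suc t) L" for t
      using subset_colon[OF c_closed col] by simp
    have "\<forall>t. submodule ((colon i ^^ t) L) R M \<and> (colon i ^^ t) L \<subseteq> T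
        \<and> (colon i ^^ t) L \<subseteq> (colon i ^^ Suc t) L"
      using col submodule_sub[OF col] inc by (simp del: funpow.simps)
    then have "\<exists>t. \<forall>m\<ge>t. (colon i ^^ m) L = (colon i ^^ t) L"
      using acc[unfolded ascending_stationary_def, THEN spec, of "\<lambda>t. (colon i ^^ t) L"] by (rule mp[rotated])
    then obtain t where "\<forall>m\<ge>t. (colon i ^^ m) L = (colon i ^^ t) L"
      by (elim exE)
    then have t: "(colon i ^^ Suc t) L = (colon i ^^ t) L"
      by (meson le_SucI order_refl)
    let ?S = "(scale i ^^ t) T"
    have S: "submodule ?S R M"
      by (induction t) simp_all
    let ?P = "?S <+>\<^bsub>M\<^esub> L"
    have P: "submodule ?P R M"
      using S Ls by simp
    have gL: "submodule (colon i L) R M" "L \<subseteq> colon i L"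
      using Ls subset_colon by auto
    \<comment> \<open>Let z = c i^t x + l lie in K, with l in L. Then c i z lies in L, hence so does
      c i^(t+1) x, and by the choice of t also c i^t x. Adding c i^t M to L thus leaves the meet
      with K unchanged, and maximality of L absorbs it.\<close>
    have "?P \<inter> K \<subseteq> L"
    proof -
      have "scale i (?P \<inter> K) \<subseteq> L"
        using KJ[OF i] Ls by auto
      then have "?P \<inter> K \<subseteq> (L <+>\<^bsub>M\<^esub> ?S) \<inter> colon i L"
        using submodule_sub[OF submodule_Int[OF P K]] scale_subset_iff join_commute[OF S Ls(1)] by blast
      also have "\<dots> = L <+>\<^bsub>M\<^esub> (?S \<inter> colon i L)"
        by (intro modular_law S gL Ls)
      also have "\<dots> \<subseteq> L"
      proof (intro join_least Ls order_refl)
        have "?S \<inter> colon i L = (scale i ^^ t) (T \<inter> (colon i ^^ Suc t) L)"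
          by (simp only: scale_funpow_Int[OF submodule_carrier] funpow_Suc_right[of t "colon i"] o_apply)
        also have "\<dots> = ?S \<inter> L"
          unfolding t by (simp add: scale_funpow_Int)
        finally show "?S \<inter> colon i L \<subseteq> L"
          by simp
      qed
      finally show ?thesis .
    qed
    then have "?P \<in> ?F"
      using P Ls join_upper2[OF S Ls(1)] by blast
    then have "?P = L"
      using L(2)[of ?P] join_upper2[OF S Ls(1)] by simp
    then show ?thesis
      using join_upper1[OF S Ls(1)] by auto
  qed
  have "\<exists>n. (Q i ^^ n) T \<subseteq> L" if "i \<le> r" for i
    using that
  proof (induction i)
    case 0
    have "(Q 0 ^^ 1) T \<subseteq> L"
      using submodule_zero[OF Ls(1)] by simp
    then show ?case by blast
  next
    case (Suc i)
    then obtain s t where "(scale i ^^ s) T \<subseteq> L" "(Q i ^^ t) T \<subseteq> L"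
      using nil[of i] by auto
    then have "(Q (Suc i) ^^ (s + t)) T \<subseteq> L"
      using Q_power_le[OF submodule_carrier, where i = i and s = s and t = t] Ls by (meson join_least order_trans)
    then show ?case by blast
  qed
  from this[of r] obtain n where "pw n T \<subseteq> L"
    by auto
  then show ?thesis
    using that Ls by blast
qed

end

section \<open>Quotients and restrictions\<close>

lemma module_length_eq_chain_length:
  "module_length R L = chain_length {K. submodule K R L} {} UNIV"
  by (simp add: module_length_def chain_length_def chains_between_def)

context module
begin

lemma submodule_iff:
  "submodule X R M \<longleftrightarrow> X \<subseteq> carrier M \<and> \<zero>\<^bsub>M\<^esub> \<in> X
    \<and> (\<forall>x\<in>X. \<forall>y\<in>X. x \<oplus>\<^bsub>M\<^esub> y \<in> X) \<and> (\<forall>b\<in>carrier R. \<forall>x\<in>X. b \<odot>\<^bsub>M\<^esub> x \<in> X)"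
    (is "_ \<longleftrightarrow> ?P")
proof
  assume ?P
  moreover from this have "\<ominus>\<^bsub>M\<^esub> x \<in> X" if "x \<in> X" for x
    using that smult_l_minus[of \<one> x] by (metis R.a_inv_closed R.one_closed smult_one subsetD)
  ultimately show "submodule X R M"
    by (intro submoduleI) auto
qed (auto intro: submodule_zero submodule_add submodule_smult dest: submodule_sub)

lemma module_restrict:
  "submodule N R M \<Longrightarrow> Module.module R (M\<lparr>carrier := N\<rparr>)"
  by (rule submodule.submodule_is_module[OF _ module_axioms])

lemma submodule_restrict_iff:
  assumes N: "submodule N R M"
  shows "submodule X R (M\<lparr>carrier := N\<rparr>) \<longleftrightarrow> submodule X R M \<and> X \<subseteq> N"
  using submodule_iff[of X] module.submodule_iff[OF module_restrict[OF N], of X] submodule_sub[OF N]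
  by auto

lemma interval_length_restrict:
  assumes N: "submodule N R M"
  shows "chain_length {X. submodule X R (M\<lparr>carrier := N\<rparr>)} A N = interval_length A N"
  by (rule antisym; rule chain_length_mono_map[where \<phi> = "\<lambda>X. X"])
     (auto simp: submodule_restrict_iff[OF N])

end

locale module_quotient = module R M for R (structure) and M (structure) +
  fixes N
  assumes N: "submodule N R M"
begin

abbreviation L where "L \<equiv> quot_module M N"

abbreviation proj where "proj x \<equiv> N +>\<^bsub>M\<^esub> x"

definition preimage where "preimage K = {x \<in> carrier M. proj x \<in> K}"

sublocale L: Module.module R L
  by (rule module_quot_module[OF module_axioms N])

sublocale abelian_subgroup N M
  by (intro abelian_subgroupI3 additive_subgroup.intro M.abelian_group_axioms
      submodule.axioms(1)[OF N])

lemma carrier_L: "carrier L = proj ` carrier M"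
  by (auto simp: quot_module_def A_RCOSETS_def')

lemma zero_L: "\<zero>\<^bsub>L\<^esub> = proj \<zero>\<^bsub>M\<^esub>"
  using a_rcos_const[OF zero_closed] by (simp add: quot_module_def)

lemma add_L: "x \<in> carrier M \<Longrightarrow> y \<in> carrier M \<Longrightarrow> proj x \<oplus>\<^bsub>L\<^esub> proj y = proj (x \<oplus>\<^bsub>M\<^esub> y)"
  by (simp add: quot_module_def a_rcos_sum)

lemma smult_L: "b \<in> carrier R \<Longrightarrow> x \<in> carrier M \<Longrightarrow> b \<odot>\<^bsub>L\<^esub> proj x = proj (b \<odot>\<^bsub>M\<^esub> x)"
  by (rule quot_module_smult[OF module_axioms N])

lemma proj_eq_iff:
  assumes "x \<in> carrier M" "y \<in> carrier M"
  shows "proj x = proj y \<longleftrightarrow> x \<ominus>\<^bsub>M\<^esub> y \<in> N"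
proof
  assume "proj x = proj y"
  then have "x \<in> proj y"
    using a_rcos_self[OF assms(1)] by simp
  then obtain h where "h \<in> N" "x = h \<oplus>\<^bsub>M\<^esub> y"
    by (auto simp: a_r_coset_def')
  then show "x \<ominus>\<^bsub>M\<^esub> y \<in> N"
    using assms submodule_carrierD[OF N] by (simp add: M.a_comm[of h y] add_minus_cancel)
next
  assume h: "x \<ominus>\<^bsub>M\<^esub> y \<in> N"
  then have "(x \<ominus>\<^bsub>M\<^esub> y) \<oplus>\<^bsub>M\<^esub> y \<in> proj y"
    by (auto simp: a_r_coset_def')
  moreover have "(x \<ominus>\<^bsub>M\<^esub> y) \<oplus>\<^bsub>M\<^esub> y = x"
    using assms add_minus_cancel(2)[of y x] by (simp add: M.a_comm)
  ultimately show "proj x = proj y"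
    using a_repr_independence'[of x y] assms by simp
qed

lemma preimage_sub: "preimage K \<subseteq> carrier M"
  by (auto simp: preimage_def)

lemma submodule_preimage:
  assumes K: "submodule K R L"
  shows "submodule (preimage K) R M" and "N \<subseteq> preimage K"
proof -
  show "submodule (preimage K) R M"
    unfolding submodule_iff preimage_def
    using L.submodule_zero[OF K] L.submodule_add[OF K] L.submodule_smult[OF K]
    by (auto simp: zero_L add_L[symmetric] smult_L[symmetric])
  show "N \<subseteq> preimage K"
  proof
    fix x assume x: "x \<in> N"
    then have "proj x = \<zero>\<^bsub>L\<^esub>"
      using submodule_carrierD[OF N] proj_eq_iff[of x "\<zero>\<^bsub>M\<^esub>"] by (simp add: zero_L a_minus_def)
    then show "x \<in> preimage K"
      using x L.submodule_zero[OF K] submodule_carrierD[OF N] by (simp add: preimage_def)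
  qed
qed

lemma image_preimage: "K \<subseteq> carrier L \<Longrightarrow> proj ` preimage K = K"
  by (auto simp: carrier_L preimage_def)

lemma preimage_inject: "K \<subseteq> carrier L \<Longrightarrow> K' \<subseteq> carrier L \<Longrightarrow> preimage K = preimage K' \<longleftrightarrow> K = K'"
  using image_preimage by metis

lemma submodule_image:
  assumes X: "submodule X R M"
  shows "submodule (proj ` X) R L"
  unfolding L.submodule_iff
proof (intro conjI ballI)
  note c = submodule_carrierD[OF X]
  show "proj ` X \<subseteq> carrier L"
    using submodule_sub[OF X] by (auto simp: carrier_L)
  show "\<zero>\<^bsub>L\<^esub> \<in> proj ` X"
    using submodule_zero[OF X] by (auto simp: zero_L)
  show "x \<oplus>\<^bsub>L\<^esub> y \<in> proj ` X" if "x \<in> proj ` X" "y \<in> proj ` X" for x y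
    using that submodule_add[OF X] c by (auto simp: add_L)
  show "b \<odot>\<^bsub>L\<^esub> x \<in> proj ` X" if "b \<in> carrier R" "x \<in> proj ` X" for b x
    using that submodule_smult[OF X] c by (auto simp: smult_L)
qed

lemma preimage_image:
  assumes X: "submodule X R M" "N \<subseteq> X"
  shows "preimage (proj ` X) = X"
proof
  show "X \<subseteq> preimage (proj ` X)"
    using submodule_sub[OF X(1)] by (auto simp: preimage_def)
  show "preimage (proj ` X) \<subseteq> X"
  proof
    fix x assume "x \<in> preimage (proj ` X)"
    then obtain y where y: "y \<in> X" "x \<in> carrier M" "proj x = proj y"
      by (auto simp: preimage_def)
    have yM: "y \<in> carrier M"
      using submodule_carrierD[OF X(1) y(1)] .
    have "x \<ominus>\<^bsub>M\<^esub> y \<in> X"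
      using y yM proj_eq_iff X(2) by auto
    then have "y \<oplus>\<^bsub>M\<^esub> (x \<ominus>\<^bsub>M\<^esub> y) \<in> X"
      using submodule_add[OF X(1)] y(1) by simp
    then show "x \<in> X"
      using y yM by (simp add: add_minus_cancel)
  qed
qed

lemma module_length_quotient: "module_length R L = interval_length N (carrier M)"
  unfolding module_length_eq_chain_length
proof (rule antisym)
  show "chain_length {K. submodule K R L} {} UNIV \<le> interval_length N (carrier M)"
  proof (rule chain_length_mono_map[where \<phi> = preimage])
    fix K assume "K \<in> {K. submodule K R L}"
    then show "preimage K \<in> submodules \<and> N \<subseteq> preimage K \<and> preimage K \<subseteq> carrier M"
      using submodule_preimage preimage_sub by auto
  next
    fix K K' assume K: "K \<in> {K. submodule K R L}" "K' \<in> {K. submodule K R L}" "K \<subset> K'"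
    then have "preimage K \<subseteq> preimage K'"
      by (auto simp: preimage_def)
    moreover have "preimage K \<noteq> preimage K'"
      using K preimage_inject[of K K'] L.submodule_sub by auto
    ultimately show "preimage K \<subset> preimage K'"
      by auto
  qed
  show "interval_length N (carrier M) \<le> chain_length {K. submodule K R L} {} UNIV"
  proof (rule chain_length_mono_map[where \<phi> = "\<lambda>X. proj ` X"])
    fix X assume "X \<in> submodules"
    then show "proj ` X \<in> {K. submodule K R L} \<and> {} \<subseteq> proj ` X \<and> proj ` X \<subseteq> UNIV"
      using submodule_image by auto
  next
    fix X X' assume X: "X \<in> submodules" "X' \<in> submodules" "N \<subseteq> X" "X \<subset> X'"
    have "preimage (proj ` X) = X" "preimage (proj ` X') = X'"
      using X(1-3) psubset_imp_subset[OF X(4)] by (simp_all add: preimage_image)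
    then have "proj ` X \<noteq> proj ` X'"
      using X(4) by (metis psubset_eq)
    moreover have "proj ` X \<subseteq> proj ` X'"
      using X(4) by (intro image_mono) simp
    ultimately show "proj ` X \<subset> proj ` X'"
      by (rule psubsetI[rotated])
  qed
qed

lemma preimage_ideal_smult:
  assumes I: "I \<subseteq> carrier R"
  shows "preimage (ideal_smult R I L) = ideal_smult R I M <+>\<^bsub>M\<^esub> N"
proof
  have IM: "submodule (ideal_smult R I M) R M" and IL: "submodule (ideal_smult R I L) R L"
    using I by (simp_all add: ideal_smult_eq_act)
  have IMN: "submodule (ideal_smult R I M <+>\<^bsub>M\<^esub> N) R M"
    using IM N by simp
  have "ideal_smult R I L \<subseteq> proj ` (ideal_smult R I M <+>\<^bsub>M\<^esub> N)"
    unfolding ideal_smult_eq_act[of R I L]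
  proof (rule L.act_least[OF submodule_image[OF IMN]])
    fix b X assume b: "b \<in> I" and "X \<in> carrier L"
    then obtain x where x: "x \<in> carrier M" "X = proj x"
      by (auto simp: carrier_L)
    have "b \<odot>\<^bsub>M\<^esub> x \<in> ideal_smult R I M <+>\<^bsub>M\<^esub> N"
      using join_upper1[OF IM N] act_mem[OF b x(1)] by (auto simp: ideal_smult_eq_act)
    then show "b \<odot>\<^bsub>L\<^esub> X \<in> proj ` (ideal_smult R I M <+>\<^bsub>M\<^esub> N)"
      using b I x by (auto simp: smult_L)
  qed
  then have "preimage (ideal_smult R I L) \<subseteq> preimage (proj ` (ideal_smult R I M <+>\<^bsub>M\<^esub> N))"
    by (auto simp: preimage_def)
  then show "preimage (ideal_smult R I L) \<subseteq> ideal_smult R I M <+>\<^bsub>M\<^esub> N"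
    using preimage_image[OF IMN join_upper2[OF IM N]] by simp
  show "ideal_smult R I M <+>\<^bsub>M\<^esub> N \<subseteq> preimage (ideal_smult R I L)"
  proof (rule join_least)
    show "ideal_smult R I M \<subseteq> preimage (ideal_smult R I L)"
      unfolding ideal_smult_eq_act[of R I M]
    proof (rule act_least[OF submodule_preimage(1)[OF IL]])
      fix b x assume b: "b \<in> I" and x: "x \<in> carrier M"
      have "b \<odot>\<^bsub>L\<^esub> proj x \<in> ideal_smult R I L"
        unfolding ideal_smult_eq_act using b x by (intro L.act_mem) (auto simp: carrier_L)
      then show "b \<odot>\<^bsub>M\<^esub> x \<in> preimage (ideal_smult R I L)"
        using b I x by (auto simp: preimage_def smult_L)
    qed
  qed (use submodule_preimage[OF IL] in auto)
qed

text \<open>Submodules of the quotient are determined by their preimages. This moves absolute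
  superficiality from the quotients of M into the submodule lattice of M.\<close>

lemma superficial_quotient_iff:
  assumes I: "I \<subseteq> carrier R" "J \<subseteq> carrier R" "I' \<subseteq> carrier R" and b: "b \<in> carrier R"
  shows "colon_elem L (ideal_smult R I L) b \<inter> ideal_smult R J L = ideal_smult R I' L
    \<longleftrightarrow> colon_elem M (ideal_smult R I M <+>\<^bsub>M\<^esub> N) b \<inter> (ideal_smult R J M <+>\<^bsub>M\<^esub> N)
      = ideal_smult R I' M <+>\<^bsub>M\<^esub> N"
proof -
  have sub: "ideal_smult R I' L \<subseteq> carrier L" if "I' \<subseteq> carrier R" for I'
    using that by (intro L.submodule_sub) (simp add: ideal_smult_eq_act)
  have "colon_elem L (ideal_smult R I L) b \<inter> ideal_smult R J L = ideal_smult R I' L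
      \<longleftrightarrow> preimage (colon_elem L (ideal_smult R I L) b \<inter> ideal_smult R J L) = preimage (ideal_smult R I' L)"
    using sub I by (intro preimage_inject[symmetric]) (auto simp: colon_elem_def)
  also have "preimage (colon_elem L (ideal_smult R I L) b \<inter> ideal_smult R J L)
      = colon_elem M (preimage (ideal_smult R I L)) b \<inter> preimage (ideal_smult R J L)"
    using b by (auto simp: preimage_def colon_elem_def smult_L carrier_L)
  finally show ?thesis
    using I by (simp add: preimage_ideal_smult)
qed

end

context module
begin

lemma module_length_quot_module:
  "submodule N R M \<Longrightarrow> module_length R (quot_module M N) = interval_length N (carrier M)"
  using module_quotient.module_length_quotient[of R M N] module_axioms
  by (simp add: module_quotient_def module_quotient_axioms_def)

lemma finite_colength_iff:
  "submodule N R M \<Longrightarrow> finite_colength N \<longleftrightarrow> module_length R (quot_module M N) < \<infinity>"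
  by (simp add: finite_colength_def module_length_quot_module)

lemma len_quot_module: "submodule N R M \<Longrightarrow> len R (quot_module M N) = colength N"
  by (simp add: colength_def module_length_quot_module)

text \<open>N/(N \<inter> I M) and (I M + N)/I M have the same length; this writes the terms of the
  e_i as differences of colengths.\<close>

lemma len_mod_eq:
  assumes N: "submodule N R M" and I: "I \<subseteq> carrier R" and fin: "finite_colength (ideal_smult R I M)"
  shows "len_mod R M I N
    = colength (ideal_smult R I M) - colength (ideal_smult R I M <+>\<^bsub>M\<^esub> N)"
proof -
  let ?P = "ideal_smult R I M" and ?M' = "M\<lparr>carrier := N\<rparr>"
  have P: "submodule ?P R M"
    using I by (simp add: ideal_smult_eq_act)
  have "submodule (N \<inter> ?P) R ?M'"
    using N P by (simp add: submodule_restrict_iff)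
  then have "module_length R (quot_module ?M' (N \<inter> ?P)) = chain_length {X. submodule X R ?M'} (N \<inter> ?P) N"
    using module.module_length_quot_module[OF module_restrict[OF N], of "N \<inter> ?P"] by simp
  also have "\<dots> = interval_length (N \<inter> ?P) N"
    by (rule interval_length_restrict[OF N])
  also have "\<dots> = interval_length ?P (?P <+>\<^bsub>M\<^esub> N)"
    using interval_length_diamond[OF N P] join_commute[OF N P] by simp
  finally show ?thesis
    using interval_length_colength(1)[OF fin _ join_upper1[OF P N]] N P by (simp add: len_mod_def)
qed

end

context module_seq
begin

lemma act_genideal_eq_Q:
  assumes X: "submodule X R M"
  shows "ideal_act R (Idl (c ` {..<i})) M X = Q i X"
proof
  have c: "c ` {..<i} \<subseteq> carrier R"
    by auto
  show "ideal_act R (Idl (c ` {..<i})) M X \<subseteq> Q i X"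
    unfolding act_genideal_subset_iff[OF submodule_Q[OF X] submodule_sub[OF X] c]
    using scale_subset_Q[OF X] by (auto simp: image_subset_iff)
  have I: "Idl (c ` {..<i}) \<subseteq> carrier R"
    using R.genideal_ideal[OF c] by (auto dest: ideal.Icarr)
  show "Q i X \<subseteq> ideal_act R (Idl (c ` {..<i})) M X"
  proof (rule Q_least)
    show "submodule (ideal_act R (Idl (c ` {..<i})) M X) R M"
      using I X by simp
    show "scale j X \<subseteq> ideal_act R (Idl (c ` {..<i})) M X" if "j < i" for j
      using that R.genideal_self[OF c] by (auto intro!: act_mem)
  qed
qed

lemma seq_ideal_eq:
  assumes "\<And>j. j < i \<Longrightarrow> c j = a (Suc j)"
  shows "seq_ideal R a i = Idl (c ` {..<i})"
proof -
  have "a ` {1..i} = a ` (Suc ` {..<i})"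
    by (simp only: image_Suc_lessThan)
  also have "\<dots> = c ` {..<i}"
    using assms by (auto simp: image_image)
  finally show ?thesis
    by (simp add: seq_ideal_def)
qed

lemma act_power_eq_pw:
  assumes X: "submodule X R M"
  shows "ideal_act R (ideal_power R (Idl (c ` {..<r})) k) M X = pw k X"
proof -
  have I: "ideal (Idl (c ` {..<r})) R"
    by (rule R.genideal_ideal) auto
  have "(ideal_act R (Idl (c ` {..<r})) M ^^ k) X = pw k X"
  proof (induction k)
    case (Suc k)
    then show ?case
      using X by (simp add: act_genideal_eq_Q)
  qed simp
  then show ?thesis
    using act_power[OF I X] by simp
qed

end

section \<open>Consequences for parameters in a local ring\<close>

lemma (in cring) ideal_power_subset_Suc:
  assumes "ideal I R"
  shows "ideal_power R I (Suc n) \<subseteq> ideal_power R I n" and "ideal_power R I (Suc n) \<subseteq> I"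
  using ideal_prod_inter[OF ideal_ideal_power[OF assms] assms] unfolding ideal_power_Suc by blast+

lemma ideal_prod_mono: "I \<subseteq> I' \<Longrightarrow> J \<subseteq> J' \<Longrightarrow> I \<cdot>\<^bsub>R\<^esub> J \<subseteq> I' \<cdot>\<^bsub>R\<^esub> J'"
proof
  fix x assume sub: "I \<subseteq> I'" "J \<subseteq> J'" and "x \<in> I \<cdot>\<^bsub>R\<^esub> J"
  from this(3) show "x \<in> I' \<cdot>\<^bsub>R\<^esub> J'"
    by (induction x rule: ideal_prod.induct) (use sub in \<open>auto intro: ideal_prod.intros\<close>)
qed

lemma ideal_power_mono: "I \<subseteq> J \<Longrightarrow> ideal_power R I n \<subseteq> ideal_power R J n"
  by (induction n) (simp_all only: ideal_power_0 ideal_power_Suc ideal_prod_mono order_refl)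

context module
begin

lemma act_commute:
  assumes "ideal I R" "ideal J R" "submodule X R M"
  shows "ideal_act R I M (ideal_act R J M X) = ideal_act R J M (ideal_act R I M X)"
  using act_prod[OF assms] act_prod[OF assms(2,1,3)] R.ideal_prod_commute[OF assms(1,2)] by simp

lemma act_power_Suc':
  assumes "ideal I R" "submodule X R M"
  shows "ideal_act R (ideal_power R I (Suc n)) M X
    = ideal_act R I M (ideal_act R (ideal_power R I n) M X)"
  using assms by (simp only: act_power funpow.simps o_apply)

lemma colon_ideal_power_Suc:
  assumes I: "ideal I R"
  shows "colon_ideal M {\<zero>\<^bsub>M\<^esub>} (ideal_power R I n) \<subseteq> colon_ideal M {\<zero>\<^bsub>M\<^esub>} (ideal_power R I (Suc n))"
  using R.ideal_power_subset_Suc(1)[OF I] by (auto simp: colon_ideal_def)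

lemma colon_ideal_power_0: "colon_ideal M {\<zero>\<^bsub>M\<^esub>} (ideal_power R I 0) = {\<zero>\<^bsub>M\<^esub>}"
proof
  show "colon_ideal M {\<zero>\<^bsub>M\<^esub>} (ideal_power R I 0) \<subseteq> {\<zero>\<^bsub>M\<^esub>}"
  proof
    fix x assume "x \<in> colon_ideal M {\<zero>\<^bsub>M\<^esub>} (ideal_power R I 0)"
    then have "x \<in> carrier M" "\<one> \<odot>\<^bsub>M\<^esub> x = \<zero>\<^bsub>M\<^esub>"
      unfolding colon_ideal_def ideal_power_0 by auto
    then show "x \<in> {\<zero>\<^bsub>M\<^esub>}"
      by simp
  qed
  show "{\<zero>\<^bsub>M\<^esub>} \<subseteq> colon_ideal M {\<zero>\<^bsub>M\<^esub>} (ideal_power R I 0)"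
    unfolding colon_ideal_def ideal_power_0 by simp
qed

lemma scale_colon_ideal_power:
  assumes I: "ideal I R" and b: "b \<in> I"
  shows "scale_set M b (colon_ideal M {\<zero>\<^bsub>M\<^esub>} (ideal_power R I (Suc n)))
    \<subseteq> colon_ideal M {\<zero>\<^bsub>M\<^esub>} (ideal_power R I n)"
proof (rule image_subsetI)
  fix x assume x: "x \<in> colon_ideal M {\<zero>\<^bsub>M\<^esub>} (ideal_power R I (Suc n))"
  have bR: "b \<in> carrier R"
    using ideal.Icarr[OF I b] .
  have "d \<odot>\<^bsub>M\<^esub> (b \<odot>\<^bsub>M\<^esub> x) = \<zero>\<^bsub>M\<^esub>" if d: "d \<in> ideal_power R I n" for d
  proof -
    have "d \<otimes> b \<in> ideal_power R I (Suc n)"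
      unfolding ideal_power_Suc using d b by (rule ideal_prod.prod)
    moreover have "d \<in> carrier R"
      using ideal.Icarr[OF R.ideal_ideal_power[OF I] d] .
    ultimately show ?thesis
      using x bR by (auto simp: colon_ideal_def smult_assoc1[symmetric])
  qed
  then show "b \<odot>\<^bsub>M\<^esub> x \<in> colon_ideal M {\<zero>\<^bsub>M\<^esub>} (ideal_power R I n)"
    using x bR by (auto simp: colon_ideal_def)
qed

end

context module_seq
begin

abbreviation gen_ideal :: "'a set"
  where "gen_ideal \<equiv> Idl (c ` {..<r})"

text \<open>Defined through the ideal and not the sequence, so reordering the generators leaves it
  unchanged.\<close>

abbreviation ann_power :: "nat \<Rightarrow> 'c set"
  where "ann_power n \<equiv> colon_ideal M {\<zero>\<^bsub>M\<^esub>} (ideal_power R gen_ideal n)"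

lemma gen_ideal: "ideal gen_ideal R"
  by (rule R.genideal_ideal) auto

lemma gen_mem: "i < r \<Longrightarrow> c i \<in> gen_ideal"
  using R.genideal_self[of "c ` {..<r}"] by auto

lemma ann_power_facts:
  "submodule (ann_power n) R M" "ann_power 0 = {\<zero>\<^bsub>M\<^esub>}"
  "i < r \<Longrightarrow> scale i (ann_power (Suc n)) \<subseteq> ann_power n"
proof -
  have "ideal_power R gen_ideal n \<subseteq> carrier R"
    using ideal.Icarr[OF R.ideal_ideal_power[OF gen_ideal]] by blast
  then show "submodule (ann_power n) R M"
    by (intro submodule_colon_ideal submodule_zeroset)
  show "ann_power 0 = {\<zero>\<^bsub>M\<^esub>}"
    by (rule colon_ideal_power_0)
  show "scale i (ann_power (Suc n)) \<subseteq> ann_power n" if "i < r"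
    by (rule scale_colon_ideal_power[OF gen_ideal gen_mem[OF that]])
qed

text \<open>The hypotheses are phrased with \<open>gen_ideal\<close>, so they are literally the same
  for a reordered sequence, and only the colon in the conclusion changes.\<close>

lemma fiber_eq_imp_colon_subset:
  assumes fin: "finite_colength (ideal_act R gen_ideal M T)" and r: "0 < r"
    and X: "submodule X R M" "ideal_act R gen_ideal M T \<subseteq> X"
    and eq: "colength (ideal_act R (ideal_power R gen_ideal (Suc m)) M X)
        - colength (ideal_act R (ideal_power R gen_ideal (Suc m)) M T)
      = int ((m + r) choose (r - 1)) * colength (X <+>\<^bsub>M\<^esub> ann_power (Suc m))"
  shows "colon_elem M (ideal_smult R (Idl (c ` {..<r - 1})) M) (c (r - 1)) \<subseteq> X <+>\<^bsub>M\<^esub> ann_power (Suc m)"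
  unfolding ideal_smult_eq_act act_genideal_eq_Q[OF submodule_carrier]
proof (rule fiber_bound_eq_imp_colon[of X ann_power])
  show "colength (pw (Suc m) X) - colength (pw (Suc m) T)
      = int ((m + r) choose (r - 1)) * colength (X <+>\<^bsub>M\<^esub> ann_power (Suc m))"
    using eq act_power_eq_pw[OF X(1), of "Suc m"] act_power_eq_pw[OF submodule_carrier, of "Suc m"]
    by (simp only:)
qed (use assms ann_power_facts in \<open>simp_all add: act_genideal_eq_Q\<close>)

text \<open>The identity starts at n = 1: for n = 0 the right-hand side would be all of M.\<close>

lemma graded_regular_superficial_eq:
  assumes E: "\<And>n. graded_regular_upto n" and i: "i < r" and n: "1 \<le> n"
  shows "colon i (pw (Suc n) T <+>\<^bsub>M\<^esub> Q i T) \<inter> (Q r T <+>\<^bsub>M\<^esub> Q i T) = pw n T <+>\<^bsub>M\<^esub> Q i T"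
proof
  have qr: "Q r T <+>\<^bsub>M\<^esub> Q i T = Q r T"
    using Q_index_mono[of T i r] i by (intro join_absorb) auto
  obtain m where m: "n = Suc m"
    using n by (cases n) auto
  show "colon i (pw (Suc n) T <+>\<^bsub>M\<^esub> Q i T) \<inter> (Q r T <+>\<^bsub>M\<^esub> Q i T) \<subseteq> pw n T <+>\<^bsub>M\<^esub> Q i T"
    unfolding qr m by (rule graded_regular_imp_superficial[OF E i])
  show "pw n T <+>\<^bsub>M\<^esub> Q i T \<subseteq> colon i (pw (Suc n) T <+>\<^bsub>M\<^esub> Q i T) \<inter> (Q r T <+>\<^bsub>M\<^esub> Q i T)"
  proof (rule Int_greatest)
    show "pw n T <+>\<^bsub>M\<^esub> Q i T \<subseteq> Q r T <+>\<^bsub>M\<^esub> Q i T"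
      unfolding m by (intro join_mono pw_subset_Q order_refl) auto
    have S: "submodule (pw n T <+>\<^bsub>M\<^esub> Q i T) R M"
      by simp
    have "scale i (pw n T <+>\<^bsub>M\<^esub> Q i T) = scale i (pw n T) <+>\<^bsub>M\<^esub> scale i (Q i T)"
      by (intro scale_join) auto
    also have "\<dots> \<subseteq> pw (Suc n) T <+>\<^bsub>M\<^esub> Q i T"
      by (intro join_mono scale_pw_subset scale_subset i) auto
    finally show "pw n T <+>\<^bsub>M\<^esub> Q i T \<subseteq> colon i (pw (Suc n) T <+>\<^bsub>M\<^esub> Q i T)"
      using scale_subset_iff[OF submodule_sub[OF S]] by blast
  qed
qed

end

locale local_module_seq = noetherian_local_module R M \<mm> + module_seq R M c r
  for R (structure) and M (structure) and \<mm> c r +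
  assumes c_max: "c i \<in> \<mm>"
begin

lemma gen_ideal_subset: "gen_ideal \<subseteq> \<mm>"
  using c_max by (intro A.genideal_minimal A.is_ideal) auto

text \<open>Let K be the sum of N = Q i T and the obstruction (N : c i) \<inter> qM. Superficiality
  puts K into q^n M + N for all large n. The weak Artin-Rees lemma for qK + N inside K then gives K
  = qK + N, and Nakayama gives K = N. This is Krull's intersection theorem in M/N.\<close>

lemma superficial_imp_relatively_regular:
  assumes sup: "\<And>i. i < r \<Longrightarrow> \<exists>n\<^sub>0. \<forall>n\<ge>n\<^sub>0.
    colon i (pw (Suc n) T <+>\<^bsub>M\<^esub> Q i T) \<inter> (Q r T <+>\<^bsub>M\<^esub> Q i T) = pw n T <+>\<^bsub>M\<^esub> Q i T"
  shows relatively_regular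
  unfolding relatively_regular_def
proof (intro allI impI)
  fix i assume i: "i < r"
  let ?N = "Q i T" and ?E = "colon i (Q i T) \<inter> Q r T"
  let ?K = "?N <+>\<^bsub>M\<^esub> ?E"
  let ?J = "Q r ?K <+>\<^bsub>M\<^esub> ?N"
  have s: "submodule ?N R M" "submodule ?E R M" "submodule ?K R M" "submodule ?J R M"
    by auto
  have NK: "?N \<subseteq> ?K"
    using s by (intro join_upper1)
  have JK: "?J \<subseteq> ?K"
    using s NK by (intro join_least Q_subset)
  obtain n\<^sub>0 where n\<^sub>0: "\<And>n. n\<^sub>0 \<le> n \<Longrightarrow>
      colon i (pw (Suc n) T <+>\<^bsub>M\<^esub> Q i T) \<inter> (Q r T <+>\<^bsub>M\<^esub> Q i T) = pw n T <+>\<^bsub>M\<^esub> Q i T"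
    using sup[OF i] by auto
  have K: "?K \<subseteq> pw n T <+>\<^bsub>M\<^esub> ?N" if "n\<^sub>0 \<le> n" for n
  proof (rule join_least)
    show "?N \<subseteq> pw n T <+>\<^bsub>M\<^esub> ?N"
      by (intro join_upper2) auto
    have "colon i ?N \<subseteq> colon i (pw (Suc n) T <+>\<^bsub>M\<^esub> ?N)"
      by (intro colon_mono join_upper2 submodule_pw s) auto
    moreover have "Q r T \<subseteq> Q r T <+>\<^bsub>M\<^esub> ?N"
      by (intro join_upper1) auto
    ultimately show "?E \<subseteq> pw n T <+>\<^bsub>M\<^esub> ?N"
      unfolding n\<^sub>0[OF that, symmetric] by (rule Int_mono)
  qed auto
  have "scale j ?K \<subseteq> ?J" if "j < r" for j
    using scale_subset_Q[OF s(3) that] join_upper1[of "Q r ?K" ?N] s by auto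
  then obtain L n where L: "submodule L R M" "?J \<subseteq> L" "L \<inter> ?K = ?J" "pw n T \<subseteq> L"
    using weak_artin_rees[OF acc s(4,3) JK] by blast
  have "?N \<subseteq> L"
    using join_upper2[of "Q r ?K" ?N] s L(2) by auto
  have "?K \<subseteq> pw (max n\<^sub>0 n) T <+>\<^bsub>M\<^esub> ?N"
    by (rule K) simp
  also have "\<dots> \<subseteq> L"
    using L \<open>?N \<subseteq> L\<close> pw_antimono[of T n "max n\<^sub>0 n"] by (intro join_least) auto
  finally have "?K \<subseteq> ?J"
    using L(3) by auto
  then have "?K = ?N"
    using s NK gen_ideal_subset by (intro nakayama[of ?K ?N gen_ideal]) (simp_all add: act_genideal_eq_Q)
  then show "?E \<subseteq> Q i T"
    using join_upper2[OF s(1,2)] by simp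
qed

text \<open>A generator sends (0 : q^(n+1)) into (0 : q^n), so the weak Artin-Rees lemma applies to
  this pair and carries the induction from n to n + 1.\<close>

lemma ann_power_disjoint: "\<exists>t. pw t T \<inter> ann_power n \<subseteq> {\<zero>\<^bsub>M\<^esub>}"
proof (induction n)
  case 0
  then show ?case
    unfolding ann_power_facts by blast
next
  case (Suc n)
  then obtain t where t: "pw t T \<inter> ann_power n \<subseteq> {\<zero>\<^bsub>M\<^esub>}"
    by blast
  obtain L s where L: "L \<inter> ann_power (Suc n) = ann_power n" "pw s T \<subseteq> L"
    using weak_artin_rees[OF acc ann_power_facts(1,1) colon_ideal_power_Suc[OF gen_ideal], of n]
      ann_power_facts(3)[of _ n] by metis
  have "pw (max s t) T \<subseteq> pw s T" "pw (max s t) T \<subseteq> pw t T"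
    by (intro pw_antimono; simp)+
  then have "pw (max s t) T \<inter> ann_power (Suc n) \<subseteq> {\<zero>\<^bsub>M\<^esub>}"
    using L t by blast
  then show ?case
    by blast
qed

text \<open>The submodules \<mm>^k M + N decrease while their colengths stay below that of N, so two
  consecutive ones agree, and Nakayama identifies them with N.\<close>

lemma maximal_power_subset:
  assumes N: "finite_colength N"
  shows "\<exists>k. ideal_act R (ideal_power R \<mm> k) M T \<subseteq> N"
proof -
  let ?X = "\<lambda>k. ideal_act R (ideal_power R \<mm> k) M T <+>\<^bsub>M\<^esub> N"
  have carr: "ideal_power R \<mm> k \<subseteq> carrier R" for k
    using ideal.Icarr[OF A.ideal_ideal_power[OF A.is_ideal]] by blast
  have s: "submodule N R M" "submodule (ideal_act R (ideal_power R \<mm> k) M T) R M" for k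
    using N carr by auto
  have X: "submodule (?X k) R M" "N \<subseteq> ?X k" for k
    using s join_upper2 by auto
  have fin: "finite_colength (?X k)" for k
    using finite_colength_mono[OF N X] .
  have dec: "?X (Suc k) \<subseteq> ?X k" for k
    using A.ideal_power_subset_Suc(1)[OF A.is_ideal, of k] carr
    by (intro join_mono act_mono) auto
  have "\<exists>k. ?X (Suc k) = ?X k"
  proof (rule ccontr)
    assume ne: "\<nexists>k. ?X (Suc k) = ?X k"
    have "int k \<le> colength (?X k)" for k
    proof (induction k)
      case 0
      then show ?case
        using colength_mono[OF fin submodule_carrier submodule_sub[OF X(1)], of 0] by simp
    next
      case (Suc k)
      have "colength (?X k) \<noteq> colength (?X (Suc k))"
        using colength_eq_imp[OF fin X(1) dec[of k]] ne by metis
      moreover have "colength (?X k) \<le> colength (?X (Suc k))"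
        using colength_mono[OF fin X(1) dec] .
      ultimately show ?case
        using Suc by linarith
    qed
    moreover have "colength (?X k) \<le> colength N" for k
      using colength_mono[OF N X] .
    ultimately have "int (nat (colength N) + 1) \<le> colength N"
      by (meson order_trans)
    then show False
      by linarith
  qed
  then obtain k where k: "?X (Suc k) = ?X k"
    by blast
  have "?X k = N"
  proof (rule nakayama[OF X(1) s(1) X(2) order_refl])
    have "?X k = ideal_act R \<mm> M (ideal_act R (ideal_power R \<mm> k) M T) <+>\<^bsub>M\<^esub> N"
      unfolding k[symmetric] act_power_Suc'[OF A.is_ideal submodule_carrier] ..
    also have "\<dots> \<subseteq> ideal_act R \<mm> M (?X k) <+>\<^bsub>M\<^esub> N"
      using s A.a_subset by (intro join_mono act_mono join_upper1 order_refl X)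
    finally show "?X k \<subseteq> ideal_act R \<mm> M (?X k) <+>\<^bsub>M\<^esub> N" .
  qed
  then show ?thesis
    using join_upper1[OF s(2,1), of k] by auto
qed

text \<open>The length bound produces q-torsion, but (iii) speaks of \<mm>-torsion. Since q need not
  contain a power of \<mm>, the comparison takes place in M: some \<mm>^k M lies in a power q^t M
  that meets (0 : q^n) only in 0.\<close>

lemma ann_power_subset:
  assumes fin: "finite_colength (Q r T)"
  shows "ann_power n \<subseteq> (\<Union>k\<in>{1..}. colon_ideal M {\<zero>\<^bsub>M\<^esub>} (ideal_power R \<mm> k))"
proof
  fix x assume x: "x \<in> ann_power n"
  have xM: "x \<in> carrier M"
    using submodule_carrierD[OF ann_power_facts(1) x] .
  obtain t where t: "pw t T \<inter> ann_power n \<subseteq> {\<zero>\<^bsub>M\<^esub>}"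
    using ann_power_disjoint by blast
  obtain k where k: "ideal_act R (ideal_power R \<mm> k) M T \<subseteq> pw t T"
    using maximal_power_subset[OF finite_colength_pw[OF fin]] by blast
  have "b \<odot>\<^bsub>M\<^esub> x = \<zero>\<^bsub>M\<^esub>" if b: "b \<in> ideal_power R \<mm> (Suc k)" for b
  proof -
    have b': "b \<in> ideal_power R \<mm> k"
      using A.ideal_power_subset_Suc(1)[OF A.is_ideal] b by blast
    have "b \<in> carrier R"
      using ideal.Icarr[OF A.ideal_ideal_power[OF A.is_ideal] b] .
    then have "b \<odot>\<^bsub>M\<^esub> x \<in> ann_power n"
      using submodule_smult[OF ann_power_facts(1) _ x] by simp
    moreover have "b \<odot>\<^bsub>M\<^esub> x \<in> pw t T"
      using k act_mem[OF b' xM] by blast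
    ultimately show ?thesis
      using t by blast
  qed
  \<comment> \<open>The exponent k + 1 is used because the union starts at exponent 1.\<close>
  then have "x \<in> colon_ideal M {\<zero>\<^bsub>M\<^esub>} (ideal_power R \<mm> (Suc k))"
    using xM by (simp add: colon_ideal_def)
  then show "x \<in> (\<Union>k\<in>{1..}. colon_ideal M {\<zero>\<^bsub>M\<^esub>} (ideal_power R \<mm> k))"
    by (intro UN_I[of "Suc k"]) simp_all
qed

end

section \<open>The bound and its equality case\<close>

context module_seq
begin

text \<open>For n = m + 1 the sum over the e_i is the bound for l(M/q^(m+1) M). For n = 0 it reduces
  to e_r and is kept apart.\<close>

lemma length_bound_eq:
  assumes fin: "finite_colength (Q r T)" and r: "0 < r"
    and c': "\<forall>j<r. c j = a (Suc j)" and I: "I \<subseteq> carrier R"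
  shows "length_bound R M I a r (Suc m) = hilbert_bound m
      + int ((m + r) choose (r - 1)) * colength (ideal_act R I M T <+>\<^bsub>M\<^esub> ann_power (Suc m))"
    and "length_bound R M I a r 0
      = colength (Q r T) - colength (Q r T <+>\<^bsub>M\<^esub> colon 0 (Q 0 T)) + colength (ideal_act R I M T)"
proof -
  have c: "c j = a (Suc j)" if "j < r" for j
    using c' that by simp
  \<comment> \<open>With these values e_i = C (r - i + 1) - C (r - i) for all i from 0 to r: C 0 = 0
    covers i = r, and C (r + 1) = l(M/qM) covers i = 0.\<close>
  define C where "C j = (case j of 0 \<Rightarrow> 0 | Suc i \<Rightarrow>
    if i < r then colength (Q r T) - colength (Q r T <+>\<^bsub>M\<^esub> colon i (Q i T)) else colength (Q r T))" for j
  have seq: "seq_ideal R a i = Idl (c ` {..<i})" if "i \<le> r" for i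
    using that c by (intro seq_ideal_eq) auto
  have qM: "ideal_smult R (seq_ideal R a i) M = Q i T" if "i \<le> r" for i
    using seq[OF that] by (simp add: ideal_smult_eq_act act_genideal_eq_Q)
  have "seq_ideal R a r \<subseteq> carrier R"
    using seq[of r] gen_ideal by (auto dest: ideal.Icarr)
  then have len_mod: "len_mod R M (seq_ideal R a r) (colon_elem M (Q i T) (a (Suc i))) = C (Suc i)"
    if "i < r" for i
    unfolding c[OF that, symmetric]
    using that fin len_mod_eq[of "colon i (Q i T)" "seq_ideal R a r"] by (simp add: C_def qM)
  have len: "len R (quot_module M (Q r T)) = C (Suc r)"
    by (simp add: C_def len_quot_module)
  have e: "e_coeff R M a r i = C (Suc (r - i)) - C (r - i)" if i: "i \<le> r" for i
  proof -
    consider "i = 0" | "0 < i" "i < r" | "i = r" "i \<noteq> 0"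
      using i by linarith
    then show ?thesis
    proof cases
      case 1
      then show ?thesis
        using len_mod[of "r - 1"] r by (simp add: e_coeff_def qM len)
    next
      case 2
      have "r - i - 1 < r" "Suc (r - i - 1) = r - i" "r - i < r"
        using 2 by auto
      then show ?thesis
        using 2 len_mod[of "r - i"] len_mod[of "r - i - 1"] by (simp add: e_coeff_def qM Let_def)
    next
      case 3
      then show ?thesis
        using len_mod[of 0] r by (simp add: e_coeff_def C_def)
    qed
  qed
  have IM: "submodule (ideal_act R I M T <+>\<^bsub>M\<^esub> ann_power n) R M" "submodule (ideal_act R I M T) R M" for n
    using I ann_power_facts(1) by simp_all
  have last: "len R (quot_module M (ideal_smult R I M <+>\<^bsub>M\<^esub> colon_ideal M {\<zero>\<^bsub>M\<^esub>}
      (ideal_power R (seq_ideal R a r) n))) = colength (ideal_act R I M T <+>\<^bsub>M\<^esub> ann_power n)" for n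
    unfolding seq[OF order_refl] ideal_smult_eq_act by (rule len_quot_module[OF IM(1)])
  have "(\<Sum>i=0..r. int ((Suc m + r - i - 1) choose (r - i)) * e_coeff R M a r i)
      = (\<Sum>i\<le>r. int ((m + (r - i)) choose (r - i)) * (C (Suc (r - i)) - C (r - i)))"
    by (intro sum.cong) (auto simp: e atLeast0AtMost)
  also have "\<dots> = (\<Sum>j\<le>r. int ((m + j) choose j) * (C (Suc j) - C j))"
    using sum.nat_diff_reindex[where g = "\<lambda>j. int ((m + j) choose j) * (C (Suc j) - C j)" and n = "Suc r"]
    by (simp add: lessThan_Suc_atMost)
  also have "\<dots> = C (Suc r) + (\<Sum>k<m. \<Sum>j<r. int ((k + j) choose j) * (C (Suc r) - C (Suc j)))"
    by (rule hilbert_sum_eq) (simp add: C_def)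
  also have "\<dots> = hilbert_bound m"
    by (simp add: hilbert_bound_def C_def)
  finally show "length_bound R M I a r (Suc m) = hilbert_bound m
      + int ((m + r) choose (r - 1)) * colength (ideal_act R I M T <+>\<^bsub>M\<^esub> ann_power (Suc m))"
    unfolding length_bound_def last by simp
  \<comment> \<open>Only i = r survives, with the conventional value 1; for i < r the upper index is
    one below the lower.\<close>
  have "(\<Sum>i=0..r. int ((0 + r - i - 1) choose (r - i)) * e_coeff R M a r i)
      = (\<Sum>i=0..r. if i = r then C 1 else 0)"
    by (intro sum.cong) (auto simp: e C_def intro!: binomial_eq_0)
  also have "\<dots> = C 1"
    by simp
  finally show "length_bound R M I a r 0
      = colength (Q r T) - colength (Q r T <+>\<^bsub>M\<^esub> colon 0 (Q 0 T)) + colength (ideal_act R I M T)"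
    unfolding length_bound_def last ann_power_facts(2)
    using r IM(2) by (simp add: C_def join_absorb submodule_zero)
qed

end

context local_module_seq
begin

context
  fixes \<aa>
  assumes \<aa>: "ideal \<aa> R" and c\<aa>: "\<forall>i<r. c i \<in> \<aa>"
    and fin: "finite_colength (Q r T)" and r: "0 < r"
begin

private abbreviation (input) X :: "'c set"
  where "X \<equiv> ideal_act R \<aa> M T"

private abbreviation (input) ap :: "nat \<Rightarrow> 'c set"
  where "ap n \<equiv> ideal_act R (ideal_power R \<aa> n) M T"

lemma submodule_X: "submodule X R M"
  using ideal.Icarr[OF \<aa>] by (intro submodule_act) auto

lemma submodule_ap: "submodule (ap n) R M"
  using ideal.Icarr[OF A.ideal_ideal_power[OF \<aa>]] by (intro submodule_act) auto

lemma ap_Suc: "ap (Suc n) = ideal_act R \<aa> M (ap n)"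
  by (rule act_power_Suc'[OF \<aa> submodule_carrier])

lemma gen_ideal_subset_\<aa>: "gen_ideal \<subseteq> \<aa>"
  using c\<aa> by (intro A.genideal_minimal \<aa>) auto

lemma Q_subset_act:
  assumes "Y \<subseteq> Z" "submodule Y R M" "submodule Z R M"
  shows "Q r Y \<subseteq> ideal_act R \<aa> M Z"
  unfolding act_genideal_eq_Q[OF assms(2), symmetric]
  using assms gen_ideal_subset_\<aa> ideal.Icarr[OF \<aa>] by (intro act_mono) auto

lemma Q_subset_X: "Q r T \<subseteq> X"
  by (intro Q_subset_act) auto

lemma pw_subset_ap: "pw n X \<subseteq> ap (Suc n)"
proof (induction n)
  case 0
  show ?case
    unfolding ap_Suc ideal_power_0 act_carrier[OF submodule_carrier] by simp
next
  case (Suc n)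
  show ?case
    unfolding ap_Suc[of "Suc n"] funpow.simps o_apply
    by (intro Q_subset_act Suc submodule_pw submodule_X submodule_ap)
qed

lemma finite_colength_pw_X: "finite_colength (pw n X)"
proof (rule finite_colength_mono[OF finite_colength_pw[OF fin, of "Suc n"]])
  show "pw (Suc n) T \<subseteq> pw n X"
    using pw_mono[OF Q_subset_X, of n] by (simp only: pw_commute)
qed (use submodule_X in simp)

lemma finite_colength_ap: "finite_colength (ap (Suc n))"
  using finite_colength_mono[OF finite_colength_pw_X submodule_ap pw_subset_ap] .

text \<open>Since m >= n >= 1, a factor q can be taken out: with m = l + 1, \<aa> q^m X = q (\<aa>
  q^l X), and \<aa> q^l X lies in \<aa>^(m+1) M = q^m X.\<close>

lemma reduction_stable:
  assumes n: "1 \<le> n" "pw n X = ap (Suc n)" and "n \<le> m"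
  shows "pw m X = ap (Suc m)"
  using \<open>n \<le> m\<close>
proof (induction m rule: dec_induct)
  case base
  then show ?case by (rule n(2))
next
  case (step m)
  obtain l where l: "m = Suc l"
    using n(1) step.hyps by (cases m) auto
  have "ap (Suc (Suc m)) = ideal_act R \<aa> M (pw m X)"
    by (simp only: ap_Suc[of "Suc m"] step.IH)
  also have "\<dots> = ideal_act R \<aa> M (ideal_act R gen_ideal M (pw l X))"
    using submodule_X by (simp add: act_genideal_eq_Q l)
  also have "\<dots> = ideal_act R gen_ideal M (ideal_act R \<aa> M (pw l X))"
    by (intro act_commute \<aa> gen_ideal submodule_pw submodule_X)
  also have "\<dots> \<subseteq> ideal_act R gen_ideal M (ap (Suc m))"
  proof (rule act_mono[OF order_refl _ _ submodule_ap])
    show "ideal_act R \<aa> M (pw l X) \<subseteq> ap (Suc m)"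
      unfolding ap_Suc[of m] using pw_subset_ap[of l] ideal.Icarr[OF \<aa>] submodule_ap[of m]
      by (intro act_mono) (auto simp: l)
    show "gen_ideal \<subseteq> carrier R"
      using gen_ideal by (auto dest: ideal.Icarr)
  qed
  also have "\<dots> = pw (Suc m) X"
    unfolding step.IH[symmetric] using submodule_X by (simp add: act_genideal_eq_Q)
  finally show ?case
    using pw_subset_ap[of "Suc m"] by (rule antisym[rotated])
qed

private abbreviation (input) fiber_eq :: "nat \<Rightarrow> bool"
  where "fiber_eq m \<equiv> colength (pw (Suc m) X) - colength (pw (Suc m) T)
    = int ((m + r) choose (r - 1)) * colength (X <+>\<^bsub>M\<^esub> ann_power (Suc m))"

text \<open>With n = m + 1 the gap is a sum of three nonnegative gaps: between q^n \<aa> M and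
  \<aa>^(n+1) M, in the bound for M/q^n M, and in the bound for q^n M/q^n \<aa> M. It vanishes only
  if all three do.\<close>

lemma length_le_bound:
  defines "B \<equiv> \<lambda>m. hilbert_bound m + int ((m + r) choose (r - 1)) * colength (X <+>\<^bsub>M\<^esub> ann_power (Suc m))"
  shows "colength (ap (Suc (Suc m))) \<le> B m"
    and "colength (ap (Suc (Suc m))) = B m \<longleftrightarrow>
      pw (Suc m) X = ap (Suc (Suc m)) \<and> colength (pw (Suc m) T) = hilbert_bound m \<and> fiber_eq m"
proof -
  have 1: "colength (ap (Suc (Suc m))) \<le> colength (pw (Suc m) X)"
    using colength_mono[OF finite_colength_pw_X submodule_ap pw_subset_ap] .
  have 2: "colength (ap (Suc (Suc m))) = colength (pw (Suc m) X) \<longleftrightarrow> pw (Suc m) X = ap (Suc (Suc m))"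
    using colength_eq_imp[OF finite_colength_pw_X submodule_ap pw_subset_ap] by metis
  note 3 = colength_pw_bound[OF fin, of m]
  have 4: "colength (pw (Suc m) X) - colength (pw (Suc m) T)
      \<le> int ((m + r) choose (r - 1)) * colength (X <+>\<^bsub>M\<^esub> ann_power (Suc m))"
    by (rule fiber_bound[OF fin r submodule_X Q_subset_X]) (rule ann_power_facts)+
  show "colength (ap (Suc (Suc m))) \<le> B m"
    using 1 3 4 unfolding B_def by linarith
  have "colength (ap (Suc (Suc m))) = B m \<longleftrightarrow> colength (ap (Suc (Suc m))) = colength (pw (Suc m) X) \<and>
      colength (pw (Suc m) T) = hilbert_bound m \<and> fiber_eq m"
    using 1 3[THEN conjunct1] 4 unfolding B_def by linarith
  then show "colength (ap (Suc (Suc m))) = B m \<longleftrightarrow>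
      pw (Suc m) X = ap (Suc (Suc m)) \<and> colength (pw (Suc m) T) = hilbert_bound m \<and> fiber_eq m"
    unfolding 2 .
qed

text \<open>Equality for m controls every index below m, so arbitrarily large m reach every
  k.\<close>

lemma infinitely_many_hilbert_eq:
  assumes "infinite {m. colength (pw (Suc m) T) = hilbert_bound m}"
  shows "graded_regular_upto k"
proof -
  obtain m where "k < m" "colength (pw (Suc m) T) = hilbert_bound m"
    using assms unfolding infinite_nat_iff_unbounded by blast
  then show ?thesis
    using colength_pw_bound[OF fin, of m] by blast
qed

text \<open>Relative regularity collapses all torsion into V = (0 : c 0). As V meets qM only in 0,
  qV = 0. Further, c 0 carries each (0 : q^k) into torsion inside qM, which is 0, so (0 : q^k) lies
  in V. Since q lies in \<mm>, the \<mm>-torsion is q-torsion and may be replaced by V in the colon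
  conditions.\<close>

lemma fiber_eqI:
  assumes D: relatively_regular
    and S: "\<And>i. i < r \<Longrightarrow> submodule (S i) R M"
      "\<And>i j. i < r \<Longrightarrow> j < r \<Longrightarrow> i \<noteq> j \<Longrightarrow> scale j T \<subseteq> S i"
    and sub: "\<And>i. i < r \<Longrightarrow> colon i (S i)
      \<subseteq> X <+>\<^bsub>M\<^esub> (\<Union>k\<in>{1..}. colon_ideal M {\<zero>\<^bsub>M\<^esub>} (ideal_power R \<mm> k))"
  shows "fiber_eq m"
proof -
  let ?V = "colon 0 (Q 0 T)"
  have V: "submodule ?V R M"
    by simp
  have VQ: "?V \<inter> Q r T \<subseteq> {\<zero>\<^bsub>M\<^esub>}"
    using D r unfolding relatively_regular_def by (metis Q.simps(1))
  have scaleV: "scale i ?V \<subseteq> {\<zero>\<^bsub>M\<^esub>}" if "i < r" for i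
  proof -
    have "scale i ?V \<subseteq> Q r T"
      using scale_mono[OF submodule_sub[OF V], of "c i"] scale_subset_Q[OF submodule_carrier that]
      by (rule order_trans)
    then show ?thesis
      using scale_subset[OF c_closed V, of i] VQ by blast
  qed
  have "Q r ?V \<subseteq> {\<zero>\<^bsub>M\<^esub>}"
    by (rule Q_least[OF submodule_zeroset scaleV])
  then have qV: "b \<odot>\<^bsub>M\<^esub> x = \<zero>\<^bsub>M\<^esub>" if "b \<in> gen_ideal" "x \<in> ?V" for b x
    using act_mem[OF that] act_genideal_eq_Q[OF V, of r] by auto
  have V_ann: "?V \<subseteq> ann_power (Suc m)"
  proof
    fix x assume x: "x \<in> ?V"
    then show "x \<in> ann_power (Suc m)"
      using qV[OF subsetD[OF A.ideal_power_subset_Suc(2)[OF gen_ideal]] x] submodule_carrierD[OF V x]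
      unfolding colon_ideal_def by simp
  qed
  have annV: "ann_power k \<subseteq> ?V" for k
  proof (cases k)
    case 0
    then show ?thesis
      unfolding 0 ann_power_facts(2) using submodule_zero[OF V] by simp
  next
    case (Suc l)
    have "scale 0 (ann_power (Suc l)) \<subseteq> Q r T"
      using scale_mono[OF submodule_sub[OF ann_power_facts(1)], of "c 0"]
        scale_subset_Q[OF submodule_carrier r] by (rule order_trans)
    moreover have "ann_power l \<inter> Q r T \<subseteq> {\<zero>\<^bsub>M\<^esub>}"
      using ann_power_facts r by (intro submodules_disjoint[OF D]) auto
    ultimately have "scale 0 (ann_power (Suc l)) \<subseteq> Q 0 T"
      using ann_power_facts(3)[OF r, of l] by (simp only: Q.simps) blast
    then show ?thesis
      unfolding Suc using scale_subset_iff[OF submodule_sub[OF ann_power_facts(1)]] by blast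
  qed
  have "colon_ideal M {\<zero>\<^bsub>M\<^esub>} (ideal_power R \<mm> k) \<subseteq> ann_power k" for k
    using ideal_power_mono[OF gen_ideal_subset] unfolding colon_ideal_def by blast
  then have "(\<Union>k\<in>{1..}. colon_ideal M {\<zero>\<^bsub>M\<^esub>} (ideal_power R \<mm> k)) \<subseteq> ?V"
    using annV by blast
  then have "colon i (S i) \<subseteq> X <+>\<^bsub>M\<^esub> ?V" if "i < r" for i
    using sub[OF that] join_mono[OF order_refl] by (meson order_trans)
  then show ?thesis
    by (intro fiber_bound_eqI[OF fin r submodule_X Q_subset_X ann_power_facts D S V scaleV V_ann])
qed

end

end

theorem corollary4p3:
  fixes A :: "('a, 'c) ring_scheme" and M :: "('a, 'b, 'd) module_scheme"
    and \<mm> \<aa> \<qq> :: "'a set" and a :: "nat \<Rightarrow> 'a" and r :: nat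
  assumes "noetherian_local_ring A \<mm>"
    and "finitely_generated_module A M"
    and "ideal \<aa> A"
    and "module_length A (quot_module M (ideal_smult A \<aa> M)) < \<infinity>"
    and "r \<ge> 1"
    and "system_of_parameters A \<mm> M a r"
    and "\<forall>i\<in>{1..r}. a i \<in> \<aa>"
    and "\<qq> = seq_ideal A a r"
  shows "(\<forall>n. module_length A (quot_module M (ideal_smult A (ideal_power A \<aa> (n + 1)) M)) < \<infinity> \<and>
              len A (quot_module M (ideal_smult A (ideal_power A \<aa> (n + 1)) M))
                \<le> length_bound A M \<aa> a r n)
    \<and> (infinite {n. len A (quot_module M (ideal_smult A (ideal_power A \<aa> (n + 1)) M))
                      = length_bound A M \<aa> a r n}
       \<longleftrightarrow>
         (\<exists>n\<ge>1. ideal_smult A (ideal_power A \<qq> n \<cdot>\<^bsub>A\<^esub> \<aa>) M = ideal_smult A (ideal_power A \<aa> (n + 1)) M)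
       \<and> absolutely_superficial A M a r
       \<and> (\<forall>\<sigma>. \<sigma> permutes {1..r} \<longrightarrow>
             colon_elem M (ideal_smult A (seq_ideal A (a \<circ> \<sigma>) (r - 1)) M) (a (\<sigma> r))
               \<subseteq> ideal_smult A \<aa> M
                   <+>\<^bsub>M\<^esub> (\<Union>k\<in>{1..}. colon_ideal M {\<zero>\<^bsub>M\<^esub>} (ideal_power A \<mm> k))))"
proof -
  interpret A: noetherian_local_ring A \<mm> by fact
  have r: "0 < r" using assms(5) by simp
  have a_max: "a (Suc j) \<in> \<mm>" if "j < r" for j
    using assms(6) that by (simp add: system_of_parameters_def)
  \<comment> \<open>Indices are shifted to start at 0, and the zeros from r on make
    \<open>c j \<in> \<mm>\<close> true for every j.\<close>
  define c where "c j = (if j < r then a (Suc j) else \<zero>\<^bsub>A\<^esub>)" for j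
  have c_max: "c j \<in> \<mm>" for j
    using a_max A.zero_closed by (simp add: c_def)
  interpret local_module_seq A M \<mm> c r
  proof (intro local_module_seq.intro noetherian_local_module.intro noetherian_local_module_axioms.intro
      module_seq.intro module_seq_axioms.intro local_module_seq_axioms.intro)
    show "Module.module A M" "Module.module A M"
      using assms(2) by (simp_all add: finitely_generated_module_def)
    show "c i \<in> carrier A" for i
      using c_max A.a_subset by auto
  qed (fact assms c_max)+
  have ca: "c j = a (Suc j)" if "j < r" for j
    using that by (simp add: c_def)
  have ca_all: "\<forall>j<r. c j = a (Suc j)"
    by (simp add: c_def)
  have c\<aa>: "\<forall>j<r. c j \<in> \<aa>"
    using assms(7) by (simp add: c_def)
  have seq: "seq_ideal A a i = Idl\<^bsub>A\<^esub> (c ` {..<i})" if "i \<le> r" for i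
    using that ca by (intro seq_ideal_eq) auto
  have \<qq>: "\<qq> = gen_ideal"
    using seq[of r] assms(8) by simp
  have qM: "ideal_smult A (seq_ideal A a i) M = Q i T" if "i \<le> r" for i
    using seq[OF that] by (simp add: ideal_smult_eq_act act_genideal_eq_Q)
  have fin: "finite_colength (Q r T)"
    using assms(6) qM[of r] by (simp add: system_of_parameters_def finite_colength_iff)
  note ctx = assms(3) c\<aa> fin r
  let ?X = "ideal_act A \<aa> M T" and ?ap = "\<lambda>n. ideal_act A (ideal_power A \<aa> n) M T"
  let ?fiber = "\<lambda>m. colength (pw (Suc m) ?X) - colength (pw (Suc m) T)
    = int ((m + r) choose (r - 1)) * colength (?X <+>\<^bsub>M\<^esub> ann_power (Suc m))"
  have \<aa>c: "\<aa> \<subseteq> carrier A"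
    using ideal.Icarr[OF assms(3)] by blast
  have X: "submodule ?X A M" "Q r T \<subseteq> ?X"
    using submodule_X[OF ctx] Q_subset_X[OF ctx] .
  have len: "len A (quot_module M (ideal_smult A (ideal_power A \<aa> n) M)) = colength (?ap n)" for n
    unfolding ideal_smult_eq_act by (rule len_quot_module[OF submodule_ap[OF ctx]])
  note lb = length_bound_eq[OF fin r ca_all \<aa>c]
  have power_eq: "ideal_smult A (ideal_power A \<qq> n \<cdot>\<^bsub>A\<^esub> \<aa>) M = pw n ?X" for n
    unfolding \<qq> ideal_smult_eq_act act_prod[OF A.ideal_ideal_power[OF gen_ideal] assms(3) submodule_carrier]
    by (rule act_power_eq_pw[OF X(1)])
  have eq_iff: "len A (quot_module M (ideal_smult A (ideal_power A \<aa> (Suc m + 1)) M))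
        = length_bound A M \<aa> a r (Suc m)
      \<longleftrightarrow> pw (Suc m) ?X = ?ap (Suc (Suc m)) \<and> colength (pw (Suc m) T) = hilbert_bound m \<and> ?fiber m" for m
    unfolding len lb using length_le_bound(2)[OF ctx, of m] by (simp only: add_Suc_right add_0_right One_nat_def)
  have superficial_iff: "absolutely_superficial A M a r \<longleftrightarrow> (\<forall>i<r. \<exists>n\<^sub>0. \<forall>n\<ge>n\<^sub>0.
      colon i (pw (Suc n) T <+>\<^bsub>M\<^esub> Q i T) \<inter> (Q r T <+>\<^bsub>M\<^esub> Q i T) = pw n T <+>\<^bsub>M\<^esub> Q i T)"
  proof -
    have "colon_elem L (ideal_smult A (ideal_power A (seq_ideal A a r) (n + 1)) L) (a (Suc i))
          \<inter> ideal_smult A (seq_ideal A a r) L = ideal_smult A (ideal_power A (seq_ideal A a r) n) L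
        \<longleftrightarrow> colon i (pw (Suc n) T <+>\<^bsub>M\<^esub> Q i T) \<inter> (Q r T <+>\<^bsub>M\<^esub> Q i T) = pw n T <+>\<^bsub>M\<^esub> Q i T"
      if i: "i < r" and L: "L = quot_module M (ideal_smult A (seq_ideal A a i) M)" for i n L
    proof -
      interpret quo: module_quotient A M "Q i T"
        by (intro module_quotient.intro module_quotient_axioms.intro module_axioms submodule_Q
            submodule_carrier)
      have sub: "ideal_power A gen_ideal n \<subseteq> carrier A" "gen_ideal \<subseteq> carrier A" for n
        using ideal.Icarr[OF A.ideal_ideal_power[OF gen_ideal]] ideal.Icarr[OF gen_ideal] by blast+
      have pw: "ideal_smult A (ideal_power A gen_ideal n) M = pw n T" for n
        unfolding ideal_smult_eq_act by (rule act_power_eq_pw) simp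
      show ?thesis
        using quo.superficial_quotient_iff[OF sub(1) sub(2) sub(1) c_closed, of "Suc n" i n] i
        by (simp only: L qM less_imp_le ca[symmetric] seq[OF order_refl] pw Suc_eq_plus1[symmetric]
            ideal_smult_eq_act[of A gen_ideal M] act_genideal_eq_Q[OF submodule_carrier])
    qed
    moreover have "(\<forall>i\<in>{1..r}. P i) \<longleftrightarrow> (\<forall>i<r. P (Suc i))" for P
      unfolding image_Suc_lessThan[symmetric] by auto
    ultimately show ?thesis
      by (simp add: absolutely_superficial_def Let_def)
  qed
  \<comment> \<open>The fiber equality depends only on \<aa> and the ideal q. For each \<sigma> it
    is therefore also the equality for the reordered sequence, whose last generator is a (\<sigma>
    r).\<close>
  have colon_iff: "(\<forall>\<sigma>. \<sigma> permutes {1..r} \<longrightarrow>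
      colon_elem M (ideal_smult A (seq_ideal A (a \<circ> \<sigma>) (r - 1)) M) (a (\<sigma> r)) \<subseteq> ?X <+>\<^bsub>M\<^esub> ann_power (Suc m))"
    if eq: "?fiber m" for m
  proof (intro allI impI)
    fix \<sigma> assume \<sigma>: "\<sigma> permutes {1..r}"
    define c' where "c' j = (if j < r then a (\<sigma> (Suc j)) else \<zero>\<^bsub>A\<^esub>)" for j
    have \<sigma>_mem: "\<sigma> (Suc j) \<in> {1..r}" if "j < r" for j
      using permutes_in_image[OF \<sigma>, of "Suc j"] that by simp
    have "a (\<sigma> (Suc j)) \<in> carrier A" if "j < r" for j
      using assms(7) \<sigma>_mem[OF that] \<aa>c by blast
    then interpret perm: module_seq A M c' r
      by unfold_locales (simp add: c'_def)
    have "c' ` {..<r} = a ` \<sigma> ` Suc ` {..<r}"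
      by (auto simp: c'_def image_image)
    also have "\<dots> = a ` Suc ` {..<r}"
      by (simp only: image_Suc_lessThan permutes_image[OF \<sigma>])
    also have "\<dots> = c ` {..<r}"
      by (auto simp: ca image_image)
    finally have gens: "c' ` {..<r} = c ` {..<r}" .
    have "colon_elem M (ideal_smult A (Idl\<^bsub>A\<^esub> (c' ` {..<r - 1})) M) (c' (r - 1)) \<subseteq> ?X <+>\<^bsub>M\<^esub> ann_power (Suc m)"
    proof (rule perm.fiber_eq_imp_colon_subset[unfolded gens, OF _ r X(1)])
      show "finite_colength (ideal_act A gen_ideal M T)" "ideal_act A gen_ideal M T \<subseteq> ?X"
        using fin X(2) by (simp_all add: act_genideal_eq_Q)
      show "colength (ideal_act A (ideal_power A gen_ideal (Suc m)) M ?X)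
          - colength (ideal_act A (ideal_power A gen_ideal (Suc m)) M T)
        = int ((m + r) choose (r - 1)) * colength (?X <+>\<^bsub>M\<^esub> ann_power (Suc m))"
        unfolding act_power_eq_pw[OF X(1)] act_power_eq_pw[OF submodule_carrier] by (rule eq)
    qed
    moreover have "seq_ideal A (a \<circ> \<sigma>) (r - 1) = Idl\<^bsub>A\<^esub> (c' ` {..<r - 1})"
      by (rule perm.seq_ideal_eq) (simp add: c'_def less_diff_conv)
    moreover have "c' (r - 1) = a (\<sigma> r)"
      using r by (simp add: c'_def)
    ultimately show "colon_elem M (ideal_smult A (seq_ideal A (a \<circ> \<sigma>) (r - 1)) M) (a (\<sigma> r))
        \<subseteq> ?X <+>\<^bsub>M\<^esub> ann_power (Suc m)"
      by simp
  qed
  let ?len = "\<lambda>n. len A (quot_module M (ideal_smult A (ideal_power A \<aa> (n + 1)) M))"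
  let ?tors = "\<Union>k\<in>{1..}. colon_ideal M {\<zero>\<^bsub>M\<^esub>} (ideal_power A \<mm> k)"
  let ?perm = "\<forall>\<sigma>. \<sigma> permutes {1..r} \<longrightarrow>
    colon_elem M (ideal_smult A (seq_ideal A (a \<circ> \<sigma>) (r - 1)) M) (a (\<sigma> r)) \<subseteq> ?X <+>\<^bsub>M\<^esub> ?tors"
  let ?red = "\<exists>n\<ge>1. pw n ?X = ?ap (n + 1)"
  have bound: "module_length A (quot_module M (ideal_smult A (ideal_power A \<aa> (n + 1)) M)) < \<infinity> \<and>
      ?len n \<le> length_bound A M \<aa> a r n" for n
  proof
    show "module_length A (quot_module M (ideal_smult A (ideal_power A \<aa> (n + 1)) M)) < \<infinity>"
      using finite_colength_ap[OF ctx, of n] unfolding ideal_smult_eq_act Suc_eq_plus1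
      by (simp only: finite_colength_iff[OF submodule_ap[OF ctx]])
    show "?len n \<le> length_bound A M \<aa> a r n"
    proof (cases n)
      case 0
      \<comment> \<open>For n = 0 the bound is l(M/\<aa>M) + e_r, and e_r is nonnegative.\<close>
      have "colength (Q r T <+>\<^bsub>M\<^esub> colon 0 (Q 0 T)) \<le> colength (Q r T)"
        by (intro colength_mono[OF fin] join_upper1) auto
      moreover have "?ap 1 = ?X"
        using ap_Suc[OF ctx, of 0] unfolding ideal_power_0 act_carrier[OF submodule_carrier] by simp
      ultimately show ?thesis
        unfolding len 0 lb(2) by simp
    next
      case (Suc m)
      show ?thesis
        unfolding len Suc lb(1) using length_le_bound(1)[OF ctx, of m] by (simp only: add_Suc_right add_0_right One_nat_def)
    qed
  qed
  have forward: "?red \<and> absolutely_superficial A M a r \<and> ?perm"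
    if inf: "infinite {n. ?len n = length_bound A M \<aa> a r n}"
  proof -
    \<comment> \<open>The index n = 0 lies outside \<open>eq_iff\<close>; removing it keeps the set
      infinite.\<close>
    have "{n. ?len n = length_bound A M \<aa> a r n}
        \<subseteq> insert 0 (Suc ` {m. ?len (Suc m) = length_bound A M \<aa> a r (Suc m)})"
    proof
      fix n assume "n \<in> {n. ?len n = length_bound A M \<aa> a r n}"
      then show "n \<in> insert 0 (Suc ` {m. ?len (Suc m) = length_bound A M \<aa> a r (Suc m)})"
        by (cases n) (simp_all only: mem_Collect_eq insertI1 insertI2 imageI)
    qed
    then have inf': "infinite {m. ?len (Suc m) = length_bound A M \<aa> a r (Suc m)}"
      using inf by (meson finite_imageI finite_insert finite_subset)
    \<comment> \<open>This single m yields (i) and (iii); for (ii) all degrees are required, hence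
      infinitely many m.\<close>
    then obtain m where m: "?len (Suc m) = length_bound A M \<aa> a r (Suc m)"
      using not_finite_existsD by blast
    have E: "graded_regular_upto k" for k
    proof (rule infinitely_many_hilbert_eq[OF ctx])
      show "infinite {m. colength (pw (Suc m) T) = hilbert_bound m}"
        using inf' unfolding eq_iff by (rule contrapos_nn) (auto elim: rev_finite_subset)
    qed
    have ?red
      using m unfolding eq_iff by (intro exI[of _ "Suc m"]) simp
    moreover have "absolutely_superficial A M a r"
      unfolding superficial_iff using graded_regular_superficial_eq[OF E] by (metis le_refl)
    moreover have ?perm
      using colon_iff[of m] m join_mono[OF order_refl ann_power_subset[OF fin, of "Suc m"], of ?X]
      unfolding eq_iff by (meson order_trans)
    ultimately show ?thesis
      by blast
  qed
  have backward: "infinite {n. ?len n = length_bound A M \<aa> a r n}"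
    if conds: ?red "absolutely_superficial A M a r" ?perm
  proof -
    have D: relatively_regular
      using conds(2) unfolding superficial_iff by (intro superficial_imp_relatively_regular) blast
    have hilbert: "colength (pw (Suc m) T) = hilbert_bound m" for m
      using colength_pw_bound[OF fin, of m] relatively_regular_imp_graded[OF D] by blast
    \<comment> \<open>The transposition places c i last, so (iii) for \<tau> i concerns the
      coefficient of c i against all other generators.\<close>
    define \<tau> where "\<tau> i = Transposition.transpose (Suc i) r" for i
    define S where "S i = ideal_smult A (seq_ideal A (a \<circ> \<tau> i) (r - 1)) M" for i
    have \<tau>: "\<tau> i permutes {1..r}" if "i < r" for i
      using that unfolding \<tau>_def by (intro permutes_swap_id) auto
    have gens: "(a \<circ> \<tau> i) ` {1..r - 1} \<subseteq> carrier A" if "i < r" for i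
    proof -
      have "\<tau> i l \<in> {1..r}" if "l \<in> {1..r - 1}" for l
        using permutes_in_image[OF \<tau>[OF \<open>i < r\<close>], of l] that by auto
      then show ?thesis
        using assms(7) \<aa>c by auto
    qed
    have S: "submodule (S i) A M" if "i < r" for i
      unfolding S_def ideal_smult_eq_act seq_ideal_def
      using ideal.Icarr[OF A.genideal_ideal[OF gens[OF that]]] by (intro submodule_act) auto
    have scale_S: "scale j T \<subseteq> S i" if ij: "i < r" "j < r" "i \<noteq> j" for i j
    proof -
      \<comment> \<open>As \<tau> i is an involution, a (j + 1) stands at position \<tau> i (j + 1),
        which differs from r because j differs from i.\<close>
      have "\<tau> i (Suc j) \<in> {1..r - 1}"
        using ij by (auto simp: \<tau>_def Transposition.transpose_def)
      then have "(a \<circ> \<tau> i) (\<tau> i (Suc j)) \<in> seq_ideal A (a \<circ> \<tau> i) (r - 1)"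
        unfolding seq_ideal_def using A.genideal_self[OF gens[OF ij(1)]] by blast
      then have "c j \<in> seq_ideal A (a \<circ> \<tau> i) (r - 1)"
        using ca[OF ij(2)] by (simp add: \<tau>_def)
      then show ?thesis
        unfolding S_def ideal_smult_eq_act by (auto intro: act_mem)
    qed
    have colon_S: "colon i (S i) \<subseteq> ?X <+>\<^bsub>M\<^esub> ?tors" if "i < r" for i
      using conds(3)[rule_format, OF \<tau>[OF that]] ca[OF that] by (simp add: S_def \<tau>_def)
    have fiber: "?fiber m" for m
      by (rule fiber_eqI[OF ctx D, where S = S]) (fact S scale_S colon_S)+
    obtain n where n: "1 \<le> n" "pw n ?X = ?ap (Suc n)"
      using conds(1) by auto
    \<comment> \<open>The reduction equality persists from n on and the other two gaps vanish for
      every m, so equality holds at all large indices.\<close>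
    have "?len (Suc m) = length_bound A M \<aa> a r (Suc m)" if "n \<le> m" for m
      unfolding eq_iff using that
      by (intro conjI reduction_stable[OF ctx n] hilbert fiber le_SucI)
    then have "Suc ` {n..} \<subseteq> {n. ?len n = length_bound A M \<aa> a r n}"
      by auto
    then show ?thesis
      using infinite_Ici[of n] by (meson finite_imageD finite_subset inj_Suc inj_on_subset subset_UNIV)
  qed
  show ?thesis
    unfolding power_eq ideal_smult_eq_act[of A \<aa>]
    using bound forward backward unfolding ideal_smult_eq_act by blast
qed

end
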